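(* For each standard positive integer $k$, the system $\mathsf{ACA}_0$ proves the following statement: for every coloring $c:\mathbf{N}\to\{0,1\}$ there exist an infinite apart set $H$ of positive integers and positive integers $a,b$ such that $FS^{\{a,\,a+b,\,a+2b,\dots,a+(k-1)b\}\cup\{b\}}(H)$ is monochromatic under $c$.
   Context: $\mathsf{ACA}_0$ is the subsystem of second-order arithmetic with arithmetical comprehension. For a positive integer $n=2^{t_1}+\dots+2^{t_m}$ with $t_1<\dots<t_m$ let $\lambda(n)=t_1$ and $\mu(n)=t_m$. A set $X$ of positive integers is apart (satisfies the Apartness Condition) if for all $x,x'\in X$ with $x<x'$ we have $\mu(x)<\lambda(x')$. For a set $A$ of positive integers and a set $B\subseteq\mathbf{N}$, $FS^{A}(B)$ denotes the set of all sums of exactly $j$ distinct elements of $B$, for all $j\in A$. A set is monochromatic under $c$ if $c$ is constant on it. The displayed statement is understood in its natural formalization in the language of second-order arithmetic. "Standard" means that $k$ is a fixed actual positive integer of the metatheory. *)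

theory Defs
  imports Main
begin

section \<open>The language of second-order arithmetic\<close>

text \<open>
  Both sorts of variables are de Bruijn indices, and the two sorts are counted independently:
  a number quantifier does not shift the set variables, nor conversely. Equality of sets is not
  primitive, and the only set terms are set variables.
\<close>

datatype tm = V nat | Zero | One | Add tm tm (infixl "\<^bold>+" 65) | Mul tm tm (infixl "\<^bold>*" 70)

datatype fm =
    Bot ("\<^bold>\<bottom>")
  | Eq tm tm (infix "\<^bold>=" 50)
  | Less tm tm (infix "\<^bold><" 50)
  | Mem tm nat (infix "\<^bold>\<in>" 50)
  | Imp fm fm (infixr "\<^bold>\<longrightarrow>" 25)
  | AllN fm ("(\<^bold>\<forall>\<^sup>0 _)" [10] 10)
  | AllS fm ("(\<^bold>\<forall>\<^sup>1 _)" [10] 10)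

abbreviation Neg :: "fm \<Rightarrow> fm" ("\<^bold>\<not> _" [40] 40)
  where "\<^bold>\<not> p \<equiv> p \<^bold>\<longrightarrow> \<^bold>\<bottom>"
abbreviation Conj :: "fm \<Rightarrow> fm \<Rightarrow> fm" (infixr "\<^bold>\<and>" 35)
  where "p \<^bold>\<and> q \<equiv> \<^bold>\<not> (p \<^bold>\<longrightarrow> \<^bold>\<not> q)"
abbreviation Disj :: "fm \<Rightarrow> fm \<Rightarrow> fm" (infixr "\<^bold>\<or>" 30)
  where "p \<^bold>\<or> q \<equiv> \<^bold>\<not> p \<^bold>\<longrightarrow> q"
abbreviation Iff :: "fm \<Rightarrow> fm \<Rightarrow> fm" (infix "\<^bold>\<longleftrightarrow>" 25)
  where "p \<^bold>\<longleftrightarrow> q \<equiv> (p \<^bold>\<longrightarrow> q) \<^bold>\<and> (q \<^bold>\<longrightarrow> p)"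
abbreviation ExN :: "fm \<Rightarrow> fm" ("(\<^bold>\<exists>\<^sup>0 _)" [10] 10)
  where "\<^bold>\<exists>\<^sup>0 p \<equiv> \<^bold>\<not> (\<^bold>\<forall>\<^sup>0 \<^bold>\<not> p)"
abbreviation ExS :: "fm \<Rightarrow> fm" ("(\<^bold>\<exists>\<^sup>1 _)" [10] 10)
  where "\<^bold>\<exists>\<^sup>1 p \<equiv> \<^bold>\<not> (\<^bold>\<forall>\<^sup>1 \<^bold>\<not> p)"

primrec substT :: "(nat \<Rightarrow> tm) \<Rightarrow> tm \<Rightarrow> tm" where
  "substT \<sigma> (V n) = \<sigma> n"
| "substT \<sigma> Zero = Zero"
| "substT \<sigma> One = One"
| "substT \<sigma> (s \<^bold>+ t) = substT \<sigma> s \<^bold>+ substT \<sigma> t"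
| "substT \<sigma> (s \<^bold>* t) = substT \<sigma> s \<^bold>* substT \<sigma> t"

abbreviation upT :: "nat \<Rightarrow> tm \<Rightarrow> tm"
  where "upT k t \<equiv> substT (\<lambda>n. V (n + k)) t"

text \<open>Simultaneous capture-avoiding substitution of terms for number variables (\<open>\<sigma>\<close>) and of
  set variables for set variables (\<open>\<rho>\<close>).\<close>

primrec subst :: "(nat \<Rightarrow> tm) \<Rightarrow> (nat \<Rightarrow> nat) \<Rightarrow> fm \<Rightarrow> fm" where
  "subst \<sigma> \<rho> \<^bold>\<bottom> = \<^bold>\<bottom>"
| "subst \<sigma> \<rho> (s \<^bold>= t) = (substT \<sigma> s \<^bold>= substT \<sigma> t)"
| "subst \<sigma> \<rho> (s \<^bold>< t) = (substT \<sigma> s \<^bold>< substT \<sigma> t)"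
| "subst \<sigma> \<rho> (t \<^bold>\<in> X) = (substT \<sigma> t \<^bold>\<in> \<rho> X)"
| "subst \<sigma> \<rho> (p \<^bold>\<longrightarrow> q) = (subst \<sigma> \<rho> p \<^bold>\<longrightarrow> subst \<sigma> \<rho> q)"
| "subst \<sigma> \<rho> (\<^bold>\<forall>\<^sup>0 p) = (\<^bold>\<forall>\<^sup>0 subst (case_nat (V 0) (\<lambda>n. upT 1 (\<sigma> n))) \<rho> p)"
| "subst \<sigma> \<rho> (\<^bold>\<forall>\<^sup>1 p) = (\<^bold>\<forall>\<^sup>1 subst \<sigma> (case_nat 0 (\<lambda>n. Suc (\<rho> n))) p)"

definition liftN :: "fm \<Rightarrow> fm" where "liftN p = subst (\<lambda>n. V (Suc n)) id p"
definition liftS :: "fm \<Rightarrow> fm" where "liftS p = subst V Suc p"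
definition instN :: "tm \<Rightarrow> fm \<Rightarrow> fm" where "instN t p = subst (case_nat t V) id p"
definition instS :: "nat \<Rightarrow> fm \<Rightarrow> fm" where "instS X p = subst V (case_nat X id) p"

primrec arithmetical :: "fm \<Rightarrow> bool" where
  "arithmetical \<^bold>\<bottom> = True"
| "arithmetical (s \<^bold>= t) = True"
| "arithmetical (s \<^bold>< t) = True"
| "arithmetical (t \<^bold>\<in> X) = True"
| "arithmetical (p \<^bold>\<longrightarrow> q) = (arithmetical p \<and> arithmetical q)"
| "arithmetical (\<^bold>\<forall>\<^sup>0 p) = arithmetical p"
| "arithmetical (\<^bold>\<forall>\<^sup>1 p) = False"


section \<open>Provability\<close>

text \<open>
  Natural deduction for classical two-sorted first-order logic with equality. Non-logical axioms
  are available under any list of hypotheses, so the eigenvariable condition of the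
  \<open>\<forall>\<close>-introduction rules does not concern them: an axiom with free variables stands for its
  universal closure.
\<close>

inductive deriv :: "fm set \<Rightarrow> fm list \<Rightarrow> fm \<Rightarrow> bool" for T :: "fm set" where
  Ax: "p \<in> T \<Longrightarrow> deriv T \<Gamma> p"
| Hyp: "p \<in> set \<Gamma> \<Longrightarrow> deriv T \<Gamma> p"
| ImpI: "deriv T (p # \<Gamma>) q \<Longrightarrow> deriv T \<Gamma> (p \<^bold>\<longrightarrow> q)"
| ImpE: "deriv T \<Gamma> (p \<^bold>\<longrightarrow> q) \<Longrightarrow> deriv T \<Gamma> p \<Longrightarrow> deriv T \<Gamma> q"
| RAA: "deriv T ((\<^bold>\<not> p) # \<Gamma>) \<^bold>\<bottom> \<Longrightarrow> deriv T \<Gamma> p"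
| AllNI: "deriv T (map liftN \<Gamma>) p \<Longrightarrow> deriv T \<Gamma> (\<^bold>\<forall>\<^sup>0 p)"
| AllNE: "deriv T \<Gamma> (\<^bold>\<forall>\<^sup>0 p) \<Longrightarrow> deriv T \<Gamma> (instN t p)"
| AllSI: "deriv T (map liftS \<Gamma>) p \<Longrightarrow> deriv T \<Gamma> (\<^bold>\<forall>\<^sup>1 p)"
| AllSE: "deriv T \<Gamma> (\<^bold>\<forall>\<^sup>1 p) \<Longrightarrow> deriv T \<Gamma> (instS X p)"
| EqRefl: "deriv T \<Gamma> (t \<^bold>= t)"
| EqSubst: "deriv T \<Gamma> (s \<^bold>= t) \<Longrightarrow> deriv T \<Gamma> (instN s p) \<Longrightarrow> deriv T \<Gamma> (instN t p)"

definition proves :: "fm set \<Rightarrow> fm \<Rightarrow> bool" (infix "\<turnstile>" 50)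
  where "T \<turnstile> p \<longleftrightarrow> deriv T [] p"


section \<open>The system $\mathsf{ACA}_0$\<close>

definition basic_axioms :: "fm set" where
  "basic_axioms = {
     \<^bold>\<not> (V 0 \<^bold>+ One \<^bold>= Zero),
     V 0 \<^bold>+ One \<^bold>= V 1 \<^bold>+ One \<^bold>\<longrightarrow> V 0 \<^bold>= V 1,
     V 0 \<^bold>+ Zero \<^bold>= V 0,
     V 0 \<^bold>+ (V 1 \<^bold>+ One) \<^bold>= (V 0 \<^bold>+ V 1) \<^bold>+ One,
     V 0 \<^bold>* Zero \<^bold>= Zero,
     V 0 \<^bold>* (V 1 \<^bold>+ One) \<^bold>= (V 0 \<^bold>* V 1) \<^bold>+ V 0,
     \<^bold>\<not> (V 0 \<^bold>< Zero),
     V 0 \<^bold>< V 1 \<^bold>+ One \<^bold>\<longleftrightarrow> (V 0 \<^bold>< V 1 \<^bold>\<or> V 0 \<^bold>= V 1) }"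

definition induction_axiom :: fm where
  "induction_axiom =
     (Zero \<^bold>\<in> 0 \<^bold>\<and> (\<^bold>\<forall>\<^sup>0 V 0 \<^bold>\<in> 0 \<^bold>\<longrightarrow> V 0 \<^bold>+ One \<^bold>\<in> 0) \<^bold>\<longrightarrow> (\<^bold>\<forall>\<^sup>0 V 0 \<^bold>\<in> 0))"

text \<open>In \<open>p\<close>, the number variable \<open>V 0\<close> is the one the set is formed over; all others, and all
  set variables, are parameters. The lifting keeps the set being defined from occurring in \<open>p\<close>.\<close>

definition comprehension :: "fm \<Rightarrow> fm" where
  "comprehension p = (\<^bold>\<exists>\<^sup>1 \<^bold>\<forall>\<^sup>0 V 0 \<^bold>\<in> 0 \<^bold>\<longleftrightarrow> liftS p)"

definition ACA0 :: "fm set" where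
  "ACA0 = basic_axioms \<union> {induction_axiom} \<union> {comprehension p | p. arithmetical p}"


section \<open>Formalizing the combinatorial statement\<close>

text \<open>
  A term argument \<open>t\<close> of a definition lives in the context outside the formula being built,
  hence it occurs as \<open>upT k t\<close> under \<open>k\<close> number quantifiers.

  Finite sequences of numbers are coded by Goedel's \<open>\<beta>\<close> function: a pair \<open>c, d\<close> codes the
  sequence whose \<open>i\<close>-th entry (counting from 0) is the remainder of \<open>c\<close> modulo \<open>(i + 1) d + 1\<close>;
  the length is given separately.
\<close>

primrec num :: "nat \<Rightarrow> tm" where
  "num 0 = Zero"
| "num (Suc n) = num n \<^bold>+ One"

\<comment> \<open>\<open>\<beta>(c,d,i) = x\<close>\<close>
definition Beta :: "tm \<Rightarrow> tm \<Rightarrow> tm \<Rightarrow> tm \<Rightarrow> fm" where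
  "Beta c d i x = (let m = (i \<^bold>+ One) \<^bold>* d \<^bold>+ One in
     x \<^bold>< m \<^bold>\<and> (\<^bold>\<exists>\<^sup>0 upT 1 c \<^bold>= V 0 \<^bold>* upT 1 m \<^bold>+ upT 1 x))"

\<comment> \<open>the first \<open>j\<close> entries of the sequence \<open>c, d\<close> sum to \<open>n\<close>;
   \<open>V 1, V 0\<close> (\<open>V 4, V 3\<close> in the scope of all quantifiers) code the sequence of partial sums\<close>
definition SeqSum :: "tm \<Rightarrow> tm \<Rightarrow> tm \<Rightarrow> tm \<Rightarrow> fm" where
  "SeqSum c d j n = (\<^bold>\<exists>\<^sup>0 \<^bold>\<exists>\<^sup>0
     Beta (V 1) (V 0) Zero Zero \<^bold>\<and>
     (\<^bold>\<forall>\<^sup>0 V 0 \<^bold>< upT 3 j \<^bold>\<longrightarrow> (\<^bold>\<exists>\<^sup>0 \<^bold>\<exists>\<^sup>0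
        Beta (upT 5 c) (upT 5 d) (V 2) (V 1) \<^bold>\<and>
        Beta (V 4) (V 3) (V 2) (V 0) \<^bold>\<and>
        Beta (V 4) (V 3) (V 2 \<^bold>+ One) (V 0 \<^bold>+ V 1))) \<^bold>\<and>
     Beta (V 1) (V 0) (upT 2 j) (upT 2 n))"

\<comment> \<open>\<open>2\<^sup>t = p\<close>\<close>
definition Pow2 :: "tm \<Rightarrow> tm \<Rightarrow> fm" where
  "Pow2 t p = (\<^bold>\<exists>\<^sup>0 \<^bold>\<exists>\<^sup>0
     Beta (V 1) (V 0) Zero One \<^bold>\<and>
     (\<^bold>\<forall>\<^sup>0 V 0 \<^bold>< upT 3 t \<^bold>\<longrightarrow> (\<^bold>\<exists>\<^sup>0
        Beta (V 3) (V 2) (V 1) (V 0) \<^bold>\<and>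
        Beta (V 3) (V 2) (V 1 \<^bold>+ One) (num 2 \<^bold>* V 0))) \<^bold>\<and>
     Beta (V 1) (V 0) (upT 2 t) (upT 2 p))"

\<comment> \<open>\<open>n\<close> is the sum of the \<open>2\<close>-powers whose exponents are the first \<open>m\<close> entries of \<open>c, d\<close>, and
   these exponents are strictly increasing\<close>
definition BinExp :: "tm \<Rightarrow> tm \<Rightarrow> tm \<Rightarrow> tm \<Rightarrow> fm" where
  "BinExp n m c d =
     ((\<^bold>\<forall>\<^sup>0 \<^bold>\<forall>\<^sup>0 V 0 \<^bold>< V 1 \<^bold>\<and> V 1 \<^bold>< upT 2 m \<^bold>\<longrightarrow> (\<^bold>\<exists>\<^sup>0 \<^bold>\<exists>\<^sup>0
         Beta (upT 4 c) (upT 4 d) (V 2) (V 1) \<^bold>\<and>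
         Beta (upT 4 c) (upT 4 d) (V 3) (V 0) \<^bold>\<and>
         V 1 \<^bold>< V 0)) \<^bold>\<and>
      (\<^bold>\<exists>\<^sup>0 \<^bold>\<exists>\<^sup>0
         (\<^bold>\<forall>\<^sup>0 V 0 \<^bold>< upT 3 m \<^bold>\<longrightarrow> (\<^bold>\<exists>\<^sup>0 \<^bold>\<exists>\<^sup>0
            Beta (upT 5 c) (upT 5 d) (V 2) (V 1) \<^bold>\<and>
            Beta (V 4) (V 3) (V 2) (V 0) \<^bold>\<and>
            Pow2 (V 1) (V 0))) \<^bold>\<and>
         SeqSum (V 1) (V 0) (upT 2 m) (upT 2 n)))"

\<comment> \<open>\<open>\<lambda>(n) = l\<close>\<close>
definition Lambda :: "tm \<Rightarrow> tm \<Rightarrow> fm" where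
  "Lambda n l = (\<^bold>\<exists>\<^sup>0 \<^bold>\<exists>\<^sup>0 \<^bold>\<exists>\<^sup>0
     BinExp (upT 3 n) (V 2 \<^bold>+ One) (V 1) (V 0) \<^bold>\<and> Beta (V 1) (V 0) Zero (upT 3 l))"

\<comment> \<open>\<open>\<mu>(n) = u\<close>\<close>
definition Mu :: "tm \<Rightarrow> tm \<Rightarrow> fm" where
  "Mu n u = (\<^bold>\<exists>\<^sup>0 \<^bold>\<exists>\<^sup>0 \<^bold>\<exists>\<^sup>0
     BinExp (upT 3 n) (V 2 \<^bold>+ One) (V 1) (V 0) \<^bold>\<and> Beta (V 1) (V 0) (V 2) (upT 3 u))"

definition Apart :: "nat \<Rightarrow> fm" where
  "Apart X = (\<^bold>\<forall>\<^sup>0 \<^bold>\<forall>\<^sup>0 V 1 \<^bold>\<in> X \<^bold>\<and> V 0 \<^bold>\<in> X \<^bold>\<and> V 1 \<^bold>< V 0 \<^bold>\<longrightarrow>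
     (\<^bold>\<exists>\<^sup>0 \<^bold>\<exists>\<^sup>0 Mu (V 3) (V 1) \<^bold>\<and> Lambda (V 2) (V 0) \<^bold>\<and> V 1 \<^bold>< V 0))"

definition Positive :: "nat \<Rightarrow> fm" where
  "Positive X = (\<^bold>\<forall>\<^sup>0 V 0 \<^bold>\<in> X \<^bold>\<longrightarrow> Zero \<^bold>< V 0)"

definition Infinite :: "nat \<Rightarrow> fm" where
  "Infinite X = (\<^bold>\<forall>\<^sup>0 \<^bold>\<exists>\<^sup>0 V 0 \<^bold>\<in> X \<^bold>\<and> V 1 \<^bold>< V 0)"

\<comment> \<open>\<open>n\<close> is the sum of \<open>j\<close> distinct elements of \<open>X\<close>\<close>
definition SumOf :: "tm \<Rightarrow> nat \<Rightarrow> tm \<Rightarrow> fm" where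
  "SumOf j X n = (\<^bold>\<exists>\<^sup>0 \<^bold>\<exists>\<^sup>0
     (\<^bold>\<forall>\<^sup>0 V 0 \<^bold>< upT 3 j \<^bold>\<longrightarrow> (\<^bold>\<exists>\<^sup>0 Beta (V 3) (V 2) (V 1) (V 0) \<^bold>\<and> V 0 \<^bold>\<in> X)) \<^bold>\<and>
     (\<^bold>\<forall>\<^sup>0 \<^bold>\<forall>\<^sup>0 V 0 \<^bold>< V 1 \<^bold>\<and> V 1 \<^bold>< upT 4 j \<^bold>\<longrightarrow> (\<^bold>\<exists>\<^sup>0 \<^bold>\<exists>\<^sup>0
        Beta (V 5) (V 4) (V 2) (V 1) \<^bold>\<and>
        Beta (V 5) (V 4) (V 3) (V 0) \<^bold>\<and>
        \<^bold>\<not> (V 1 \<^bold>= V 0))) \<^bold>\<and>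
     SeqSum (V 1) (V 0) (upT 2 j) (upT 2 n))"

\<comment> \<open>\<open>n \<in> FS\<^sup>A(X)\<close>, where \<open>A\<close> is given by a formula in which \<open>V 0\<close> stands for the element and which
   is placed below one number quantifier\<close>
definition FS :: "fm \<Rightarrow> nat \<Rightarrow> tm \<Rightarrow> fm" where
  "FS A X n = (\<^bold>\<exists>\<^sup>0 A \<^bold>\<and> SumOf (V 0) X (upT 1 n))"

\<comment> \<open>\<open>j \<in> {a, a + b, \<dots>, a + (k - 1) b} \<union> {b}\<close>\<close>
definition AP :: "nat \<Rightarrow> tm \<Rightarrow> tm \<Rightarrow> tm \<Rightarrow> fm" where
  "AP k a b j = ((\<^bold>\<exists>\<^sup>0 V 0 \<^bold>< num k \<^bold>\<and> upT 1 j \<^bold>= upT 1 a \<^bold>+ V 0 \<^bold>* upT 1 b) \<^bold>\<or> j \<^bold>= b)"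

definition pair :: "tm \<Rightarrow> tm \<Rightarrow> tm" where
  "pair s t = (s \<^bold>+ t) \<^bold>* (s \<^bold>+ t) \<^bold>+ s"

\<comment> \<open>\<open>c\<close> is (the graph of) a function from \<open>\<nat>\<close> to \<open>{0, 1}\<close>\<close>
definition Coloring :: "nat \<Rightarrow> fm" where
  "Coloring c =
     ((\<^bold>\<forall>\<^sup>0 V 0 \<^bold>\<in> c \<^bold>\<longrightarrow> (\<^bold>\<exists>\<^sup>0 \<^bold>\<exists>\<^sup>0 V 0 \<^bold>< num 2 \<^bold>\<and> V 2 \<^bold>= pair (V 1) (V 0))) \<^bold>\<and>
      (\<^bold>\<forall>\<^sup>0 \<^bold>\<exists>\<^sup>0 pair (V 1) (V 0) \<^bold>\<in> c \<^bold>\<and> (\<^bold>\<forall>\<^sup>0 pair (V 2) (V 0) \<^bold>\<in> c \<^bold>\<longrightarrow> V 0 \<^bold>= V 1)))"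

\<comment> \<open>\<open>c\<close> is constant on the set given by the formula \<open>S\<close>, which is placed below two number
   quantifiers: \<open>V 0\<close> is the element and \<open>V 1\<close> the common value\<close>
definition Monochromatic :: "nat \<Rightarrow> fm \<Rightarrow> fm" where
  "Monochromatic c S = (\<^bold>\<exists>\<^sup>0 \<^bold>\<forall>\<^sup>0 S \<^bold>\<longrightarrow> pair (V 0) (V 1) \<^bold>\<in> c)"

\<comment> \<open>The set variable \<open>1\<close> is the coloring and \<open>0\<close> is \<open>H\<close>. The numbers \<open>a, b\<close> are \<open>V 1, V 0\<close>,
   which below the three number quantifiers of \<open>Monochromatic\<close> and \<open>FS\<close> are \<open>V 4, V 3\<close>.\<close>
definition FS_AP_statement :: "nat \<Rightarrow> fm" where
  "FS_AP_statement k = (\<^bold>\<forall>\<^sup>1 Coloring 0 \<^bold>\<longrightarrow>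
     (\<^bold>\<exists>\<^sup>1 Infinite 0 \<^bold>\<and> Positive 0 \<^bold>\<and> Apart 0 \<^bold>\<and>
       (\<^bold>\<exists>\<^sup>0 \<^bold>\<exists>\<^sup>0 Zero \<^bold>< V 1 \<^bold>\<and> Zero \<^bold>< V 0 \<^bold>\<and>
         Monochromatic 1 (FS (AP k (V 4) (V 3) (V 0)) 0 (V 0)))))"

end

theory Submission
  imports Defs "HOL-Library.Countable_Set"
begin

text \<open>By the completeness theorem it suffices to argue inside an arbitrary countable model of
  $\mathsf{ACA}_0$, where a set exists as soon as it is arithmetically definable from sets of the model.
  Let \<open>H\<close> be an infinite set of powers of \<open>2\<close>, which makes it apart, such that for every \<open>j < N\<close> all
  sums of \<open>j\<close> distinct elements of \<open>H\<close> have the same colour \<open>v j\<close>; this is Ramsey's theorem for the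
  standard exponents below the standard number \<open>N\<close>. Brauer's theorem (van der Waerden with the
  difference in the same colour), which is used outside the model, applied to \<open>v\<close> yields \<open>a\<close> and \<open>b\<close>.

  As the colour of a tuple depends only on its sum, the induction on the exponent can be carried out with
  colourings of numbers: if \<open>Y\<close> is such that for each \<open>s\<close> the colour of \<open>s + y\<close> is eventually
  constant for \<open>y \<in> Y\<close>, the limit colours form a colouring of the numbers \<open>s\<close>.\<close>

text \<open>Standardness of \<open>k\<close> is what keeps the argument within ACA0: Ramsey's
  theorem for all exponents at once is not provable there, but for exponents below a fixed standard
  \<open>N\<close> it needs only fixedly many applications of arithmetical comprehension, carried
  out by an ordinary induction on \<open>nat\<close> outside the model. \<open>N\<close> has to come
  first, since \<open>H\<close> depends on \<open>N\<close> and \<open>v\<close> depends on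
  \<open>H\<close>; so Brauer's theorem is used in its finite form, with a bound that is good for
  every \<open>v\<close>. The restriction to powers of 2 costs nothing: the least and the greatest
  exponent of such a number coincide, so apartness is just growth of exponents, and Ramsey's
  argument works inside any unbounded set. The obstacle inside the model is that induction holds
  only for predicates arithmetical in sets of the model, and that its bounded sets may be infinite
  from outside. Hence a calculus of definability accompanies every induction, sequences must be
  coded before anything can be defined by recursion, and bounds are combined by induction instead of
  by finiteness.\<close>

section \<open>Henkin semantics of the two-sorted language\<close>

primrec eval :: "'a \<Rightarrow> 'a \<Rightarrow> ('a \<Rightarrow> 'a \<Rightarrow> 'a) \<Rightarrow> ('a \<Rightarrow> 'a \<Rightarrow> 'a) \<Rightarrow> (nat \<Rightarrow> 'a) \<Rightarrow> tm \<Rightarrow> 'a" where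
  "eval z u p m e (V n) = e n"
| "eval z u p m e Zero = z"
| "eval z u p m e One = u"
| "eval z u p m e (s \<^bold>+ t) = p (eval z u p m e s) (eval z u p m e t)"
| "eval z u p m e (s \<^bold>* t) = m (eval z u p m e s) (eval z u p m e t)"

text \<open>The number domain is the whole type, so that type classes can later describe it. Set
  quantifiers range over \<open>setsS\<close> only, which is what makes the logic complete.\<close>

datatype 'a interp =
  Interp (zeroS: 'a) (oneS: 'a) (addS: "'a \<Rightarrow> 'a \<Rightarrow> 'a") (mulS: "'a \<Rightarrow> 'a \<Rightarrow> 'a")
    (lessS: "'a \<Rightarrow> 'a \<Rightarrow> bool") (setsS: "'a set set")

abbreviation evalS :: "'a interp \<Rightarrow> (nat \<Rightarrow> 'a) \<Rightarrow> tm \<Rightarrow> 'a"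
  where "evalS M \<equiv> eval (zeroS M) (oneS M) (addS M) (mulS M)"

primrec sat :: "'a interp \<Rightarrow> (nat \<Rightarrow> 'a) \<Rightarrow> (nat \<Rightarrow> 'a set) \<Rightarrow> fm \<Rightarrow> bool" where
  "sat M e s \<^bold>\<bottom> \<longleftrightarrow> False"
| "sat M e s (t \<^bold>= u) \<longleftrightarrow> evalS M e t = evalS M e u"
| "sat M e s (t \<^bold>< u) \<longleftrightarrow> lessS M (evalS M e t) (evalS M e u)"
| "sat M e s (t \<^bold>\<in> X) \<longleftrightarrow> evalS M e t \<in> s X"
| "sat M e s (p \<^bold>\<longrightarrow> q) \<longleftrightarrow> (sat M e s p \<longrightarrow> sat M e s q)"
| "sat M e s (\<^bold>\<forall>\<^sup>0 p) \<longleftrightarrow> (\<forall>x. sat M (case_nat x e) s p)"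
| "sat M e s (\<^bold>\<forall>\<^sup>1 p) \<longleftrightarrow> (\<forall>A\<in>setsS M. sat M e (case_nat A s) p)"

definition valid :: "'a interp \<Rightarrow> fm \<Rightarrow> bool" where
  "valid M p \<longleftrightarrow> (\<forall>e s. range s \<subseteq> setsS M \<longrightarrow> sat M e s p)"

subsection \<open>Substitution\<close>

abbreviation upN :: "(nat \<Rightarrow> tm) \<Rightarrow> nat \<Rightarrow> tm"
  where "upN \<sigma> \<equiv> case_nat (V 0) (\<lambda>n. substT (\<lambda>n. V (Suc n)) (\<sigma> n))"

abbreviation upS :: "(nat \<Rightarrow> nat) \<Rightarrow> nat \<Rightarrow> nat"
  where "upS \<rho> \<equiv> case_nat 0 (\<lambda>n. Suc (\<rho> n))"

lemma subst_AllN: "subst \<sigma> \<rho> (\<^bold>\<forall>\<^sup>0 p) = (\<^bold>\<forall>\<^sup>0 subst (upN \<sigma>) \<rho> p)"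
  by simp

lemma substT_V [simp]: "substT V t = t"
  by (induction t) auto

lemma substT_substT: "substT \<sigma> (substT \<tau> t) = substT (\<lambda>n. substT \<sigma> (\<tau> n)) t"
  by (induction t) auto

lemma eval_substT: "eval z u p m e (substT \<sigma> t) = eval z u p m (\<lambda>n. eval z u p m e (\<sigma> n)) t"
  by (induction t) auto

lemma upN_V [simp]: "upN V = V"
  by (auto simp: fun_eq_iff split: nat.split)

lemma upS_id [simp]: "upS id = id" "upS (\<lambda>n. n) = (\<lambda>n. n)"
  by (auto simp: fun_eq_iff split: nat.split)

lemma subst_id [simp]: "subst V id p = p" "subst V (\<lambda>n. n) p = p"
proof -
  show "subst V id p = p"
    by (induction p) (simp_all only: subst.simps(1-5,7) subst_AllN substT_V upN_V upS_id id_apply)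
  then show "subst V (\<lambda>n. n) p = p"
    by (simp add: id_def)
qed

lemma upN_comp: "(\<lambda>n. substT (upN \<sigma>) (upN \<tau> n)) = upN (\<lambda>n. substT \<sigma> (\<tau> n))"
  by (auto simp: fun_eq_iff substT_substT split: nat.split)

lemma upS_comp: "(\<lambda>n. upS \<rho> (upS \<pi> n)) = upS (\<lambda>n. \<rho> (\<pi> n))"
  by (auto simp: fun_eq_iff split: nat.split)

lemma subst_subst: "subst \<sigma> \<rho> (subst \<tau> \<pi> p) = subst (\<lambda>n. substT \<sigma> (\<tau> n)) (\<lambda>n. \<rho> (\<pi> n)) p"
  by (induction p arbitrary: \<sigma> \<rho> \<tau> \<pi>) (simp_all only: subst.simps(1-5,7) subst_AllN substT_substT upN_comp upS_comp)

lemma subst_liftN: "subst (upN \<sigma>) \<rho> (liftN p) = liftN (subst \<sigma> \<rho> p)"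
  by (simp add: liftN_def subst_subst id_def)

lemma subst_liftS: "subst \<sigma> (upS \<rho>) (liftS p) = liftS (subst \<sigma> \<rho> p)"
  by (simp add: liftS_def subst_subst)

lemma subst_instN: "subst \<sigma> \<rho> (instN t p) = instN (substT \<sigma> t) (subst (upN \<sigma>) \<rho> p)"
  by (auto simp: instN_def subst_subst substT_substT id_def fun_eq_iff
      intro!: arg_cong[where f = "\<lambda>\<sigma>. subst \<sigma> \<rho> p"] split: nat.split)

lemma subst_instS: "subst \<sigma> \<rho> (instS X p) = instS (\<rho> X) (subst \<sigma> (upS \<rho>) p)"
  by (auto simp: instS_def subst_subst fun_eq_iff
      intro!: arg_cong[where f = "\<lambda>\<rho>. subst \<sigma> \<rho> p"] split: nat.split)

lemma instN_upN: "instN t (subst (upN \<sigma>) \<rho> p) = subst (case_nat t \<sigma>) \<rho> p"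
  by (auto simp: instN_def subst_subst substT_substT id_def fun_eq_iff
      intro!: arg_cong[where f = "\<lambda>\<sigma>. subst \<sigma> \<rho> p"] split: nat.split)

lemma instS_upS: "instS X (subst \<sigma> (upS \<rho>) p) = subst \<sigma> (case_nat X \<rho>) p"
  by (auto simp: instS_def subst_subst fun_eq_iff
      intro!: arg_cong[where f = "\<lambda>\<rho>. subst \<sigma> \<rho> p"] split: nat.split)

lemma sat_subst:
  "sat M e s (subst \<sigma> \<rho> p) \<longleftrightarrow> sat M (\<lambda>n. evalS M e (\<sigma> n)) (\<lambda>n. s (\<rho> n)) p"
proof (induction p arbitrary: \<sigma> \<rho> e s)
  case (AllN p)
  have "(\<lambda>n. evalS M (case_nat x e) (upN \<sigma> n)) = case_nat x (\<lambda>n. evalS M e (\<sigma> n))" for x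
    by (auto simp: fun_eq_iff eval_substT split: nat.split)
  then show ?case
    by (simp only: sat.simps subst_AllN AllN)
next
  case (AllS p)
  have "(\<lambda>n. case_nat A s (upS \<rho> n)) = case_nat A (\<lambda>n. s (\<rho> n))" for A
    by (auto simp: fun_eq_iff split: nat.split)
  then show ?case
    by (simp only: sat.simps subst.simps AllS)
qed (simp_all add: eval_substT)

section \<open>Formulas depend on finitely many variables\<close>

lemma substT_bound: "\<exists>n. \<forall>\<sigma> \<sigma>'. (\<forall>i<n. \<sigma> i = \<sigma>' i) \<longrightarrow> substT \<sigma> t = substT \<sigma>' t"
proof (induction t)
  case (V n)
  show ?case by (rule exI[of _ "Suc n"]) auto
next
  case (Add s t)
  then obtain m n where "\<forall>\<sigma> \<sigma>'. (\<forall>i<m. \<sigma> i = \<sigma>' i) \<longrightarrow> substT \<sigma> s = substT \<sigma>' s"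
    "\<forall>\<sigma> \<sigma>'. (\<forall>i<n. \<sigma> i = \<sigma>' i) \<longrightarrow> substT \<sigma> t = substT \<sigma>' t" by (elim exE) (rule that)
  then have "\<forall>\<sigma> \<sigma>'. (\<forall>i<max m n. \<sigma> i = \<sigma>' i) \<longrightarrow> substT \<sigma> (s \<^bold>+ t) = substT \<sigma>' (s \<^bold>+ t)"
    by (simp add: less_max_iff_disj)
  then show ?case by blast
next
  case (Mul s t)
  then obtain m n where "\<forall>\<sigma> \<sigma>'. (\<forall>i<m. \<sigma> i = \<sigma>' i) \<longrightarrow> substT \<sigma> s = substT \<sigma>' s"
    "\<forall>\<sigma> \<sigma>'. (\<forall>i<n. \<sigma> i = \<sigma>' i) \<longrightarrow> substT \<sigma> t = substT \<sigma>' t" by (elim exE) (rule that)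
  then have "\<forall>\<sigma> \<sigma>'. (\<forall>i<max m n. \<sigma> i = \<sigma>' i) \<longrightarrow> substT \<sigma> (s \<^bold>* t) = substT \<sigma>' (s \<^bold>* t)"
    by (simp add: less_max_iff_disj)
  then show ?case by blast
qed auto

text \<open>Expresses that every free variable of either sort has index below \<open>n\<close>, in
  the form in which fresh variables are used later: substitutions may be changed from
  \<open>n\<close> on.\<close>

definition bounds :: "nat \<Rightarrow> fm \<Rightarrow> bool" where
  "bounds n p \<longleftrightarrow> (\<forall>\<sigma> \<sigma>' \<rho> \<rho>'. (\<forall>i<n. \<sigma> i = \<sigma>' i \<and> \<rho> i = \<rho>' i) \<longrightarrow> subst \<sigma> \<rho> p = subst \<sigma>' \<rho>' p)"

lemma boundsD:
  "bounds n p \<Longrightarrow> (\<And>i. i < n \<Longrightarrow> \<sigma> i = \<sigma>' i) \<Longrightarrow> (\<And>i. i < n \<Longrightarrow> \<rho> i = \<rho>' i) \<Longrightarrow>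
    subst \<sigma> \<rho> p = subst \<sigma>' \<rho>' p"
  by (simp add: bounds_def)

lemma bounds_mono: "bounds m p \<Longrightarrow> m \<le> n \<Longrightarrow> bounds n p"
  unfolding bounds_def[of n] by (intro allI impI boundsD[of m]) auto

lemma bounds_ex: "\<exists>n. bounds n p"
proof (induction p)
  case (Eq s t)
  obtain m n where "\<forall>\<sigma> \<sigma>'. (\<forall>i<m. \<sigma> i = \<sigma>' i) \<longrightarrow> substT \<sigma> s = substT \<sigma>' s"
    "\<forall>\<sigma> \<sigma>'. (\<forall>i<n. \<sigma> i = \<sigma>' i) \<longrightarrow> substT \<sigma> t = substT \<sigma>' t" using substT_bound[of s] substT_bound[of t] by (elim exE) (rule that)
  then have "bounds (max m n) (s \<^bold>= t)"
    unfolding bounds_def subst.simps fm.inject by (meson less_max_iff_disj)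
  then show ?case by blast
next
  case (Less s t)
  obtain m n where "\<forall>\<sigma> \<sigma>'. (\<forall>i<m. \<sigma> i = \<sigma>' i) \<longrightarrow> substT \<sigma> s = substT \<sigma>' s"
    "\<forall>\<sigma> \<sigma>'. (\<forall>i<n. \<sigma> i = \<sigma>' i) \<longrightarrow> substT \<sigma> t = substT \<sigma>' t" using substT_bound[of s] substT_bound[of t] by (elim exE) (rule that)
  then have "bounds (max m n) (s \<^bold>< t)"
    unfolding bounds_def subst.simps fm.inject by (meson less_max_iff_disj)
  then show ?case by blast
next
  case (Mem t X)
  obtain n where "\<forall>\<sigma> \<sigma>'. (\<forall>i<n. \<sigma> i = \<sigma>' i) \<longrightarrow> substT \<sigma> t = substT \<sigma>' t"
    using substT_bound[of t] by (elim exE) (rule that)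
  then have "bounds (max n (Suc X)) (t \<^bold>\<in> X)"
    unfolding bounds_def subst.simps fm.inject by (meson less_max_iff_disj lessI)
  then show ?case by blast
next
  case (Imp p q)
  then obtain m n where mn: "bounds m p" "bounds n q" by blast
  have "bounds (max m n) (p \<^bold>\<longrightarrow> q)"
    unfolding bounds_def[of _ "p \<^bold>\<longrightarrow> q"] subst.simps
    by (intro allI impI arg_cong2[where f = Imp] boundsD[OF mn(1)] boundsD[OF mn(2)]) auto
  then show ?case by blast
next
  case (AllN p)
  then obtain n where n: "bounds n p" by blast
  have "bounds n (\<^bold>\<forall>\<^sup>0 p)"
    unfolding bounds_def[of _ "\<^bold>\<forall>\<^sup>0 p"] subst.simps
  proof (intro allI impI arg_cong[where f = AllN] boundsD[OF n])
    fix \<sigma> \<sigma>' :: "nat \<Rightarrow> tm" and \<rho> \<rho>' :: "nat \<Rightarrow> nat" and i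
    assume "\<forall>i<n. \<sigma> i = \<sigma>' i \<and> \<rho> i = \<rho>' i" "i < n"
    then show "case_nat (V 0) (\<lambda>n. upT 1 (\<sigma> n)) i = case_nat (V 0) (\<lambda>n. upT 1 (\<sigma>' n)) i" "\<rho> i = \<rho>' i"
      by (cases i; simp)+
  qed
  then show ?case by blast
next
  case (AllS p)
  then obtain n where n: "bounds n p" by blast
  have "bounds n (\<^bold>\<forall>\<^sup>1 p)"
    unfolding bounds_def[of _ "\<^bold>\<forall>\<^sup>1 p"] subst.simps
  proof (intro allI impI arg_cong[where f = AllS] boundsD[OF n])
    fix \<sigma> \<sigma>' :: "nat \<Rightarrow> tm" and \<rho> \<rho>' :: "nat \<Rightarrow> nat" and i
    assume "\<forall>i<n. \<sigma> i = \<sigma>' i \<and> \<rho> i = \<rho>' i" "i < n"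
    then show "\<sigma> i = \<sigma>' i" "upS \<rho> i = upS \<rho>' i"
      by (cases i; simp)+
  qed
  then show ?case by blast
qed (auto simp: bounds_def)

subsection \<open>Admissible rules\<close>

lemma deriv_weaken: "deriv T \<Gamma> p \<Longrightarrow> set \<Gamma> \<subseteq> set \<Delta> \<Longrightarrow> deriv T \<Delta> p"
proof (induction arbitrary: \<Delta> rule: deriv.induct)
  case (Ax p \<Gamma>)
  from Ax.hyps show ?case by (rule deriv.Ax)
next
  case (Hyp p \<Gamma>)
  then show ?case by (intro deriv.Hyp) blast
next
  case (ImpI p \<Gamma> q)
  show ?case by (rule deriv.ImpI, rule ImpI.IH) (use ImpI.prems in auto)
next
  case (ImpE \<Gamma> p q)
  show ?case by (rule deriv.ImpE; rule ImpE.IH) (rule ImpE.prems)+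
next
  case (RAA p \<Gamma>)
  show ?case by (rule deriv.RAA, rule RAA.IH) (use RAA.prems in auto)
next
  case (AllNI \<Gamma> p)
  show ?case by (rule deriv.AllNI, rule AllNI.IH) (use AllNI.prems in auto)
next
  case (AllNE \<Gamma> p t)
  show ?case by (rule deriv.AllNE, rule AllNE.IH, rule AllNE.prems)
next
  case (AllSI \<Gamma> p)
  show ?case by (rule deriv.AllSI, rule AllSI.IH) (use AllSI.prems in auto)
next
  case (AllSE \<Gamma> p X)
  show ?case by (rule deriv.AllSE, rule AllSE.IH, rule AllSE.prems)
next
  case (EqRefl \<Gamma> t)
  show ?case by (rule deriv.EqRefl)
next
  case (EqSubst \<Gamma> s t p)
  show ?case by (rule deriv.EqSubst; rule EqSubst.IH) (rule EqSubst.prems)+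
qed

text \<open>The outermost of \<open>n + 1\<close> quantifiers is instantiated while \<open>n\<close>
  others stay in front of \<open>p\<close>. So its variable is \<open>V n\<close> there,
  \<open>t\<close> is lifted by \<open>n\<close>, and larger indices drop by one.\<close>

lemma instN_AllN_funpow:
  "instN t ((AllN ^^ n) p) =
    (AllN ^^ n) (subst (\<lambda>i. if i < n then V i else if i = n then upT n t else V (i - 1)) id p)"
proof -
  have "subst \<sigma> \<rho> ((AllN ^^ n) p) = (AllN ^^ n) (subst ((upN ^^ n) \<sigma>) \<rho> p)" for \<sigma> \<rho>
    by (induction n arbitrary: \<sigma>) (simp_all add: subst_AllN funpow_swap1[of upN] del: subst.simps(6))
  moreover have "(upN ^^ n) (case_nat t V) =
      (\<lambda>i. if i < n then V i else if i = n then upT n t else V (i - 1))"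
  proof (induction n)
    case (Suc n)
    then show ?case
      by (auto simp: fun_eq_iff substT_substT split: nat.split)
  qed (auto simp: fun_eq_iff split: nat.split)
  ultimately show ?thesis
    by (simp add: instN_def)
qed

lemma instS_AllS_funpow:
  "instS X ((AllS ^^ n) p) =
    (AllS ^^ n) (subst V (\<lambda>i. if i < n then i else if i = n then X + n else i - 1) p)"
proof -
  have "subst \<sigma> \<rho> ((AllS ^^ n) p) = (AllS ^^ n) (subst \<sigma> ((upS ^^ n) \<rho>) p)" for \<sigma> \<rho>
    by (induction n arbitrary: \<rho>) (simp_all add: funpow_swap1[of upS])
  moreover have "(upS ^^ n) (case_nat X id) =
      (\<lambda>i. if i < n then i else if i = n then X + n else i - 1)"
  proof (induction n)
    case (Suc n)
    then show ?case
      by (auto simp: fun_eq_iff split: nat.split)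
  qed (auto simp: fun_eq_iff split: nat.split)
  ultimately show ?thesis
    by (simp add: instS_def)
qed

lemma deriv_AllN_funpow_inst:
  "deriv T \<Gamma> ((AllN ^^ n) p) \<Longrightarrow> deriv T \<Gamma> (subst (\<lambda>i. if i < n then \<sigma> i else V (i - n)) id p)"
proof (induction n arbitrary: p)
  case (Suc n)
  have "deriv T \<Gamma> (instN (\<sigma> n) ((AllN ^^ n) p))"
    using Suc.prems by (intro deriv.AllNE) simp
  note * = Suc.IH[OF this[unfolded instN_AllN_funpow], unfolded subst_subst]
  \<comment> \<open>The variables of \<open>upT n (\<sigma> n)\<close> all have index at least
    \<open>n\<close>, so instantiating the remaining quantifiers undoes this lifting.\<close>
  have "substT (\<lambda>i. if i < n then \<sigma> i else V (i - n))
      (if i < n then V i else if i = n then upT n (\<sigma> n) else V (i - 1)) =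
      (if i < Suc n then \<sigma> i else V (i - Suc n))" for i
    by (cases i n rule: linorder_cases) (auto simp: substT_substT)
  with * show ?case
    by (simp add: id_def)
qed simp

lemma deriv_AllS_funpow_inst:
  "deriv T \<Gamma> ((AllS ^^ n) p) \<Longrightarrow> deriv T \<Gamma> (subst V (\<lambda>i. if i < n then \<rho> i else i - n) p)"
proof (induction n arbitrary: p)
  case (Suc n)
  have "deriv T \<Gamma> (instS (\<rho> n) ((AllS ^^ n) p))"
    using Suc.prems by (intro deriv.AllSE) simp
  note * = Suc.IH[OF this[unfolded instS_AllS_funpow], unfolded subst_subst]
  have "(\<lambda>i. if i < n then \<rho> i else i - n)
      (if i < n then i else if i = n then \<rho> n + n else i - 1) =
      (if i < Suc n then \<rho> i else i - Suc n)" for i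
    by (cases i n rule: linorder_cases) auto
  with * show ?case
    by simp
qed simp

text \<open>Under an empty context the eigenvariable condition is void, so every theorem can be
  generalized over all its variables and then specialized simultaneously.\<close>

lemma deriv_Nil_subst:
  assumes "deriv T [] p"
  shows "deriv T [] (subst \<sigma> \<rho> p)"
proof -
  obtain n where n: "bounds n p" using bounds_ex by blast
  have "deriv T [] ((AllN ^^ n) p)"
    using assms by (induction n) (auto intro: deriv.AllNI)
  then have "deriv T [] (subst (\<lambda>i. if i < n then \<sigma> i else V (i - n)) id p)"
    by (rule deriv_AllN_funpow_inst)
  \<comment> \<open>The two substitutions differ only from \<open>n\<close> on, where
    \<open>p\<close> has no free variables.\<close>
  then have *: "deriv T [] (subst \<sigma> id p)"
    by (rule back_subst[where P = "deriv T _"]) (auto intro: boundsD[OF n])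
  obtain m where m: "bounds m (subst \<sigma> id p)" using bounds_ex by blast
  have "deriv T [] ((AllS ^^ m) (subst \<sigma> id p))"
    using * by (induction m) (auto intro: deriv.AllSI)
  then have "deriv T [] (subst V (\<lambda>i. if i < m then \<rho> i else i - m) (subst \<sigma> id p))"
    by (rule deriv_AllS_funpow_inst)
  then have "deriv T [] (subst V \<rho> (subst \<sigma> id p))"
    by (rule back_subst[where P = "deriv T _"]) (auto intro: boundsD[OF m])
  then show ?thesis
    by (simp add: subst_subst)
qed

lemma deriv_subst: "deriv T \<Gamma> p \<Longrightarrow> deriv T (map (subst \<sigma> \<rho>) \<Gamma>) (subst \<sigma> \<rho> p)"
proof (induction arbitrary: \<sigma> \<rho> rule: deriv.induct)
  \<comment> \<open>\<open>T\<close> need not be closed under substitution; the instance is derived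
    in the empty context and then weakened.\<close>
  case (Ax p \<Gamma>)
  then show ?case
    using deriv_weaken[OF deriv_Nil_subst[OF deriv.Ax]] by simp
next
  case (Hyp p \<Gamma>)
  then show ?case by (intro deriv.Hyp) auto
next
  case (ImpI p \<Gamma> q)
  from ImpI.IH show ?case unfolding subst.simps list.map by (rule deriv.ImpI)
next
  case (ImpE \<Gamma> p q)
  from ImpE.IH show ?case unfolding subst.simps by (rule deriv.ImpE)
next
  case (RAA p \<Gamma>)
  from RAA.IH show ?case unfolding subst.simps list.map by (rule deriv.RAA)
next
  case (AllNI \<Gamma> p)
  have "map liftN (map (subst \<sigma> \<rho>) \<Gamma>) = map (subst (upN \<sigma>) \<rho>) (map liftN \<Gamma>)"
    by (simp only: list.map_comp comp_def subst_liftN)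
  with AllNI.IH[of "upN \<sigma>" \<rho>] show ?case
    unfolding subst_AllN by (intro deriv.AllNI) (simp only:)
next
  case (AllNE \<Gamma> p t)
  from AllNE.IH show ?case
    unfolding subst_instN subst_AllN by (rule deriv.AllNE)
next
  case (AllSI \<Gamma> p)
  have "map liftS (map (subst \<sigma> \<rho>) \<Gamma>) = map (subst \<sigma> (upS \<rho>)) (map liftS \<Gamma>)"
    by (simp only: list.map_comp comp_def subst_liftS)
  with AllSI.IH[of \<sigma> "upS \<rho>"] show ?case
    unfolding subst.simps by (intro deriv.AllSI) (simp only:)
next
  case (AllSE \<Gamma> p X)
  from AllSE.IH show ?case
    unfolding subst_instS subst.simps by (rule deriv.AllSE)
next
  case (EqSubst \<Gamma> s t p)
  from EqSubst.IH show ?case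
    unfolding subst_instN subst.simps by (rule deriv.EqSubst)
next
  case (EqRefl \<Gamma> t)
  show ?case unfolding subst.simps by (rule deriv.EqRefl)
qed

subsection \<open>Henkin models\<close>

abbreviation consistent :: "fm set \<Rightarrow> fm list \<Rightarrow> bool" where
  "consistent T \<Gamma> \<equiv> \<not> deriv T \<Gamma> \<^bold>\<bottom>"

lemma bounds_list_ex: "\<exists>n. \<forall>p\<in>set ps. bounds n p"
proof (induction ps)
  case (Cons p ps)
  then obtain m n where "bounds m p" "\<forall>q\<in>set ps. bounds n q" using bounds_ex[of p] by auto
  then have "\<forall>q\<in>set (p # ps). bounds (max m n) q" by (auto intro: bounds_mono)
  then show ?case by blast
qed simp

text \<open>A variable \<open>V m\<close> that is free neither in \<open>\<Gamma>\<close> nor in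
  \<open>q\<close> is the witness. In de Bruijn form its freshness means that the renaming
  \<open>\<sigma>\<close>, which moves \<open>m\<close> to \<open>0\<close> and every other index
  up, acts on \<open>\<Gamma>\<close> as \<open>liftN\<close> and turns \<open>instN (V m) q\<close>
  into \<open>q\<close>; then the eigenvariable rule applies.\<close>

lemma consistent_witnessN:
  assumes con: "consistent T \<Gamma>" and mem: "(\<^bold>\<not> (\<^bold>\<forall>\<^sup>0 q)) \<in> set \<Gamma>"
  shows "\<exists>t. consistent T ((\<^bold>\<not> instN t q) # \<Gamma>)"
proof -
  obtain m where m: "bounds m q" "\<And>p. p \<in> set \<Gamma> \<Longrightarrow> bounds m p"
    using bounds_list_ex[of "q # \<Gamma>"] by auto
  define \<sigma> where "\<sigma> = (\<lambda>i. if i = m then V 0 else V (Suc i))"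
  have \<Gamma>: "map (subst \<sigma> id) \<Gamma> = map liftN \<Gamma>"
    unfolding liftN_def by (rule map_cong) (auto simp: \<sigma>_def intro: boundsD[OF m(2)])
  have "instN (\<sigma> m) (subst (upN \<sigma>) id q) = subst (case_nat (\<sigma> m) \<sigma>) id q"
    by (rule instN_upN)
  also have "\<dots> = subst V id q"
    by (rule boundsD[OF m(1)]) (auto simp: \<sigma>_def split: nat.split)
  finally have q: "subst \<sigma> id (instN (V m) q) = q"
    by (simp add: subst_instN)
  have False if "deriv T ((\<^bold>\<not> instN (V m) q) # \<Gamma>) \<^bold>\<bottom>"
  proof -
    from that have "deriv T \<Gamma> (instN (V m) q)" by (rule deriv.RAA)
    from deriv_subst[OF this, of \<sigma> id] have "deriv T (map liftN \<Gamma>) q" by (simp only: \<Gamma> q)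
    then have "deriv T \<Gamma> (\<^bold>\<forall>\<^sup>0 q)" by (rule deriv.AllNI)
    with con mem show False by (meson deriv.Hyp deriv.ImpE)
  qed
  then show ?thesis by blast
qed

lemma consistent_witnessS:
  assumes con: "consistent T \<Gamma>" and mem: "(\<^bold>\<not> (\<^bold>\<forall>\<^sup>1 q)) \<in> set \<Gamma>"
  shows "\<exists>X. consistent T ((\<^bold>\<not> instS X q) # \<Gamma>)"
proof -
  obtain m where m: "bounds m q" "\<And>p. p \<in> set \<Gamma> \<Longrightarrow> bounds m p"
    using bounds_list_ex[of "q # \<Gamma>"] by auto
  define \<rho> where "\<rho> = (\<lambda>i. if i = m then 0 else Suc i)"
  have \<Gamma>: "map (subst V \<rho>) \<Gamma> = map liftS \<Gamma>"
    unfolding liftS_def by (rule map_cong) (auto simp: \<rho>_def intro: boundsD[OF m(2)])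
  have "instS (\<rho> m) (subst V (upS \<rho>) q) = subst V (case_nat (\<rho> m) \<rho>) q"
    by (rule instS_upS)
  also have "\<dots> = subst V id q"
    by (rule boundsD[OF m(1)]) (auto simp: \<rho>_def split: nat.split)
  finally have q: "subst V \<rho> (instS m q) = q"
    by (simp add: subst_instS)
  have False if "deriv T ((\<^bold>\<not> instS m q) # \<Gamma>) \<^bold>\<bottom>"
  proof -
    from that have "deriv T \<Gamma> (instS m q)" by (rule deriv.RAA)
    from deriv_subst[OF this, of V \<rho>] have "deriv T (map liftS \<Gamma>) q" by (simp only: \<Gamma> q)
    then have "deriv T \<Gamma> (\<^bold>\<forall>\<^sup>1 q)" by (rule deriv.AllSI)
    with con mem show False by (meson deriv.Hyp deriv.ImpE)
  qed
  then show ?thesis by blast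
qed

lemma henkin_step:
  assumes con: "consistent T \<Gamma>"
  shows "\<exists>\<Delta>. consistent T \<Delta> \<and> set \<Gamma> \<subseteq> set \<Delta> \<and>
    (deriv T \<Gamma> (\<^bold>\<not> p) \<or> p \<in> set \<Delta> \<and>
      (\<forall>q. p = (\<^bold>\<not> (\<^bold>\<forall>\<^sup>0 q)) \<longrightarrow> (\<exists>t. (\<^bold>\<not> instN t q) \<in> set \<Delta>)) \<and>
      (\<forall>q. p = (\<^bold>\<not> (\<^bold>\<forall>\<^sup>1 q)) \<longrightarrow> (\<exists>X. (\<^bold>\<not> instS X q) \<in> set \<Delta>)))"
proof (cases "consistent T (p # \<Gamma>)")
  case True
  consider q where "p = (\<^bold>\<not> (\<^bold>\<forall>\<^sup>0 q))" | q where "p = (\<^bold>\<not> (\<^bold>\<forall>\<^sup>1 q))" |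
    "\<And>q. p \<noteq> (\<^bold>\<not> (\<^bold>\<forall>\<^sup>0 q))" "\<And>q. p \<noteq> (\<^bold>\<not> (\<^bold>\<forall>\<^sup>1 q))"
    by blast
  then show ?thesis
  proof cases
    case (1 q)
    then obtain t where t: "consistent T ((\<^bold>\<not> instN t q) # p # \<Gamma>)"
      using consistent_witnessN[OF True, of q] by auto
    have "\<exists>u. (\<^bold>\<not> instN u q') \<in> set ((\<^bold>\<not> instN t q) # p # \<Gamma>)" if "p = (\<^bold>\<not> (\<^bold>\<forall>\<^sup>0 q'))" for q'
      by (rule exI[of _ t]) (use that 1 in simp)
    moreover have "p \<noteq> (\<^bold>\<not> (\<^bold>\<forall>\<^sup>1 q'))" for q'
      using 1 by simp
    moreover have "set \<Gamma> \<subseteq> set ((\<^bold>\<not> instN t q) # p # \<Gamma>)" "p \<in> set ((\<^bold>\<not> instN t q) # p # \<Gamma>)"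
      by auto
    ultimately show ?thesis using t by blast
  next
    case (2 q)
    then obtain X where X: "consistent T ((\<^bold>\<not> instS X q) # p # \<Gamma>)"
      using consistent_witnessS[OF True, of q] by auto
    have "\<exists>Y. (\<^bold>\<not> instS Y q') \<in> set ((\<^bold>\<not> instS X q) # p # \<Gamma>)" if "p = (\<^bold>\<not> (\<^bold>\<forall>\<^sup>1 q'))" for q'
      by (rule exI[of _ X]) (use that 2 in simp)
    moreover have "p \<noteq> (\<^bold>\<not> (\<^bold>\<forall>\<^sup>0 q'))" for q'
      using 2 by simp
    moreover have "set \<Gamma> \<subseteq> set ((\<^bold>\<not> instS X q) # p # \<Gamma>)" "p \<in> set ((\<^bold>\<not> instS X q) # p # \<Gamma>)"
      by auto
    ultimately show ?thesis using X by blast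
  next
    case 3
    have "set \<Gamma> \<subseteq> set (p # \<Gamma>)" "p \<in> set (p # \<Gamma>)" by auto
    with True 3 show ?thesis by blast
  qed
next
  case False
  then have "deriv T \<Gamma> (\<^bold>\<not> p)" by (intro deriv.ImpI) simp
  with con show ?thesis by blast
qed

instance tm :: countable by countable_datatype
instance fm :: countable by countable_datatype

definition saturated :: "fm set \<Rightarrow> fm set \<Rightarrow> bool" where
  "saturated T \<Delta> \<longleftrightarrow> (\<forall>\<Gamma> p. deriv T \<Gamma> p \<longrightarrow> set \<Gamma> \<subseteq> \<Delta> \<longrightarrow> p \<in> \<Delta>) \<and> \<^bold>\<bottom> \<notin> \<Delta> \<and>
    (\<forall>p. p \<in> \<Delta> \<or> (\<^bold>\<not> p) \<in> \<Delta>) \<and>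
    (\<forall>q. (\<^bold>\<forall>\<^sup>0 q) \<in> \<Delta> \<or> (\<exists>t. (\<^bold>\<not> instN t q) \<in> \<Delta>)) \<and>
    (\<forall>q. (\<^bold>\<forall>\<^sup>1 q) \<in> \<Delta> \<or> (\<exists>X. (\<^bold>\<not> instS X q) \<in> \<Delta>))"

lemma saturated_ex:
  assumes "consistent T \<Gamma>0"
  shows "\<exists>\<Delta>. saturated T \<Delta> \<and> set \<Gamma>0 \<subseteq> \<Delta>"
proof -
  define step where "step n \<Gamma> \<Delta> \<longleftrightarrow> set \<Gamma> \<subseteq> set \<Delta> \<and>
    (deriv T \<Gamma> (\<^bold>\<not> (from_nat n)) \<or> from_nat n \<in> set \<Delta> \<and>
      (\<forall>q. from_nat n = (\<^bold>\<not> (\<^bold>\<forall>\<^sup>0 q)) \<longrightarrow> (\<exists>t. (\<^bold>\<not> instN t q) \<in> set \<Delta>)) \<and>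
      (\<forall>q. from_nat n = (\<^bold>\<not> (\<^bold>\<forall>\<^sup>1 q)) \<longrightarrow> (\<exists>X. (\<^bold>\<not> instS X q) \<in> set \<Delta>)))" for n \<Gamma> \<Delta>
  \<comment> \<open>Dependent choice strings the stages together; stage \<open>n\<close> treats the
    formula with number \<open>n\<close>.\<close>
  have "\<exists>G. \<forall>n. (consistent T (G n) \<and> (n = 0 \<longrightarrow> G n = \<Gamma>0)) \<and> step n (G n) (G (Suc n))"
  proof (rule dependent_nat_choice)
    show "\<exists>\<Gamma>. consistent T \<Gamma> \<and> (0 = 0 \<longrightarrow> \<Gamma> = \<Gamma>0)"
      using assms by (intro exI[of _ \<Gamma>0]) simp
  next
    fix \<Gamma> :: "fm list" and n :: nat assume "consistent T \<Gamma> \<and> (n = 0 \<longrightarrow> \<Gamma> = \<Gamma>0)"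
    then have "consistent T \<Gamma>" ..
    from henkin_step[OF this, of "from_nat n"]
    show "\<exists>\<Delta>. (consistent T \<Delta> \<and> (Suc n = 0 \<longrightarrow> \<Delta> = \<Gamma>0)) \<and> step n \<Gamma> \<Delta>"
      unfolding step_def conj_assoc by (simp only: nat.distinct simp_thms)
  qed
  then obtain G where G: "\<And>n. (consistent T (G n) \<and> (n = 0 \<longrightarrow> G n = \<Gamma>0)) \<and> step n (G n) (G (Suc n))"
    by blast
  have con: "consistent T (G n)" and G0: "G 0 = \<Gamma>0" and step: "step n (G n) (G (Suc n))" for n
    using G[of n] G[of 0] by simp_all
  have mono: "set (G m) \<subseteq> set (G n)" if "m \<le> n" for m n
    using step[unfolded step_def, THEN conjunct1] that by (rule lift_Suc_mono_le[of "\<lambda>n. set (G n)"])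
  define \<Delta> where "\<Delta> = (\<Union>n. set (G n))"
  have GI: "set (G n) \<subseteq> \<Delta>" for n unfolding \<Delta>_def by blast
  have fin: "\<exists>n. set \<Gamma> \<subseteq> set (G n)" if "set \<Gamma> \<subseteq> \<Delta>" for \<Gamma>
    using that
  proof (induction \<Gamma>)
    case (Cons p \<Gamma>)
    then obtain m n where mn: "set \<Gamma> \<subseteq> set (G m)" "p \<in> set (G n)" unfolding \<Delta>_def by auto
    then have "set (p # \<Gamma>) \<subseteq> set (G (max m n))"
      using mono[of m "max m n"] mono[of n "max m n"] by auto
    then show ?case by blast
  qed simp
  have no: "\<not> (deriv T \<Gamma> p \<and> deriv T \<Gamma>' (\<^bold>\<not> p))" if "set \<Gamma> \<subseteq> \<Delta>" "set \<Gamma>' \<subseteq> \<Delta>" for \<Gamma> \<Gamma>' p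
  proof
    assume d: "deriv T \<Gamma> p \<and> deriv T \<Gamma>' (\<^bold>\<not> p)"
    obtain n where "set (\<Gamma> @ \<Gamma>') \<subseteq> set (G n)" using fin[of "\<Gamma> @ \<Gamma>'"] \<open>set \<Gamma> \<subseteq> \<Delta>\<close> \<open>set \<Gamma>' \<subseteq> \<Delta>\<close> by auto
    then have "deriv T (G n) p" "deriv T (G n) (\<^bold>\<not> p)"
      using deriv_weaken[OF conjunct1[OF d], of "G n"] deriv_weaken[OF conjunct2[OF d], of "G n"] by simp_all
    then show False using con[of n] by (meson deriv.ImpE)
  qed
  \<comment> \<open>Every formula is settled at the stage that carries its own number.\<close>
  have dec: "deriv T (G (to_nat p)) (\<^bold>\<not> p) \<or> p \<in> \<Delta> \<and>
      (\<forall>q. p = (\<^bold>\<not> (\<^bold>\<forall>\<^sup>0 q)) \<longrightarrow> (\<exists>t. (\<^bold>\<not> instN t q) \<in> \<Delta>)) \<and>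
      (\<forall>q. p = (\<^bold>\<not> (\<^bold>\<forall>\<^sup>1 q)) \<longrightarrow> (\<exists>X. (\<^bold>\<not> instS X q) \<in> \<Delta>))" for p
    using step[of "to_nat p", unfolded step_def from_nat_to_nat, THEN conjunct2] GI[of "Suc (to_nat p)"]
    by blast
  have cl: "p \<in> \<Delta>" if "deriv T \<Gamma> p" "set \<Gamma> \<subseteq> \<Delta>" for \<Gamma> p
    using no[OF that(2) GI] that(1) dec by blast
  have cp: "p \<in> \<Delta> \<or> (\<^bold>\<not> p) \<in> \<Delta>" for p
    using dec[of p] cl[OF _ GI] by blast
  have hyp: "deriv T [p] p" for p by (intro deriv.Hyp) simp
  have "(\<^bold>\<forall>\<^sup>0 q) \<in> \<Delta> \<or> (\<exists>t. (\<^bold>\<not> instN t q) \<in> \<Delta>)" for q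
  proof (subst disj_commute, rule disjCI)
    assume "(\<^bold>\<forall>\<^sup>0 q) \<notin> \<Delta>"
    then have "(\<^bold>\<not> (\<^bold>\<forall>\<^sup>0 q)) \<in> \<Delta>" using cp by blast
    then show "\<exists>t. (\<^bold>\<not> instN t q) \<in> \<Delta>"
      using dec[of "\<^bold>\<not> (\<^bold>\<forall>\<^sup>0 q)"] no[OF _ GI, of "[\<^bold>\<not> (\<^bold>\<forall>\<^sup>0 q)]"] hyp by auto
  qed
  moreover have "(\<^bold>\<forall>\<^sup>1 q) \<in> \<Delta> \<or> (\<exists>X. (\<^bold>\<not> instS X q) \<in> \<Delta>)" for q
  proof (subst disj_commute, rule disjCI)
    assume "(\<^bold>\<forall>\<^sup>1 q) \<notin> \<Delta>"
    then have "(\<^bold>\<not> (\<^bold>\<forall>\<^sup>1 q)) \<in> \<Delta>" using cp by blast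
    then show "\<exists>X. (\<^bold>\<not> instS X q) \<in> \<Delta>"
      using dec[of "\<^bold>\<not> (\<^bold>\<forall>\<^sup>1 q)"] no[OF _ GI, of "[\<^bold>\<not> (\<^bold>\<forall>\<^sup>1 q)]"] hyp by auto
  qed
  moreover have "\<^bold>\<bottom> \<notin> \<Delta>"
    unfolding \<Delta>_def using con by (auto intro: deriv.Hyp)
  ultimately have "saturated T \<Delta>"
    unfolding saturated_def using cl cp by blast
  moreover have "set \<Gamma>0 \<subseteq> \<Delta>" using GI[of 0] G0 by simp
  ultimately show ?thesis by blast
qed

text \<open>These are the clauses of the truth lemma. In the last one an axiom enters with all its
  substitution instances, since it stands for its universal closure.\<close>

lemma saturated_cases:
  assumes "saturated T \<Delta>"
  shows "\<^bold>\<bottom> \<notin> \<Delta>"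
    and "(p \<^bold>\<longrightarrow> q) \<in> \<Delta> \<longleftrightarrow> (p \<in> \<Delta> \<longrightarrow> q \<in> \<Delta>)"
    and "(\<^bold>\<forall>\<^sup>0 p) \<in> \<Delta> \<longleftrightarrow> (\<forall>t. instN t p \<in> \<Delta>)"
    and "(\<^bold>\<forall>\<^sup>1 p) \<in> \<Delta> \<longleftrightarrow> (\<forall>X. instS X p \<in> \<Delta>)"
    and "(t \<^bold>= t) \<in> \<Delta>"
    and "(s \<^bold>= t) \<in> \<Delta> \<Longrightarrow> instN s p \<in> \<Delta> \<Longrightarrow> instN t p \<in> \<Delta>"
    and "r \<in> T \<Longrightarrow> subst \<sigma> \<rho> r \<in> \<Delta>"
proof -
  note sat = assms[unfolded saturated_def]
  note cl = sat[THEN conjunct1, rule_format]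
    and bot = sat[THEN conjunct2, THEN conjunct1]
    and witN = sat[THEN conjunct2, THEN conjunct2, THEN conjunct2, THEN conjunct1, rule_format]
    and witS = sat[THEN conjunct2, THEN conjunct2, THEN conjunct2, THEN conjunct2, rule_format]
  have cp: "p \<in> \<Delta> \<or> (\<^bold>\<not> p) \<in> \<Delta>" for p
    using sat[THEN conjunct2, THEN conjunct2, THEN conjunct1] ..
  have hyp: "deriv T [p] p" for p by (intro deriv.Hyp) simp
  have mp: "q \<in> \<Delta>" if "(p \<^bold>\<longrightarrow> q) \<in> \<Delta>" "p \<in> \<Delta>" for p q
  proof (rule cl)
    show "deriv T [p \<^bold>\<longrightarrow> q, p] q" by (rule deriv.ImpE[of _ _ p]; rule deriv.Hyp) simp_all
  qed (simp add: that)
  show "\<^bold>\<bottom> \<notin> \<Delta>" by (rule bot)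
  show "(p \<^bold>\<longrightarrow> q) \<in> \<Delta> \<longleftrightarrow> (p \<in> \<Delta> \<longrightarrow> q \<in> \<Delta>)"
  proof (intro iffI impI)
    assume *: "p \<in> \<Delta> \<longrightarrow> q \<in> \<Delta>"
    show "(p \<^bold>\<longrightarrow> q) \<in> \<Delta>"
    proof (cases "p \<in> \<Delta>")
      case True
      show ?thesis
      proof (rule cl)
        show "deriv T [q] (p \<^bold>\<longrightarrow> q)" by (rule deriv.ImpI, rule deriv.Hyp) simp
      qed (simp add: * True)
    next
      case False
      show ?thesis
      proof (rule cl)
        show "deriv T [\<^bold>\<not> p] (p \<^bold>\<longrightarrow> q)"
          by (rule deriv.ImpI, rule deriv.RAA, rule deriv.ImpE[of _ _ p]; rule deriv.Hyp) simp_all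
      qed (use cp[of p] False in simp)
    qed
  qed (rule mp)
  show "(\<^bold>\<forall>\<^sup>0 p) \<in> \<Delta> \<longleftrightarrow> (\<forall>t. instN t p \<in> \<Delta>)"
  proof (intro iffI allI)
    show "instN t p \<in> \<Delta>" if "(\<^bold>\<forall>\<^sup>0 p) \<in> \<Delta>" for t
      by (rule cl[OF deriv.AllNE[OF hyp]]) (simp add: that)
    show "(\<^bold>\<forall>\<^sup>0 p) \<in> \<Delta>" if "\<forall>t. instN t p \<in> \<Delta>"
      using witN[of p] that mp[of _ "\<^bold>\<bottom>"] bot by metis
  qed
  show "(\<^bold>\<forall>\<^sup>1 p) \<in> \<Delta> \<longleftrightarrow> (\<forall>X. instS X p \<in> \<Delta>)"
  proof (intro iffI allI)
    show "instS X p \<in> \<Delta>" if "(\<^bold>\<forall>\<^sup>1 p) \<in> \<Delta>" for X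
      by (rule cl[OF deriv.AllSE[OF hyp]]) (simp add: that)
    show "(\<^bold>\<forall>\<^sup>1 p) \<in> \<Delta>" if "\<forall>X. instS X p \<in> \<Delta>"
      using witS[of p] that mp[of _ "\<^bold>\<bottom>"] bot by metis
  qed
  show "(t \<^bold>= t) \<in> \<Delta>"
    by (rule cl[OF deriv.EqRefl[of _ "[]"]]) simp
  show "instN t p \<in> \<Delta>" if "(s \<^bold>= t) \<in> \<Delta>" "instN s p \<in> \<Delta>"
  proof (rule cl)
    show "deriv T [s \<^bold>= t, instN s p] (instN t p)"
      by (rule deriv.EqSubst[of _ _ s]; rule deriv.Hyp) simp_all
  qed (simp add: that)
  show "subst \<sigma> \<rho> r \<in> \<Delta>" if "r \<in> T"
    by (rule cl[OF deriv_Nil_subst[OF deriv.Ax[OF that]]]) simp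
qed

text \<open>The two axioms force the term model to be infinite, so that its domain can be identified
  with any given countably infinite type.\<close>

theorem model_existence:
  fixes f :: "nat \<Rightarrow> 'a"
  assumes f: "bij f" and np: "\<not> deriv T [] \<phi>"
    and T: "(\<^bold>\<not> (V 0 \<^bold>+ One \<^bold>= Zero)) \<in> T" "(V 0 \<^bold>+ One \<^bold>= V 1 \<^bold>+ One \<^bold>\<longrightarrow> V 0 \<^bold>= V 1) \<in> T"
  shows "\<exists>M :: 'a interp. setsS M \<noteq> {} \<and> (\<forall>p\<in>T. valid M p) \<and> \<not> valid M \<phi>"
proof -
  have "consistent T [\<^bold>\<not> \<phi>]" using np by (blast intro: deriv.RAA)
  then obtain \<Delta> where sat: "saturated T \<Delta>" and \<phi>: "(\<^bold>\<not> \<phi>) \<in> \<Delta>"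
    using saturated_ex by fastforce
  note sc = saturated_cases[OF sat]
  define R where "R = {(s, t). (s \<^bold>= t) \<in> \<Delta>}"
  \<comment> \<open>Leibniz's rule; below, \<open>V 0\<close> marks the place in \<open>p\<close>
    where the term is replaced.\<close>
  have eqD: "P \<longrightarrow> Q" if "(s \<^bold>= t) \<in> \<Delta>" "P = (instN s p \<in> \<Delta>)" "Q = (instN t p \<in> \<Delta>)" for s t p P Q
    using sc(6)[OF that(1)] that by blast
  have sym: "(t \<^bold>= s) \<in> \<Delta>" if "(s \<^bold>= t) \<in> \<Delta>" for s t
    using eqD[OF that refl refl, of "V 0 \<^bold>= upT 1 s"] sc(5)
    by (simp add: instN_def substT_substT)
  have trans: "(s \<^bold>= u) \<in> \<Delta>" if "(s \<^bold>= t) \<in> \<Delta>" "(t \<^bold>= u) \<in> \<Delta>" for s t u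
    using eqD[OF that(2) refl refl, of "upT 1 s \<^bold>= V 0"] that(1)
    by (simp add: instN_def substT_substT)
  have addL: "(s \<^bold>+ u \<^bold>= t \<^bold>+ u) \<in> \<Delta>" "(u \<^bold>+ s \<^bold>= u \<^bold>+ t) \<in> \<Delta>"
    and mulL: "(s \<^bold>* u \<^bold>= t \<^bold>* u) \<in> \<Delta>" "(u \<^bold>* s \<^bold>= u \<^bold>* t) \<in> \<Delta>"
    and less: "(s \<^bold>< u) \<in> \<Delta> \<Longrightarrow> (t \<^bold>< u) \<in> \<Delta>" "(u \<^bold>< s) \<in> \<Delta> \<Longrightarrow> (u \<^bold>< t) \<in> \<Delta>"
    and mem: "(s \<^bold>\<in> X) \<in> \<Delta> \<Longrightarrow> (t \<^bold>\<in> X) \<in> \<Delta>"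
    if "(s \<^bold>= t) \<in> \<Delta>" for s t u X
  proof -
    show "(s \<^bold>+ u \<^bold>= t \<^bold>+ u) \<in> \<Delta>"
      using eqD[OF that refl refl, of "upT 1 s \<^bold>+ upT 1 u \<^bold>= V 0 \<^bold>+ upT 1 u"] sc(5)
      by (simp add: instN_def substT_substT)
    show "(u \<^bold>+ s \<^bold>= u \<^bold>+ t) \<in> \<Delta>"
      using eqD[OF that refl refl, of "upT 1 u \<^bold>+ upT 1 s \<^bold>= upT 1 u \<^bold>+ V 0"] sc(5)
      by (simp add: instN_def substT_substT)
    show "(s \<^bold>* u \<^bold>= t \<^bold>* u) \<in> \<Delta>"
      using eqD[OF that refl refl, of "upT 1 s \<^bold>* upT 1 u \<^bold>= V 0 \<^bold>* upT 1 u"] sc(5)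
      by (simp add: instN_def substT_substT)
    show "(u \<^bold>* s \<^bold>= u \<^bold>* t) \<in> \<Delta>"
      using eqD[OF that refl refl, of "upT 1 u \<^bold>* upT 1 s \<^bold>= upT 1 u \<^bold>* V 0"] sc(5)
      by (simp add: instN_def substT_substT)
    show "(s \<^bold>< u) \<in> \<Delta> \<Longrightarrow> (t \<^bold>< u) \<in> \<Delta>"
      using eqD[OF that refl refl, of "V 0 \<^bold>< upT 1 u"] by (simp add: instN_def substT_substT)
    show "(u \<^bold>< s) \<in> \<Delta> \<Longrightarrow> (u \<^bold>< t) \<in> \<Delta>"
      using eqD[OF that refl refl, of "upT 1 u \<^bold>< V 0"] by (simp add: instN_def substT_substT)
    show "(s \<^bold>\<in> X) \<in> \<Delta> \<Longrightarrow> (t \<^bold>\<in> X) \<in> \<Delta>"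
      using eqD[OF that refl refl, of "V 0 \<^bold>\<in> X"] by (simp add: instN_def)
  qed
  have equiv: "equiv UNIV R"
    unfolding R_def using sc(5) sym trans
    by (intro equivI refl_onI symI transI; (unfold mem_Collect_eq split_conv)?) blast+
  have R_mem: "(s, t) \<in> R \<longleftrightarrow> (s \<^bold>= t) \<in> \<Delta>" for s t
    by (simp add: R_def)
  have R_iff: "R `` {s} = R `` {t} \<longleftrightarrow> (s \<^bold>= t) \<in> \<Delta>" for s t
    using equiv_class_eq_iff[OF equiv, of s t] R_mem[of s t] by simp
  have "infinite (UNIV // R)"
  proof
    assume fin: "finite (UNIV // R)"
    \<comment> \<open>Successor on the classes is injective; on a finite quotient it would be onto,
      but it misses the class of \<open>Zero\<close>.\<close>
    define S where "S C = R `` {(SOME t. t \<in> C) \<^bold>+ One}" for C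
    have S: "S (R `` {t}) = R `` {t \<^bold>+ One}" for t
    proof -
      have "(SOME u. u \<in> R `` {t}) \<in> R `` {t}" by (rule someI[of _ t]) (simp add: R_mem sc(5))
      then show ?thesis unfolding S_def R_iff by (intro addL(1) sym[of t]) (simp add: R_mem)
    qed
    have "inj_on S (UNIV // R)"
    proof (rule inj_onI, elim quotientE)
      fix C C' s t assume *: "S C = S C'" "C = R `` {s}" "C' = R `` {t}"
      then have "(s \<^bold>+ One \<^bold>= t \<^bold>+ One) \<in> \<Delta>" by (simp add: S R_iff)
      with sc(7)[OF T(2), of "case_nat s (\<lambda>_. t)" id] have "(s \<^bold>= t) \<in> \<Delta>" by (simp add: sc(2))
      with * show "C = C'" by (simp add: R_iff)
    qed
    moreover have "S ` (UNIV // R) \<subseteq> UNIV // R"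
      unfolding S_def by (auto intro: quotientI)
    ultimately have "S ` (UNIV // R) = UNIV // R"
      by (intro endo_inj_surj fin)
    moreover have "R `` {Zero} \<in> UNIV // R" by (simp add: quotientI)
    ultimately obtain t where "S (R `` {t}) = R `` {Zero}"
      by (metis (no_types, lifting) imageE quotientE)
    then have "(t \<^bold>+ One \<^bold>= Zero) \<in> \<Delta>" by (simp add: S R_iff)
    with sc(7)[OF T(1), of "\<lambda>_. t" id] show False by (simp add: sc(1,2))
  qed
  moreover have "countable (UNIV // R)"
    unfolding quotient_def by simp
  ultimately obtain g where g: "bij_betw g (UNIV // R) (UNIV :: nat set)"
    using countableE_infinite by blast
  define h where "h t = f (g (R `` {t}))" for t
  have h_iff: "h s = h t \<longleftrightarrow> (s \<^bold>= t) \<in> \<Delta>" for s t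
  proof -
    have "h s = h t \<longleftrightarrow> g (R `` {s}) = g (R `` {t})"
      unfolding h_def using f by (auto simp: bij_def inj_eq)
    also have "\<dots> \<longleftrightarrow> R `` {s} = R `` {t}"
      using bij_betw_imp_inj_on[OF g] by (simp add: inj_on_eq_iff quotientI)
    finally show ?thesis by (simp add: R_iff)
  qed
  have h_surj: "\<exists>t. h t = x" for x
  proof -
    obtain n where "x = f n" using f by (metis bij_pointE)
    moreover obtain C where "C \<in> UNIV // R" "g C = n"
      using g by (metis UNIV_I bij_betw_imp_surj_on imageE)
    ultimately show ?thesis unfolding h_def by (metis quotientE)
  qed
  define k where "k x = (SOME t. h t = x)" for x
  have hk: "h (k x) = x" for x unfolding k_def using h_surj by (rule someI_ex)
  have kh: "(k (h t) \<^bold>= t) \<in> \<Delta>" "(t \<^bold>= k (h t)) \<in> \<Delta>" for t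
    using hk h_iff by metis+
  define SS where "SS X = {h t | t. (t \<^bold>\<in> X) \<in> \<Delta>}" for X
  define M where "M = Interp (h Zero) (h One) (\<lambda>x y. h (k x \<^bold>+ k y)) (\<lambda>x y. h (k x \<^bold>* k y))
    (\<lambda>x y. (k x \<^bold>< k y) \<in> \<Delta>) (range SS)"
  have add: "h (k (h s) \<^bold>+ k (h t)) = h (s \<^bold>+ t)" and mul: "h (k (h s) \<^bold>* k (h t)) = h (s \<^bold>* t)" for s t
    unfolding h_iff using addL[OF kh(1)] mulL[OF kh(1)] trans by blast+
  have lt: "(k (h s) \<^bold>< k (h t)) \<in> \<Delta> \<longleftrightarrow> (s \<^bold>< t) \<in> \<Delta>" for s t
    using less[OF kh(1)] less[OF kh(2)] by blast
  have sets: "setsS M = range SS"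
    by (simp add: M_def)
  have SS_iff: "h t \<in> SS X \<longleftrightarrow> (t \<^bold>\<in> X) \<in> \<Delta>" for t X
    unfolding SS_def mem_Collect_eq h_iff using mem sym sc(5) by blast
  have ev: "evalS M (\<lambda>n. h (\<sigma> n)) t = h (substT \<sigma> t)" for \<sigma> t
    by (induction t) (simp_all add: M_def add mul)
  have truth: "sat M (\<lambda>n. h (\<sigma> n)) (\<lambda>n. SS (\<rho> n)) p \<longleftrightarrow> subst \<sigma> \<rho> p \<in> \<Delta>" for \<sigma> \<rho> p
  proof (induction p arbitrary: \<sigma> \<rho>)
    case (AllN p)
    have "case_nat (h t) (\<lambda>n. h (\<sigma> n)) = (\<lambda>n. h (case_nat t \<sigma> n))" for t
      by (simp add: fun_eq_iff split: nat.split)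
    then have "sat M (\<lambda>n. h (\<sigma> n)) (\<lambda>n. SS (\<rho> n)) (\<^bold>\<forall>\<^sup>0 p) \<longleftrightarrow> (\<forall>t. subst (case_nat t \<sigma>) \<rho> p \<in> \<Delta>)"
      unfolding sat.simps AllN[symmetric] using h_surj by metis
    then show ?case by (simp only: subst_AllN sc(3) instN_upN)
  next
    case (AllS p)
    have "case_nat (SS X) (\<lambda>n. SS (\<rho> n)) = (\<lambda>n. SS (case_nat X \<rho> n))" for X
      by (simp add: fun_eq_iff split: nat.split)
    then have "sat M (\<lambda>n. h (\<sigma> n)) (\<lambda>n. SS (\<rho> n)) (\<^bold>\<forall>\<^sup>1 p) \<longleftrightarrow> (\<forall>X. subst \<sigma> (case_nat X \<rho>) p \<in> \<Delta>)"
      unfolding sat.simps AllS[symmetric] sets by simp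
    then show ?case by (simp only: subst.simps sc(4) instS_upS)
  qed (simp_all only: sat.simps subst.simps ev h_iff SS_iff sc(1,2), simp_all add: M_def lt)
  have "valid M p" if "p \<in> T" for p
    unfolding valid_def
  proof (intro allI impI)
    fix e :: "nat \<Rightarrow> 'a" and s :: "nat \<Rightarrow> 'a set" assume "range s \<subseteq> setsS M"
    then have "\<forall>n. \<exists>X. s n = SS X" by (auto simp: M_def)
    \<comment> \<open>Every assignment is named by a substitution, so validity of an axiom amounts
      to membership of its instances in \<open>\<Delta>\<close>.\<close>
    then obtain \<rho> where \<rho>: "s = (\<lambda>n. SS (\<rho> n))" by metis
    have e: "e = (\<lambda>n. h (k (e n)))" by (simp add: hk)
    show "sat M e s p"
      unfolding \<rho> by (subst e) (simp only: truth sc(7)[OF that])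
  qed
  moreover have "\<not> valid M \<phi>"
  proof
    assume "valid M \<phi>"
    then have "sat M (\<lambda>n. h (V n)) (\<lambda>n. SS (id n)) \<phi>"
      unfolding valid_def by (auto simp: M_def)
    then have "\<phi> \<in> \<Delta>" unfolding truth by simp
    with \<phi> show False by (simp add: sc(1,2))
  qed
  moreover have "setsS M \<noteq> {}" by (simp add: sets)
  ultimately show ?thesis by blast
qed

subsection \<open>A generic model\<close>

text \<open>All models are represented on one type \<open>mnat\<close>, whose operations are those of a countermodel
  to the statement if there is one (and of the standard model otherwise). Arguing about \<open>mnat\<close>
  is therefore arguing in an arbitrary countable model, with the type class
  infrastructure for ordered semirings at hand.\<close>

typedef mnat = "UNIV :: nat set" ..

definition model :: "'a interp \<Rightarrow> bool" where
  "model M \<longleftrightarrow> setsS M \<noteq> {} \<and> (\<forall>p\<in>ACA0. valid M p)"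

definition std :: "mnat interp" where
  "std = Interp (Abs_mnat 0) (Abs_mnat 1) (\<lambda>x y. Abs_mnat (Rep_mnat x + Rep_mnat y))
    (\<lambda>x y. Abs_mnat (Rep_mnat x * Rep_mnat y)) (\<lambda>x y. Rep_mnat x < Rep_mnat y) UNIV"

lemma sat_liftS: "sat M e (case_nat A s) (liftS p) \<longleftrightarrow> sat M e s p"
  by (simp add: liftS_def sat_subst)

lemma model_std: "model std"
proof -
  note [simp] = Abs_mnat_inverse Abs_mnat_inject Rep_mnat_inverse Rep_mnat_inject
  have "valid std p" if "p \<in> basic_axioms" for p
    using that unfolding basic_axioms_def
    by (auto simp: valid_def std_def less_Suc_eq)
  moreover have "valid std induction_axiom"
  proof -
    have *: "x \<in> A" if "Abs_mnat 0 \<in> A" "\<forall>x. x \<in> A \<longrightarrow> Abs_mnat (Suc (Rep_mnat x)) \<in> A" for A x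
    proof -
      have "Abs_mnat n \<in> A" for n
      proof (induction n)
        case (Suc n)
        from that(2)[rule_format, OF this] show ?case by simp
      qed (rule that(1))
      from this[of "Rep_mnat x"] show ?thesis by simp
    qed
    show ?thesis
      unfolding valid_def induction_axiom_def
      by (simp add: std_def) (intro allI impI, rule *; simp)
  qed
  moreover have "valid std (comprehension p)" for p
  proof -
    have "\<exists>A. \<forall>x. x \<in> A \<longleftrightarrow> sat std (case_nat x e) s p" for e s
      by (rule exI[of _ "{x. sat std (case_nat x e) s p}"]) simp
    moreover have "sat std e s (comprehension p) \<longleftrightarrow>
        (\<exists>A. \<forall>x. x \<in> A \<longleftrightarrow> sat std (case_nat x e) s p)" for e s
      unfolding comprehension_def
      by (simp only: sat.simps sat_liftS) (simp add: std_def iff_conv_conj_imp)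
    ultimately show ?thesis
      unfolding valid_def by simp
  qed
  ultimately show ?thesis
    unfolding model_def ACA0_def by (auto simp: std_def)
qed

text \<open>\<open>mnat\<close> can carry only one structure, so a single choice has to serve every
  \<open>k\<close>: if some model on this type fails for some \<open>k\<close>, then so does the
  chosen one.\<close>

definition MM :: "mnat interp" where
  "MM = (SOME M. model M \<and> ((\<forall>k>0. valid M (FS_AP_statement k)) \<longrightarrow>
    (\<forall>M' :: mnat interp. model M' \<longrightarrow> (\<forall>k>0. valid M' (FS_AP_statement k)))))"

lemma MM: "model MM"
  "(\<forall>k>0. valid MM (FS_AP_statement k)) \<Longrightarrow> model (M' :: mnat interp) \<Longrightarrow> k > 0 \<Longrightarrow>
    valid M' (FS_AP_statement k)"
proof -
  have "\<exists>M :: mnat interp. model M \<and> ((\<forall>k>0. valid M (FS_AP_statement k)) \<longrightarrow>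
    (\<forall>M' :: mnat interp. model M' \<longrightarrow> (\<forall>k>0. valid M' (FS_AP_statement k))))"
    using model_std by metis
  from someI_ex[OF this] show "model MM"
    "(\<forall>k>0. valid MM (FS_AP_statement k)) \<Longrightarrow> model (M' :: mnat interp) \<Longrightarrow> k > 0 \<Longrightarrow>
      valid M' (FS_AP_statement k)"
    unfolding MM_def[symmetric] by blast+
qed

lemma succ_axioms:
  "(\<^bold>\<not> (V 0 \<^bold>+ One \<^bold>= Zero)) \<in> ACA0" "(V 0 \<^bold>+ One \<^bold>= V 1 \<^bold>+ One \<^bold>\<longrightarrow> V 0 \<^bold>= V 1) \<in> ACA0"
  by (simp_all add: ACA0_def basic_axioms_def)

lemma proves_if_valid_MM:
  assumes "\<And>k. k > 0 \<Longrightarrow> valid MM (FS_AP_statement k)" and "k > 0"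
  shows "ACA0 \<turnstile> FS_AP_statement k"
proof (rule ccontr)
  assume "\<not> ACA0 \<turnstile> FS_AP_statement k"
  then have "\<not> deriv ACA0 [] (FS_AP_statement k)" by (simp add: proves_def)
  moreover have "bij Abs_mnat"
    by (rule bijI') (auto simp: Abs_mnat_inject intro: Abs_mnat_cases)
  ultimately obtain M :: "mnat interp" where "setsS M \<noteq> {}" "\<forall>p\<in>ACA0. valid M p" "\<not> valid M (FS_AP_statement k)"
    using model_existence[OF _ _ succ_axioms] by blast
  then show False
    using MM(2)[of M k] assms unfolding model_def by blast
qed

instantiation mnat :: "{zero, one, plus, times, ord}"
begin
definition zero_mnat where "0 = zeroS MM"
definition one_mnat where "1 = oneS MM"
definition plus_mnat where "x + y = addS MM x y"
definition times_mnat where "x * y = mulS MM x y"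
definition less_mnat where "x < y \<longleftrightarrow> lessS MM x y"
definition less_eq_mnat where "x \<le> y \<longleftrightarrow> x < y \<or> x = (y :: mnat)"
instance ..
end

definition SS :: "mnat set set" where "SS = setsS MM"

abbreviation tval :: "(nat \<Rightarrow> mnat) \<Rightarrow> tm \<Rightarrow> mnat"
  where "tval \<equiv> eval 0 1 (+) (*)"

abbreviation holds :: "(nat \<Rightarrow> mnat) \<Rightarrow> (nat \<Rightarrow> mnat set) \<Rightarrow> fm \<Rightarrow> bool"
  where "holds \<equiv> sat MM"

lemma evalS_MM: "evalS MM = tval"
proof -
  have "addS MM = (+)" "mulS MM = (*)"
    by (auto simp: plus_mnat_def times_mnat_def fun_eq_iff)
  then show ?thesis by (simp add: zero_mnat_def one_mnat_def)
qed

lemma holds_simps [simp]: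
  "holds e s \<^bold>\<bottom> \<longleftrightarrow> False"
  "holds e s (t \<^bold>= u) \<longleftrightarrow> tval e t = tval e u"
  "holds e s (t \<^bold>< u) \<longleftrightarrow> tval e t < tval e u"
  "holds e s (t \<^bold>\<in> X) \<longleftrightarrow> tval e t \<in> s X"
  "holds e s (p \<^bold>\<longrightarrow> q) \<longleftrightarrow> (holds e s p \<longrightarrow> holds e s q)"
  "holds e s (\<^bold>\<forall>\<^sup>0 p) \<longleftrightarrow> (\<forall>x. holds (case_nat x e) s p)"
  "holds e s (\<^bold>\<forall>\<^sup>1 p) \<longleftrightarrow> (\<forall>A\<in>SS. holds e (case_nat A s) p)"
  by (simp_all only: sat.simps evalS_MM SS_def less_mnat_def)

declare sat.simps [simp del]

lemma SS_nonempty: "SS \<noteq> {}"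
  using MM(1) by (simp add: model_def SS_def)

lemma holds_ACA0: "p \<in> ACA0 \<Longrightarrow> range s \<subseteq> SS \<Longrightarrow> holds e s p"
  using MM(1) unfolding model_def valid_def SS_def by blast

lemma SS_comprehension_holds:
  assumes "arithmetical p" "range s \<subseteq> SS"
  shows "{x. holds (case_nat x e) s p} \<in> SS"
proof -
  have "holds e s (comprehension p)"
    using assms by (intro holds_ACA0) (auto simp: ACA0_def)
  then obtain A where A: "A \<in> SS" "\<And>x. x \<in> A \<longleftrightarrow> holds (case_nat x e) s p"
    by (auto simp: comprehension_def sat_liftS)
  then have "{x. holds (case_nat x e) s p} = A" by blast
  with A show ?thesis by simp
qed

subsection \<open>Arithmetical predicates\<close>

text \<open>Arithmetical definability with set parameters from the model, as a property of HOL
  predicates on assignments. The formula stays hidden, so comprehension and induction become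
  applicable by closure rules alone.\<close>

definition arith :: "((nat \<Rightarrow> mnat) \<Rightarrow> bool) \<Rightarrow> bool" where
  "arith P \<longleftrightarrow> (\<exists>p s. arithmetical p \<and> range s \<subseteq> SS \<and> (\<forall>e. P e = holds e s p))"

definition arith_fun :: "((nat \<Rightarrow> mnat) \<Rightarrow> mnat) \<Rightarrow> bool" where
  "arith_fun t \<longleftrightarrow> arith (\<lambda>e. e 0 = t (\<lambda>i. e (Suc i)))"

lemma arithI: "arithmetical p \<Longrightarrow> range s \<subseteq> SS \<Longrightarrow> (\<And>e. P e = holds e s p) \<Longrightarrow> arith P"
  unfolding arith_def by blast

lemma SS_comprehension:
  assumes "arith (\<lambda>e. P (e 0) (\<lambda>i. e (Suc i)))"
  shows "{x. P x e} \<in> SS"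
proof -
  from assms obtain p s where ps: "arithmetical p" "range s \<subseteq> SS"
    "\<And>e. P (e 0) (\<lambda>i. e (Suc i)) = holds e s p" unfolding arith_def by auto
  have "P x e = holds (case_nat x e) s p" for x
    using ps(3)[of "case_nat x e"] by simp
  with SS_comprehension_holds[OF ps(1,2), of e] show ?thesis by simp
qed

lemma arith_basic:
  assumes "arithmetical p"
  shows "arith (\<lambda>e. holds e (\<lambda>_. SOME A. A \<in> SS) p)"
  by (rule arithI[OF assms]) (use SS_nonempty some_in_eq in auto)

lemma arith_False: "arith (\<lambda>e. False)"
  using arith_basic[of "\<^bold>\<bottom>"] by simp

lemma arith_imp:
  assumes "arith P" "arith Q"
  shows "arith (\<lambda>e. P e \<longrightarrow> Q e)"
proof -
  from assms(1) obtain p s where p: "arithmetical p" "range s \<subseteq> SS" "\<And>e. P e = holds e s p"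
    unfolding arith_def by auto
  from assms(2) obtain q t where q: "arithmetical q" "range t \<subseteq> SS" "\<And>e. Q e = holds e t q"
    unfolding arith_def by auto
  \<comment> \<open>The set parameters of the two formulas are interleaved on even and odd
    indices.\<close>
  define u where "u n = (if even n then s (n div 2) else t (n div 2))" for n
  have ar: "arithmetical (subst \<sigma> \<rho> r) = arithmetical r" for \<sigma> \<rho> r
    by (induction r arbitrary: \<sigma> \<rho>) simp_all
  have "P e = holds e u (subst V (\<lambda>n. 2 * n) p)" "Q e = holds e u (subst V (\<lambda>n. Suc (2 * n)) q)" for e
    by (simp_all add: sat_subst u_def p(3) q(3) evalS_MM)
  then show ?thesis
    by (intro arithI[of "subst V (\<lambda>n. 2 * n) p \<^bold>\<longrightarrow> subst V (\<lambda>n. Suc (2 * n)) q" u])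
      (use p(1,2) q(1,2) in \<open>auto simp: ar u_def\<close>)
qed

lemma arith_not: "arith P \<Longrightarrow> arith (\<lambda>e. \<not> P e)"
  using arith_imp[OF _ arith_False] by simp

lemma arith_const: "arith (\<lambda>e. c)"
  by (cases c) (use arith_False arith_not[OF arith_False] in simp_all)

lemma arith_conj: "arith P \<Longrightarrow> arith Q \<Longrightarrow> arith (\<lambda>e. P e \<and> Q e)"
  using arith_not[OF arith_imp[OF _ arith_not], of P Q] by simp

lemma arith_disj: "arith P \<Longrightarrow> arith Q \<Longrightarrow> arith (\<lambda>e. P e \<or> Q e)"
  using arith_imp[OF arith_not, of P Q] by (simp add: disj_imp)

lemma arith_iff: "arith P \<Longrightarrow> arith Q \<Longrightarrow> arith (\<lambda>e. P e = Q e)"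
  using arith_conj[OF arith_imp arith_imp, of P Q Q P] by (simp add: iff_conv_conj_imp)

text \<open>In \<open>P (e 0) (\<lambda>i. e (Suc i))\<close> the bound variable becomes index \<open>0\<close> of the assignment; beta reduction
  takes care of shifting the other indices.\<close>

lemma arith_all:
  assumes "arith (\<lambda>e. P (e 0) (\<lambda>i. e (Suc i)))"
  shows "arith (\<lambda>e. \<forall>x. P x e)"
proof -
  from assms obtain p s where ps: "arithmetical p" "range s \<subseteq> SS"
    "\<And>e. P (e 0) (\<lambda>i. e (Suc i)) = holds e s p" unfolding arith_def by auto
  have "P x e = holds (case_nat x e) s p" for x e
    using ps(3)[of "case_nat x e"] by simp
  with ps(1,2) show ?thesis by (intro arithI[of "AllN p" s]) simp_all
qed

lemma arith_ex:
  assumes "arith (\<lambda>e. P (e 0) (\<lambda>i. e (Suc i)))"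
  shows "arith (\<lambda>e. \<exists>x. P x e)"
  using arith_not[OF arith_all[of "\<lambda>x e. \<not> P x e"]] arith_not[OF assms] by simp

lemma arith_rename:
  assumes "arith P"
  shows "arith (\<lambda>e. P (\<lambda>i. e (f i)))"
proof -
  from assms obtain p s where p: "arithmetical p" "range s \<subseteq> SS" "\<And>e. P e = holds e s p"
    unfolding arith_def by auto
  have "arithmetical (subst \<sigma> \<rho> r) = arithmetical r" for \<sigma> \<rho> r
    by (induction r arbitrary: \<sigma> \<rho>) simp_all
  with p show ?thesis
    by (intro arithI[of "subst (\<lambda>i. V (f i)) id p" s]) (simp_all add: sat_subst evalS_MM)
qed

lemma arith_fun_rename: "arith_fun t \<Longrightarrow> arith_fun (\<lambda>e. t (\<lambda>i. e (f i)))"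
  unfolding arith_fun_def
  using arith_rename[of "\<lambda>e. e 0 = t (\<lambda>i. e (Suc i))" "case_nat 0 (\<lambda>i. Suc (f i))"] by simp

lemma arith_fun_var: "arith_fun (\<lambda>e. e n)"
  unfolding arith_fun_def using arith_basic[of "V 0 \<^bold>= V (Suc n)"] by simp

lemma arith_mem0: "A \<in> SS \<Longrightarrow> arith (\<lambda>e. e 0 \<in> A)"
  by (rule arithI[of "V 0 \<^bold>\<in> 0" "\<lambda>_. A"]) auto

text \<open>A number parameter is carried by the set parameter \<open>{x. x = a}\<close>, which
  comprehension provides.\<close>

lemma arith_fun_const: "arith_fun (\<lambda>e. a)"
proof -
  have "{x. x = a} \<in> SS"
    using SS_comprehension[of "\<lambda>x e. x = e 0" "\<lambda>_. a"] arith_basic[of "V 0 \<^bold>= V 1"] by simp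
  from arith_mem0[OF this] show ?thesis by (simp add: arith_fun_def)
qed

text \<open>Instantiating a variable of an arithmetical predicate is expressed by an existential quantifier,
  so a term may be any arithmetically definable function.\<close>

lemma arith_case_nat:
  assumes "arith P" "arith_fun t"
  shows "arith (\<lambda>e. P (case_nat (t e) e))"
proof -
  have "(\<lambda>e. P (case_nat (e 0) (\<lambda>i. e (Suc i)))) = P"
  proof
    fix e :: "nat \<Rightarrow> mnat"
    have "case_nat (e 0) (\<lambda>i. e (Suc i)) = e" by (auto split: nat.split)
    then show "P (case_nat (e 0) (\<lambda>i. e (Suc i))) = P e" by simp
  qed
  with assms have "arith (\<lambda>e. \<exists>x. x = t e \<and> P (case_nat x e))"
    by (intro arith_ex arith_conj) (simp_all add: arith_fun_def)
  then show ?thesis by simp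
qed

lemma arith_rel1:
  assumes "arith (\<lambda>e. R (e 0))" "arith_fun t"
  shows "arith (\<lambda>e. R (t e))"
  using arith_case_nat[OF assms] by simp

lemma arith_rel2:
  assumes "arith (\<lambda>e. R (e 0) (e 1))" "arith_fun s" "arith_fun t"
  shows "arith (\<lambda>e. R (s e) (t e))"
  using arith_case_nat[OF arith_case_nat[OF assms(1) arith_fun_rename[OF assms(2), of Suc]] assms(3)]
  by simp

lemma arith_rel3:
  assumes "arith (\<lambda>e. R (e 0) (e 1) (e 2))" "arith_fun s" "arith_fun t" "arith_fun u"
  shows "arith (\<lambda>e. R (s e) (t e) (u e))"
  using arith_case_nat[OF arith_case_nat[OF arith_case_nat[OF assms(1)
      arith_fun_rename[OF assms(2), of "\<lambda>i. Suc (Suc i)"]] arith_fun_rename[OF assms(3), of Suc]] assms(4)]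
  by (simp add: numeral_2_eq_2)

lemma arith_fun1:
  assumes "arith (\<lambda>e. e 0 = F (e 1))" "arith_fun s"
  shows "arith_fun (\<lambda>e. F (s e))"
  unfolding arith_fun_def
  by (rule arith_rel2[of "\<lambda>x y. x = F y", OF assms(1) arith_fun_var arith_fun_rename[OF assms(2)]])

lemma arith_fun2:
  assumes "arith (\<lambda>e. e 0 = F (e 1) (e 2))" "arith_fun s" "arith_fun t"
  shows "arith_fun (\<lambda>e. F (s e) (t e))"
  unfolding arith_fun_def
  by (rule arith_rel3[of "\<lambda>x y z. x = F y z", OF assms(1) arith_fun_var
      arith_fun_rename[OF assms(2)] arith_fun_rename[OF assms(3)]])

lemma arith_eq: "arith_fun s \<Longrightarrow> arith_fun t \<Longrightarrow> arith (\<lambda>e. s e = t e)"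
  using arith_rel2[of "(=)" s t] arith_basic[of "V 0 \<^bold>= V 1"] by simp

lemma arith_less: "arith_fun s \<Longrightarrow> arith_fun t \<Longrightarrow> arith (\<lambda>e. s e < t e)"
  using arith_rel2[of "(<)" s t] arith_basic[of "V 0 \<^bold>< V 1"] by simp

lemma arith_le: "arith_fun s \<Longrightarrow> arith_fun t \<Longrightarrow> arith (\<lambda>e. s e \<le> t e)"
  unfolding less_eq_mnat_def by (intro arith_disj arith_less arith_eq)

lemma arith_mem: "A \<in> SS \<Longrightarrow> arith_fun t \<Longrightarrow> arith (\<lambda>e. t e \<in> A)"
  using arith_rel1[of "\<lambda>x. x \<in> A" t] arith_mem0[of A] by simp

lemma arith_fun_add: "arith_fun s \<Longrightarrow> arith_fun t \<Longrightarrow> arith_fun (\<lambda>e. s e + t e)"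
  using arith_fun2[of "(+)" s t] arith_basic[of "V 0 \<^bold>= V 1 \<^bold>+ V 2"] by simp

lemma arith_fun_mult: "arith_fun s \<Longrightarrow> arith_fun t \<Longrightarrow> arith_fun (\<lambda>e. s e * t e)"
  using arith_fun2[of "(*)" s t] arith_basic[of "V 0 \<^bold>= V 1 \<^bold>* V 2"] by simp

lemma arith_ball: "arith (\<lambda>e. \<forall>x. x \<in> A e \<longrightarrow> P x e) \<Longrightarrow> arith (\<lambda>e. \<forall>x\<in>A e. P x e)"
  by (simp add: Ball_def)

lemma arith_bex: "arith (\<lambda>e. \<exists>x. x \<in> A e \<and> P x e) \<Longrightarrow> arith (\<lambda>e. \<exists>x\<in>A e. P x e)"
  by (simp add: Bex_def)

lemmas arith_intros = arith_all arith_ex arith_ball arith_bex arith_conj arith_disj arith_imp arith_iff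
  arith_not arith_eq arith_less arith_le arith_mem arith_const
  arith_fun_add arith_fun_mult arith_fun_var arith_fun_const

text \<open>The induction axiom speaks of sets of the model only; comprehension turns an
  arithmetical predicate into one. Hence each induction below comes with an \<open>arith\<close>
  goal.\<close>

lemma mnat_induct:
  assumes "arith (\<lambda>e. P (e 0))" "P 0" "\<And>n. P n \<Longrightarrow> P (n + 1)"
  shows "P n"
proof -
  have A: "{x. P x} \<in> SS"
    using SS_comprehension[of "\<lambda>x e. P x"] assms(1) by simp
  then have "holds e (\<lambda>_. {x. P x}) induction_axiom" for e
    by (intro holds_ACA0) (auto simp: ACA0_def)
  then show ?thesis
    using assms(2,3) by (simp add: induction_axiom_def)
qed

subsection \<open>Arithmetic in the model\<close>

lemma basic:
  fixes x y :: mnat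
  shows "x + 1 \<noteq> 0" "x + 1 = y + 1 \<longleftrightarrow> x = y" "x + 0 = x" "x + (y + 1) = (x + y) + 1"
    "x * 0 = 0" "x * (y + 1) = x * y + x" "\<not> x < 0" "x < y + 1 \<longleftrightarrow> x < y \<or> x = y"
proof -
  have h: "holds (case_nat x (\<lambda>_. y)) (\<lambda>_. SOME A. A \<in> SS) p" if "p \<in> basic_axioms" for p
    using that SS_nonempty some_in_eq by (intro holds_ACA0) (auto simp: ACA0_def)
  note h' = h[unfolded basic_axioms_def]
  show "x + 1 \<noteq> 0" using h'[of "\<^bold>\<not> (V 0 \<^bold>+ One \<^bold>= Zero)"] by simp
  show "x + 1 = y + 1 \<longleftrightarrow> x = y" using h'[of "V 0 \<^bold>+ One \<^bold>= V 1 \<^bold>+ One \<^bold>\<longrightarrow> V 0 \<^bold>= V 1"] by auto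
  show "x + 0 = x" using h'[of "V 0 \<^bold>+ Zero \<^bold>= V 0"] by simp
  show "x + (y + 1) = (x + y) + 1"
    using h'[of "V 0 \<^bold>+ (V 1 \<^bold>+ One) \<^bold>= (V 0 \<^bold>+ V 1) \<^bold>+ One"] by simp
  show "x * 0 = 0" using h'[of "V 0 \<^bold>* Zero \<^bold>= Zero"] by simp
  show "x * (y + 1) = x * y + x"
    using h'[of "V 0 \<^bold>* (V 1 \<^bold>+ One) \<^bold>= (V 0 \<^bold>* V 1) \<^bold>+ V 0"] by simp
  show "\<not> x < 0" using h'[of "\<^bold>\<not> (V 0 \<^bold>< Zero)"] by simp
  show "x < y + 1 \<longleftrightarrow> x < y \<or> x = y"
    using h'[of "V 0 \<^bold>< V 1 \<^bold>+ One \<^bold>\<longleftrightarrow> (V 0 \<^bold>< V 1 \<^bold>\<or> V 0 \<^bold>= V 1)"] by auto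
qed

lemma mnat_add_0_left: "0 + n = (n :: mnat)"
  by (rule mnat_induct[of "\<lambda>n. 0 + n = n"])
    ((intro arith_intros)[], simp_all add: basic)

lemma mnat_add_1_left: "(m + 1) + n = (m + n) + (1 :: mnat)"
  by (rule mnat_induct[of "\<lambda>n. (m + 1) + n = (m + n) + 1"])
    ((intro arith_intros)[], simp_all add: basic)

lemma mnat_add_comm: "m + n = n + (m :: mnat)"
  by (rule mnat_induct[of "\<lambda>n. m + n = n + m"])
    ((intro arith_intros)[], simp_all add: basic mnat_add_0_left mnat_add_1_left)

lemma mnat_add_assoc: "(a + b) + c = a + (b + c :: mnat)"
  by (rule mnat_induct[of "\<lambda>c. (a + b) + c = a + (b + c)"])
    ((intro arith_intros)[], simp_all add: basic)

lemma mnat_add_cancel: "a + b = a + c \<Longrightarrow> b = (c :: mnat)"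
proof -
  have "a + b = a + c \<longrightarrow> b = c"
    by (rule mnat_induct[of "\<lambda>a. a + b = a + c \<longrightarrow> b = c"])
      ((intro arith_intros)[], simp_all add: basic mnat_add_0_left mnat_add_1_left)
  then show "a + b = a + c \<Longrightarrow> b = c" by blast
qed

lemma mnat_cases: "n = 0 \<or> (\<exists>m. n = m + (1 :: mnat))"
  by (rule mnat_induct[of "\<lambda>n. n = 0 \<or> (\<exists>m. n = m + 1)"])
    ((intro arith_intros)[], auto)

instance mnat :: comm_monoid_add
  by standard (rule mnat_add_assoc mnat_add_comm mnat_add_0_left)+

lemma mnat_mult_0_left: "0 * n = (0 :: mnat)"
  by (rule mnat_induct[of "\<lambda>n. 0 * n = 0"])
    ((intro arith_intros)[], simp_all add: basic)

lemma mnat_mult_1_left: "(m + 1) * n = m * n + (n :: mnat)"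
  by (rule mnat_induct[of "\<lambda>n. (m + 1) * n = m * n + n"])
    ((intro arith_intros)[], simp_all add: basic ac_simps)

lemma mnat_mult_comm: "m * n = n * (m :: mnat)"
  by (rule mnat_induct[of "\<lambda>n. m * n = n * m"])
    ((intro arith_intros)[], simp_all add: basic mnat_mult_0_left mnat_mult_1_left)

lemma mnat_distrib: "(a + b) * c = a * c + b * (c :: mnat)"
  by (rule mnat_induct[of "\<lambda>c. (a + b) * c = a * c + b * c"])
    ((intro arith_intros)[], simp_all add: basic ac_simps)

lemma mnat_mult_assoc: "(a * b) * c = a * (b * c :: mnat)"
  by (rule mnat_induct[of "\<lambda>c. (a * b) * c = a * (b * c)"])
    ((intro arith_intros)[], simp_all add: basic mnat_distrib mnat_mult_comm[of a])

lemma mnat_less_iff: "x < y \<longleftrightarrow> (\<exists>z. y = x + z + (1 :: mnat))"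
proof (rule mnat_induct[of "\<lambda>y. x < y \<longleftrightarrow> (\<exists>z. y = x + z + 1)"])
  fix y assume IH: "x < y \<longleftrightarrow> (\<exists>z. y = x + z + 1)"
  have "(\<exists>z. y + 1 = x + z + 1) \<longleftrightarrow> (\<exists>z. y = x + z + 1) \<or> x = y"
    using mnat_cases by (metis add.assoc add.right_neutral basic(2))
  then show "x < y + 1 \<longleftrightarrow> (\<exists>z. y + 1 = x + z + 1)"
    by (simp only: basic(8) IH)
qed ((intro arith_intros)[], metis basic(1,7))

lemma mnat_le_iff: "x \<le> y \<longleftrightarrow> (\<exists>z. y = x + (z :: mnat))"
  unfolding less_eq_mnat_def mnat_less_iff
  using mnat_cases by (metis add.assoc add.right_neutral)

lemma mnat_less_irrefl: "\<not> x < (x :: mnat)"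
proof
  assume "x < x"
  then obtain z where "x = x + z + 1" unfolding mnat_less_iff by blast
  then have "x + (z + 1) = x + 0" by (metis add.assoc add.right_neutral)
  then have "z + 1 = 0" by (rule mnat_add_cancel)
  then show False by (simp add: basic)
qed

lemma mnat_less_trans: "x < y \<Longrightarrow> y < z \<Longrightarrow> x < (z :: mnat)"
  unfolding mnat_less_iff by (metis add.assoc)

lemma mnat_linear: "x < y \<or> x = y \<or> y < (x :: mnat)"
proof (rule mnat_induct[of "\<lambda>y. x < y \<or> x = y \<or> y < x"])
  fix y assume "x < y \<or> x = y \<or> y < x"
  moreover have "y < x \<Longrightarrow> y + 1 < x \<or> y + 1 = x"
    unfolding mnat_less_iff using mnat_cases
    by (metis add.assoc add.commute add.right_neutral)
  ultimately show "x < y + 1 \<or> x = y + 1 \<or> y + 1 < x"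
    by (auto simp: basic)
qed ((intro arith_intros)[], use mnat_cases[of x] in \<open>auto simp: mnat_less_iff ac_simps\<close>)

instance mnat :: linorder
proof
  fix x y z :: mnat
  show "x < y \<longleftrightarrow> x \<le> y \<and> \<not> y \<le> x"
    using mnat_less_irrefl[of x] mnat_less_trans[of x y x] by (auto simp: less_eq_mnat_def)
  show "x \<le> x" by (simp add: less_eq_mnat_def)
  show "x \<le> y \<Longrightarrow> y \<le> z \<Longrightarrow> x \<le> z"
    using mnat_less_trans[of x y z] by (auto simp: less_eq_mnat_def)
  show "x \<le> y \<Longrightarrow> y \<le> x \<Longrightarrow> x = y"
    using mnat_less_irrefl[of x] mnat_less_trans[of x y x] by (auto simp: less_eq_mnat_def)
  show "x \<le> y \<or> y \<le> x"
    using mnat_linear[of x y] by (auto simp: less_eq_mnat_def)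
qed

text \<open>Truncated subtraction, an operation that \<open>linordered_semidom\<close>
  presupposes.\<close>

instantiation mnat :: minus
begin
definition minus_mnat where "x - y = (if y \<le> x then THE z. x = y + z else (0 :: mnat))"
instance ..
end

lemma mnat_add_diff: "(a + b) - a = (b :: mnat)"
  unfolding minus_mnat_def by (auto simp: mnat_le_iff intro!: the_equality dest: mnat_add_cancel)

lemma mnat_diff_0: "\<not> b \<le> a \<Longrightarrow> a - b = (0 :: mnat)"
  by (simp add: minus_mnat_def)

lemma mnat_mult_strict_mono: "a < b \<Longrightarrow> 0 < c \<Longrightarrow> c * a < c * (b :: mnat)"
proof -
  assume "a < b" "0 < c"
  then obtain z w where *: "b = a + z + 1" "c = w + 1" by (auto simp: mnat_less_iff)
  have "c * b = c * (a + z) + c" unfolding *(1) by (rule basic(6))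
  also have "c * (a + z) = c * a + c * z" by (metis mnat_distrib mnat_mult_comm)
  also have "c * a + c * z + c = c * a + (c * z + w) + 1" by (subst (3) *(2)) (simp only: add.assoc)
  finally have "c * b = c * a + (c * z + w) + 1" .
  then show "c * a < c * b" unfolding mnat_less_iff by blast
qed

instance mnat :: linordered_semidom
proof
  fix a b c :: mnat
  show "(a * b) * c = a * (b * c)" by (rule mnat_mult_assoc)
  show "a * b = b * a" by (rule mnat_mult_comm)
  show "1 * a = a" using mnat_mult_1_left[of 0 a] by (simp add: mnat_mult_0_left)
  show "(a + b) * c = a * c + b * c" by (rule mnat_distrib)
  show "a * (b + c) = a * b + a * c" by (metis mnat_distrib mnat_mult_comm)
  show "0 * a = 0" "a * 0 = 0" by (rule mnat_mult_0_left basic(5))+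
  show "0 \<noteq> (1 :: mnat)" using basic(1)[of 0] by simp
  show "a + b - a = b" by (rule mnat_add_diff)
  show "a - b - c = a - (b + c)"
  proof (cases "b + c \<le> a")
    case True
    then obtain z where "a = b + c + z" by (auto simp: mnat_le_iff)
    then show ?thesis
      using mnat_add_diff[of "b + c" z] mnat_add_diff[of b "c + z"] mnat_add_diff[of c z]
      by (simp add: add.assoc)
  next
    case False
    show ?thesis
    proof (cases "b \<le> a")
      case True
      then obtain z where z: "a = b + z" by (auto simp: mnat_le_iff)
      with False have "\<not> c \<le> z" by (auto simp: mnat_le_iff add.assoc)
      with False show ?thesis by (simp add: z mnat_add_diff mnat_diff_0)
    next
      case b: False
      have "0 - c = 0"
        using mnat_add_diff[of 0 0] mnat_diff_0[of c 0] basic(7)[of c]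
        by (cases "c = 0") (auto simp: less_eq_mnat_def)
      with b False show ?thesis by (simp add: mnat_diff_0)
    qed
  qed
  show "a * (b - c) = a * b - a * c"
  proof (cases "c \<le> b")
    case True
    then obtain z where z: "b = c + z" by (auto simp: mnat_le_iff)
    show ?thesis
      unfolding z mnat_add_diff mnat_mult_comm[of a] mnat_distrib ..
  next
    case False
    show ?thesis
    proof (cases "a = 0")
      case True
      then show ?thesis using mnat_add_diff[of 0 0] by (simp add: mnat_mult_0_left)
    next
      case a: False
      then have "0 < a" using basic(7)[of a] mnat_linear[of a 0] by blast
      from mnat_mult_strict_mono[OF _ this, of b c] False have "\<not> a * c \<le> a * b" by (simp add: not_le)
      with False show ?thesis by (simp add: mnat_diff_0 basic)
    qed
  qed
  show "a \<le> b \<Longrightarrow> c + a \<le> c + b" by (auto simp: mnat_le_iff add.assoc)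
  show "a < b \<Longrightarrow> 0 < c \<Longrightarrow> c * a < c * b" by (rule mnat_mult_strict_mono)
  show "0 < (1 :: mnat)" using basic(8)[of 0 0] by simp
  show "b \<le> a \<Longrightarrow> a - b + b = a"
    unfolding mnat_le_iff by (metis mnat_add_diff add.commute)
  show "a \<noteq> 0 \<Longrightarrow> b \<noteq> 0 \<Longrightarrow> a * b \<noteq> 0"
    using mnat_mult_strict_mono[of 0 b a] basic(7)[of a] basic(7)[of b] mnat_linear[of a 0] mnat_linear[of b 0]
      mnat_less_irrefl by (auto simp: basic)
qed

instance mnat :: canonically_ordered_monoid_add
  by standard (rule mnat_le_iff)

lemma mnat_less_add_1_iff: "x < y + 1 \<longleftrightarrow> x \<le> (y :: mnat)"
  by (simp add: basic less_eq_mnat_def)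

lemma mnat_add_1_le_iff: "x + 1 \<le> y \<longleftrightarrow> x < (y :: mnat)"
  using mnat_less_add_1_iff[of y x] by (metis not_le)

subsection \<open>Coding of sequences and recursion\<close>

lemma arith_fun_app: "arith_fun (\<lambda>e. F (e 0)) \<Longrightarrow> arith_fun s \<Longrightarrow> arith_fun (\<lambda>e. F (s e))"
  by (rule arith_fun1) (simp_all add: arith_fun_def)

lemma arith_fun_if:
  assumes "arith b" "arith_fun s" "arith_fun t"
  shows "arith_fun (\<lambda>e. if b e then s e else t e)"
proof -
  have "arith (\<lambda>e. (b (\<lambda>i. e (Suc i)) \<longrightarrow> e 0 = s (\<lambda>i. e (Suc i))) \<and>
      (\<not> b (\<lambda>i. e (Suc i)) \<longrightarrow> e 0 = t (\<lambda>i. e (Suc i))))"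
    by (intro arith_conj arith_imp arith_not arith_rename[OF assms(1)]
        assms(2,3)[unfolded arith_fun_def])
  then show ?thesis
    unfolding arith_fun_def by (rule back_subst[of arith]) auto
qed

lemma arith_dvd:
  assumes "arith_fun s" "arith_fun t"
  shows "arith (\<lambda>e. s e dvd t e)"
  unfolding dvd_def by (intro arith_intros assms[THEN arith_fun_rename])

lemma mnat_strong_induct:
  assumes "arith (\<lambda>e. P (e 0))" "\<And>n. (\<And>m. m < n \<Longrightarrow> P m) \<Longrightarrow> P n"
  shows "P (n :: mnat)"
proof -
  have "\<forall>m<n + 1. P m"
  proof (rule mnat_induct[of "\<lambda>n. \<forall>m<n + 1. P m"])
    show "arith (\<lambda>e. \<forall>m<e 0 + 1. P m)"
      by (intro arith_intros arith_rel1[of P, OF assms(1)])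
    show "\<forall>m<0 + 1. P m"
      using assms(2)[of 0] by (auto simp: mnat_less_add_1_iff simp del: add_0 add_0_left)
    show "\<forall>m<n + 1 + 1. P m" if "\<forall>m<n + 1. P m" for n
      using that assms(2)[of "n + 1"] by (auto simp: mnat_less_add_1_iff[of _ "n + 1"] le_less)
  qed
  then show ?thesis by (simp add: mnat_less_add_1_iff)
qed

section \<open>Division and congruences in the model\<close>

lemma division_exists:
  assumes "0 < (m :: mnat)"
  shows "\<exists>q r. c = q * m + r \<and> r < m"
proof (rule mnat_induct[of "\<lambda>c. \<exists>q r. c = q * m + r \<and> r < m"])
  show "\<exists>q r. 0 = q * m + r \<and> r < m"
    using assms by (intro exI[of _ 0]) simp
  fix c assume "\<exists>q r. c = q * m + r \<and> r < m"
  then obtain q r where *: "c = q * m + r" "r < m" by blast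
  show "\<exists>q r. c + 1 = q * m + r \<and> r < m"
  proof (cases "r + 1 < m")
    case True
    with * show ?thesis by (intro exI[of _ q] exI[of _ "r + 1"]) (simp add: add.assoc)
  next
    case False
    with *(2) have "r + 1 = m" by (simp add: mnat_add_1_le_iff[symmetric])
    with * assms show ?thesis by (intro exI[of _ "q + 1"] exI[of _ 0]) (auto simp: algebra_simps)
  qed
qed (intro arith_intros)

lemma division_unique:
  assumes "q * m + r = q' * m + r'" "r < m" "r' < (m :: mnat)"
  shows "r = r'"
proof -
  have aux: "\<not> q < q'" if eq: "q * m + r = q' * m + r'" and "r < m" for q q' r r' :: mnat
  proof
    assume "q < q'"
    then have "(q + 1) * m \<le> q' * m" by (simp add: mnat_add_1_le_iff mult_right_mono)
    moreover have "q * m + r < (q + 1) * m" using \<open>r < m\<close> by (simp add: distrib_right)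
    moreover have "q' * m \<le> q' * m + r'" by simp
    ultimately show False unfolding eq by (meson leD order_trans)
  qed
  have "q = q'" using aux[OF assms(1,2)] aux[OF assms(1)[symmetric] assms(3)] by simp
  with assms(1) show ?thesis by simp
qed

text \<open>Multiples of the modulus are added on both sides because subtraction is
  truncated.\<close>

definition mcong :: "mnat \<Rightarrow> mnat \<Rightarrow> mnat \<Rightarrow> bool" where
  "mcong m a b \<longleftrightarrow> (\<exists>x y. a + x * m = b + y * m)"

lemma arith_mcong:
  assumes "arith_fun m" "arith_fun a" "arith_fun b"
  shows "arith (\<lambda>e. mcong (m e) (a e) (b e))"
  unfolding mcong_def by (intro arith_intros assms[THEN arith_fun_rename])

lemma mcongI: "a + x * m = b + y * m \<Longrightarrow> mcong m a b"
  unfolding mcong_def by blast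

lemma mcong_refl: "mcong m a a"
  by (rule mcongI[of _ 0 _ _ 0]) simp

lemma mcong_sym: "mcong m a b \<Longrightarrow> mcong m b a"
  unfolding mcong_def by (metis)

lemma mcong_trans:
  assumes "mcong m a b" "mcong m b c"
  shows "mcong m a c"
proof -
  obtain x y z w where *: "a + x * m = b + y * m" "b + z * m = c + w * m"
    using assms unfolding mcong_def by blast
  have "a + (x + z) * m = (a + x * m) + z * m" by (simp add: algebra_simps)
  also have "\<dots> = (b + z * m) + y * m" unfolding *(1) by (simp add: algebra_simps)
  also have "\<dots> = c + (w + y) * m" unfolding *(2) by (simp add: algebra_simps)
  finally show ?thesis by (rule mcongI)
qed

lemma mcong_add:
  assumes "mcong m a b" "mcong m c d"
  shows "mcong m (a + c) (b + d)"
proof -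
  obtain x y z w where *: "a + x * m = b + y * m" "c + z * m = d + w * m"
    using assms unfolding mcong_def by blast
  have "a + c + (x + z) * m = (a + x * m) + (c + z * m)" by (simp add: algebra_simps)
  also have "\<dots> = b + d + (y + w) * m" unfolding * by (simp add: algebra_simps)
  finally show ?thesis by (rule mcongI)
qed

lemma mcong_mult_left:
  assumes "mcong m a b"
  shows "mcong m (c * a) (c * b)"
proof -
  obtain x y where *: "a + x * m = b + y * m"
    using assms unfolding mcong_def by blast
  have "c * a + (c * x) * m = c * (a + x * m)" by (simp add: algebra_simps)
  also have "\<dots> = c * b + (c * y) * m" unfolding * by (simp add: algebra_simps)
  finally show ?thesis by (rule mcongI)
qed

lemma mcong_mult:
  assumes "mcong m a b" "mcong m c d"
  shows "mcong m (a * c) (b * d)"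
  using mcong_trans[OF mcong_mult_left[OF assms(2), of a]] mcong_mult_left[OF assms(1), of d]
  by (simp add: mult.commute)

lemma mcong_cancel:
  assumes "mcong m (a + c) (b + c)"
  shows "mcong m a b"
proof -
  obtain x y where "a + c + x * m = b + c + y * m"
    using assms unfolding mcong_def by blast
  then have "(a + x * m) + c = (b + y * m) + c" by (simp only: ac_simps)
  then show ?thesis by (intro mcongI) simp
qed

lemma mcong_multiple: "m dvd a \<Longrightarrow> mcong m (b + a) b"
proof (elim dvdE)
  show "mcong m (b + a) b" if "a = m * k" for k
    by (rule mcongI[of _ 0 _ _ k]) (simp add: that mult.commute)
qed

lemma mcong_remainder:
  assumes "mcong m c x" "x < m"
  shows "\<exists>q. c = q * m + x"
proof -
  obtain a b where ab: "c + a * m = x + b * m" using assms(1) unfolding mcong_def by blast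
  have "0 < m" using assms(2) by (rule le_less_trans[rotated]) simp
  then obtain q r where qr: "c = q * m + r" "r < m" using division_exists by blast
  have "(q + a) * m + r = b * m + x"
    using ab unfolding qr by (simp add: algebra_simps)
  then have "r = x" using division_unique qr(2) assms(2) by blast
  with qr show ?thesis by blast
qed

section \<open>Goedel's beta function and the Chinese remainder theorem\<close>

text \<open>Let \<open>a\<close> and \<open>m\<close> be the moduli for \<open>i\<close> and
  \<open>i + e\<close>, and \<open>w = i + e + 1\<close>, so that \<open>m = a + e * d\<close>.
  Modulo \<open>m\<close>, \<open>w * d\<close> is \<open>-1\<close>. With \<open>d = e * f\<close>
  and \<open>u = f * w * w\<close> the product \<open>e * d * u\<close> is the square of
  \<open>w * d\<close>, that is \<open>1\<close>. So \<open>a * u\<close> is \<open>-1\<close>, and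
  \<open>u * (a * u)\<close> inverts \<open>a\<close>.\<close>

lemma beta_moduli_coprime:
  fixes d :: mnat
  assumes "e dvd d"
  shows "\<exists>u. mcong ((i + e + 1) * d + 1) (((i + 1) * d + 1) * u) 1"
proof -
  obtain f where f: "d = e * f" using assms by (rule dvdE)
  define w where "w = i + e + 1"
  define m where "m = w * d + 1"
  define a where "a = (i + 1) * d + 1"
  define u where "u = f * w * w"
  have 1: "a + e * d = m" unfolding a_def m_def w_def by (simp add: algebra_simps)
  have 2: "e * d * u = (w * d) * (w * d)" unfolding u_def by (subst (2) f) (simp add: f algebra_simps)
  have "a * u + 1 + m * m = a * u + e * d * u + (m + m)"
    unfolding 2 unfolding m_def by (simp add: algebra_simps)
  also have "\<dots> = (a + e * d) * u + (m + m)" by (simp add: distrib_right)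
  also have "\<dots> = 0 + (u + 1 + 1) * m" unfolding 1 by (simp add: algebra_simps)
  finally have "mcong m (a * u + 1) 0" by (rule mcongI)
  from mcong_mult_left[OF this, of "a * u"] have "mcong m (a * u * (a * u) + a * u) 0"
    by (simp add: distrib_left)
  from mcong_trans[OF this mcong_sym[OF \<open>mcong m (a * u + 1) 0\<close>]]
  have "mcong m (a * (u * (a * u)) + a * u) (1 + a * u)"
    by (simp only: ac_simps)
  then have "mcong m (a * (u * (a * u))) 1"
    by (rule mcong_cancel)
  then show ?thesis unfolding m_def a_def w_def by blast
qed

text \<open>Takes the place of the factorial in Goedel's construction.\<close>

lemma common_multiple: "\<exists>d>0. \<forall>i. 0 < i \<and> i \<le> m \<longrightarrow> i dvd (d :: mnat)"
proof (rule mnat_induct[of "\<lambda>m. \<exists>d>0. \<forall>i. 0 < i \<and> i \<le> m \<longrightarrow> i dvd (d :: mnat)"])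
  show "arith (\<lambda>e. \<exists>d>0. \<forall>i. 0 < i \<and> i \<le> e 0 \<longrightarrow> i dvd d)"
    by (intro arith_intros arith_dvd)
  show "\<exists>d>0. \<forall>i. 0 < i \<and> i \<le> 0 \<longrightarrow> i dvd (d :: mnat)"
    by (rule exI[of _ 1]) auto
  fix m assume "\<exists>d>0. \<forall>i. 0 < i \<and> i \<le> m \<longrightarrow> i dvd (d :: mnat)"
  then obtain d where d: "d > 0" "\<And>i. 0 < i \<Longrightarrow> i \<le> m \<Longrightarrow> i dvd d" by blast
  have "i dvd d * (m + 1)" if "0 < i" "i \<le> m + 1" for i
    using that d(2)[of i] by (auto simp: le_less[of i] mnat_less_add_1_iff)
  with d(1) show "\<exists>d>0. \<forall>i. 0 < i \<and> i \<le> m + 1 \<longrightarrow> i dvd (d :: mnat)"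
    by (intro exI[of _ "d * (m + 1)"]) (simp add: mult_pos_pos mnat_less_add_1_iff)
qed

definition beta :: "mnat \<Rightarrow> mnat \<Rightarrow> mnat \<Rightarrow> mnat" where
  "beta c d i = (THE x. x < (i + 1) * d + 1 \<and> (\<exists>q. c = q * ((i + 1) * d + 1) + x))"

lemma beta_eq_iff: "beta c d i = x \<longleftrightarrow> x < (i + 1) * d + 1 \<and> (\<exists>q. c = q * ((i + 1) * d + 1) + x)"
proof -
  let ?m = "(i + 1) * d + 1"
  have "0 < ?m" by (simp add: add_nonneg_pos)
  then have ex: "\<exists>x. x < ?m \<and> (\<exists>q. c = q * ?m + x)" using division_exists[of ?m c] by blast
  moreover have un: "x = y" if "x < ?m \<and> (\<exists>q. c = q * ?m + x)" "y < ?m \<and> (\<exists>q. c = q * ?m + y)" for x y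
    using that division_unique[of _ ?m x _ y] by auto
  ultimately have "\<exists>!x. x < ?m \<and> (\<exists>q. c = q * ?m + x)" by blast
  from theI'[OF this] show ?thesis
    unfolding beta_def[symmetric] using un by blast
qed

lemma arith_fun_beta:
  "arith_fun s \<Longrightarrow> arith_fun t \<Longrightarrow> arith_fun u \<Longrightarrow> arith_fun (\<lambda>e. beta (s e) (t e) (u e))"
proof -
  assume *: "arith_fun s" "arith_fun t" "arith_fun u"
  show ?thesis
    unfolding arith_fun_def eq_commute[of _ "beta _ _ _"] beta_eq_iff
    by (intro arith_intros *[THEN arith_fun_rename])
qed

text \<open>The Chinese remainder theorem for the moduli \<open>q i\<close>. As \<open>n\<close> may
  be nonstandard, both the bound on the values of \<open>F\<close> and the code are found by
  induction in the model, which is why \<open>F\<close> has to be arithmetical.\<close>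

lemma beta_code:
  assumes F: "arith_fun (\<lambda>e. F (e 0))"
  shows "\<exists>c d. \<forall>i<n. beta c d i = F i"
proof -
  note F' = arith_fun_app[OF F]
  have "\<exists>b. \<forall>i<n. F i < b"
  proof (rule mnat_induct[of "\<lambda>n. \<exists>b. \<forall>i<n. F i < b"])
    show "arith (\<lambda>e. \<exists>b. \<forall>i<e 0. F i < b)"
      by (intro arith_intros F')
    show "\<exists>b. \<forall>i<n + 1. F i < b" if "\<exists>b. \<forall>i<n. F i < b" for n
    proof -
      from that obtain b where "\<And>i. i < n \<Longrightarrow> F i < b" by blast
      then have "F i < max b (F n + 1)" if "i < n + 1" for i
        using that by (auto simp: mnat_less_add_1_iff le_less[of i] less_max_iff_disj)
      then show ?thesis by blast
    qed
  qed simp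
  then obtain b where b: "\<And>i. i < n \<Longrightarrow> F i < b" by blast
  \<comment> \<open>Divisibility by the bound \<open>b\<close> makes each modulus exceed the entry
    it must store; divisibility by the differences of indices, which are below \<open>n\<close>,
    makes the moduli pairwise coprime.\<close>
  obtain d where d: "0 < d" "\<And>i. 0 < i \<Longrightarrow> i \<le> n + b \<Longrightarrow> i dvd d"
    using common_multiple[of "n + b"] by blast
  define q where "q i = (i + 1) * d + 1" for i
  have q: "arith_fun s \<Longrightarrow> arith_fun (\<lambda>e. q (s e))" for s
    unfolding q_def by (intro arith_intros)
  have less_q: "F i < q i" if "i < n" for i
  proof -
    have "0 < b" using b[OF that] by (rule le_less_trans[rotated]) simp
    then have "b dvd d" by (intro d(2)) simp_all
    then obtain f where f: "d = b * f" by (rule dvdE)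
    with d(1) have "f \<noteq> 0" by auto
    then have "1 \<le> f" using mnat_add_1_le_iff[of 0 f] by (simp add: zero_less_iff_neq_zero)
    then have "b \<le> d" unfolding f using mult_left_mono[of 1 f b] by simp
    also have "d \<le> (i + 1) * d" using mult_right_mono[of 1 "i + 1" d] by simp
    also have "\<dots> < q i" unfolding q_def by (simp add: mnat_less_add_1_iff)
    finally show ?thesis using b[OF that] by simp
  qed
  have inv: "\<exists>u. mcong (q j) (q i * u) 1" if ij: "i < j" "j < n" for i j
  proof -
    obtain e where e: "j = i + e" using ij(1) by (metis less_imp_le le_iff_add)
    with ij(1) have "0 < e" by auto
    moreover have "e \<le> n + b" using ij(2) unfolding e by (meson add_increasing2 le_add_same_cancel2 less_imp_le order_trans zero_le)
    ultimately show ?thesis using beta_moduli_coprime[OF d(2), of e i] unfolding q_def e by (simp add: add.assoc)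
  qed
  \<comment> \<open>\<open>M\<close> plays the part of the product of the first \<open>k\<close>
    moduli: each of them divides it, and it is invertible modulo every later one.\<close>
  have "k \<le> n \<longrightarrow> (\<exists>c M. (\<forall>i<k. mcong (q i) c (F i)) \<and> (\<forall>i<k. q i dvd M) \<and>
      (\<forall>j. k \<le> j \<and> j < n \<longrightarrow> (\<exists>u. mcong (q j) (M * u) 1)))" for k
  proof (rule mnat_induct[of "\<lambda>k. k \<le> n \<longrightarrow> (\<exists>c M. (\<forall>i<k. mcong (q i) c (F i)) \<and> (\<forall>i<k. q i dvd M) \<and>
      (\<forall>j. k \<le> j \<and> j < n \<longrightarrow> (\<exists>u. mcong (q j) (M * u) 1)))"])
    show "arith (\<lambda>e. e 0 \<le> n \<longrightarrow> (\<exists>c M. (\<forall>i<e 0. mcong (q i) c (F i)) \<and> (\<forall>i<e 0. q i dvd M) \<and>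
      (\<forall>j. e 0 \<le> j \<and> j < n \<longrightarrow> (\<exists>u. mcong (q j) (M * u) 1))))"
      by (intro arith_intros arith_mcong arith_dvd q F')
    show "0 \<le> n \<longrightarrow> (\<exists>c M. (\<forall>i<0. mcong (q i) c (F i)) \<and> (\<forall>i<0. q i dvd M) \<and>
      (\<forall>j. 0 \<le> j \<and> j < n \<longrightarrow> (\<exists>u. mcong (q j) (M * u) 1)))"
      by (intro impI exI[of _ 0] exI[of _ 1]) (auto intro: exI[of _ 1] mcong_refl)
  next
    fix k
    assume IH: "k \<le> n \<longrightarrow> (\<exists>c M. (\<forall>i<k. mcong (q i) c (F i)) \<and> (\<forall>i<k. q i dvd M) \<and>
      (\<forall>j. k \<le> j \<and> j < n \<longrightarrow> (\<exists>u. mcong (q j) (M * u) 1)))"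
    show "k + 1 \<le> n \<longrightarrow> (\<exists>c M. (\<forall>i<k + 1. mcong (q i) c (F i)) \<and> (\<forall>i<k + 1. q i dvd M) \<and>
      (\<forall>j. k + 1 \<le> j \<and> j < n \<longrightarrow> (\<exists>u. mcong (q j) (M * u) 1)))"
    proof
      assume "k + 1 \<le> n"
      then have "k < n" by (simp add: mnat_add_1_le_iff)
      with IH obtain c M where "\<forall>i<k. mcong (q i) c (F i)" "\<forall>i<k. q i dvd M"
        "\<forall>j. k \<le> j \<and> j < n \<longrightarrow> (\<exists>u. mcong (q j) (M * u) 1)" by auto
      then have cM: "\<And>i. i < k \<Longrightarrow> mcong (q i) c (F i)" "\<And>i. i < k \<Longrightarrow> q i dvd M"
        "\<And>j. k \<le> j \<Longrightarrow> j < n \<Longrightarrow> \<exists>u. mcong (q j) (M * u) 1" by simp_all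
      obtain u where u: "mcong (q k) (M * u) 1" using cM(3)[of k] \<open>k < n\<close> by auto
      \<comment> \<open>Without negatives, \<open>F k - c\<close> is written
        \<open>F k + c * ((k + 1) * d)\<close>, as \<open>(k + 1) * d\<close> is \<open>-1\<close>
        modulo \<open>q k\<close>. The factor \<open>M\<close> leaves the earlier residues
        alone.\<close>
      define c' where "c' = c + M * (u * (F k + c * ((k + 1) * d)))"
      have "mcong (q i) c' (F i)" if "i < k + 1" for i
      proof (cases "i = k")
        case True
        have "mcong (q k) (M * u * (F k + c * ((k + 1) * d))) (1 * (F k + c * ((k + 1) * d)))"
          by (intro mcong_mult u mcong_refl)
        then have "mcong (q k) c' (c + (F k + c * ((k + 1) * d)))"
          unfolding c'_def mult.assoc mult_1 by (intro mcong_add mcong_refl)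
        also have "c + (F k + c * ((k + 1) * d)) = F k + q k * c"
          unfolding q_def by (simp add: algebra_simps)
        finally show ?thesis
          using mcong_trans mcong_multiple[of "q k" "q k * c" "F k"] True by auto
      next
        case False
        with that have "i < k" by (simp add: mnat_less_add_1_iff)
        then have "mcong (q i) c' c"
          unfolding c'_def by (intro mcong_multiple dvd_mult2 cM(2))
        with cM(1)[OF \<open>i < k\<close>] show ?thesis by (blast intro: mcong_trans)
      qed
      moreover have "q i dvd M * q k" if "i < k + 1" for i
        using that cM(2)[of i] by (auto simp: mnat_less_add_1_iff le_less[of i])
      moreover have "\<exists>u. mcong (q j) (M * q k * u) 1" if kj: "k + 1 \<le> j" "j < n" for j
      proof -
        have "k < j" using kj(1) by (simp add: mnat_add_1_le_iff)
        obtain v where "mcong (q j) (M * v) 1"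
          using cM(3)[OF less_imp_le[OF \<open>k < j\<close>] kj(2)] by blast
        moreover obtain w where "mcong (q j) (q k * w) 1"
          using inv[OF \<open>k < j\<close> kj(2)] by blast
        ultimately have "mcong (q j) ((M * v) * (q k * w)) (1 * 1)" by (rule mcong_mult)
        then show ?thesis by (intro exI[of _ "v * w"]) (simp add: ac_simps)
      qed
      ultimately show "\<exists>c M. (\<forall>i<k + 1. mcong (q i) c (F i)) \<and> (\<forall>i<k + 1. q i dvd M) \<and>
        (\<forall>j. k + 1 \<le> j \<and> j < n \<longrightarrow> (\<exists>u. mcong (q j) (M * u) 1))"
        by (intro exI[of _ c'] exI[of _ "M * q k"]) simp
    qed
  qed
  from this[of n] obtain c where "\<forall>i<n. mcong (q i) c (F i)" by auto
  then have c: "\<And>i. i < n \<Longrightarrow> mcong (q i) c (F i)" by simp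
  have "beta c d i = F i" if "i < n" for i
    unfolding beta_eq_iff
    using less_q[OF that] mcong_remainder[OF c[OF that] less_q[OF that]] by (simp add: q_def)
  then show ?thesis by blast
qed

text \<open>Course-of-values recursion for sets: membership of \<open>z\<close> may depend arithmetically on the part of the
  set below \<open>z\<close>, which is given by a code.\<close>

lemma set_recursion:
  assumes P: "arith (\<lambda>e. P (e 0) {i. beta (e 1) (e 2) i = 1})"
    and local: "\<And>z S S'. (\<And>i. i < z \<Longrightarrow> i \<in> S \<longleftrightarrow> i \<in> S') \<Longrightarrow> P z S \<longleftrightarrow> P z S'"
  obtains H where "H \<in> SS" "\<And>z. z \<in> H \<longleftrightarrow> P z H"
proof -
  let ?S = "\<lambda>c d. {i. beta c d i = 1}"
  \<comment> \<open>An approximation of length \<open>n\<close>, where the entry \<open>1\<close>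
    means membership. What \<open>c, d\<close> code from \<open>n\<close> on is arbitrary, which
    \<open>local\<close> makes harmless.\<close>
  define good where "good c d n \<longleftrightarrow> (\<forall>i<n. beta c d i = 1 \<longleftrightarrow> P i (?S c d))" for c d n
  note P' = arith_rel3[of "\<lambda>z c d. P z (?S c d)", OF P]
  have good_arith: "arith (\<lambda>e. good (s e) (t e) (u e))"
    if "arith_fun s" "arith_fun t" "arith_fun u" for s t u
    unfolding good_def
    by (intro arith_intros P' arith_fun_beta that[THEN arith_fun_rename])
  have ex: "\<exists>c d. good c d n" for n
  proof (rule mnat_induct[of "\<lambda>n. \<exists>c d. good c d n"])
    show "arith (\<lambda>e. \<exists>c d. good c d (e 0))"
      by (intro arith_intros good_arith)
    show "\<exists>c d. good c d 0" by (simp add: good_def)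
    fix n assume "\<exists>c d. good c d n"
    then obtain c d where cd: "good c d n" by blast
    define F where "F i = (if i < n then beta c d i else if P n (?S c d) then 1 else 0)" for i
    have "arith_fun (\<lambda>e. F (e 0))"
      unfolding F_def by (intro arith_fun_if arith_intros arith_fun_beta)
    then obtain c' d' where "\<forall>i<n + 1. beta c' d' i = F i" using beta_code by blast
    then have eq: "beta c' d' i = F i" if "i \<le> n" for i using that by (simp add: mnat_less_add_1_iff)
    have loc: "P i (?S c' d') \<longleftrightarrow> P i (?S c d)" if "i \<le> n" for i
      by (rule local) (use that eq in \<open>auto simp: F_def\<close>)
    have "beta c' d' i = 1 \<longleftrightarrow> P i (?S c' d')" if "i \<le> n" for i
      using that cd unfolding loc[OF that] eq[OF that] good_def F_def by (auto simp: le_less)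
    then show "\<exists>c d. good c d (n + 1)"
      unfolding good_def by (auto simp: mnat_less_add_1_iff)
  qed
  \<comment> \<open>Approximations agree wherever both are correct, so \<open>H\<close> can be read
    off from any of them.\<close>
  have unique: "beta c d i = 1 \<longleftrightarrow> beta c' d' i = 1" if "good c d n" "good c' d' n'" "i < n" "i < n'"
    for c d c' d' n n' i
  proof -
    have "i < n \<longrightarrow> i < n' \<longrightarrow> (beta c d i = 1 \<longleftrightarrow> beta c' d' i = 1)"
    proof (rule mnat_strong_induct[of "\<lambda>i. i < n \<longrightarrow> i < n' \<longrightarrow> (beta c d i = 1 \<longleftrightarrow> beta c' d' i = 1)"])
      show "arith (\<lambda>e. e 0 < n \<longrightarrow> e 0 < n' \<longrightarrow> (beta c d (e 0) = 1 \<longleftrightarrow> beta c' d' (e 0) = 1))"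
        by (intro arith_intros arith_fun_beta)
      fix i assume IH: "\<And>j. j < i \<Longrightarrow> j < n \<longrightarrow> j < n' \<longrightarrow> (beta c d j = 1 \<longleftrightarrow> beta c' d' j = 1)"
      show "i < n \<longrightarrow> i < n' \<longrightarrow> (beta c d i = 1 \<longleftrightarrow> beta c' d' i = 1)"
      proof (intro impI)
        assume "i < n" "i < n'"
        then have "P i (?S c d) \<longleftrightarrow> P i (?S c' d')"
          by (intro local) (use IH in force)
        with \<open>i < n\<close> \<open>i < n'\<close> that(1,2) show "beta c d i = 1 \<longleftrightarrow> beta c' d' i = 1"
          by (simp add: good_def)
      qed
    qed
    with that(3,4) show ?thesis by blast
  qed
  define H where "H = {z. \<exists>c d. good c d (z + 1) \<and> beta c d z = 1}"
  have "H \<in> SS"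
    unfolding H_def by (rule SS_comprehension) (intro arith_intros good_arith arith_fun_beta)
  moreover have "z \<in> H \<longleftrightarrow> P z H" for z
  proof -
    obtain c d where cd: "good c d (z + 1)" using ex by blast
    have H: "i \<in> H \<longleftrightarrow> beta c d i = 1" if "i \<le> z" for i
    proof -
      have g: "good c d (i + 1)"
        using cd that unfolding good_def by (auto simp: mnat_less_add_1_iff)
      have i: "i < i + 1" by (simp add: mnat_less_add_1_iff)
      show ?thesis
      proof
        assume "i \<in> H"
        then obtain c' d' where "good c' d' (i + 1)" "beta c' d' i = 1" unfolding H_def by blast
        with unique[OF g this(1) i i] show "beta c d i = 1" by simp
      next
        assume "beta c d i = 1"
        with g show "i \<in> H" unfolding H_def by blast
      qed
    qed
    have "P z H \<longleftrightarrow> P z (?S c d)" by (rule local) (use H in auto)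
    then show ?thesis
      using cd H[of z] by (simp add: good_def mnat_less_add_1_iff)
  qed
  ultimately show thesis by (rule that)
qed

subsection \<open>Ramsey's theorem for sums\<close>

definition unbounded :: "mnat set \<Rightarrow> bool" where
  "unbounded A \<longleftrightarrow> (\<forall>b. \<exists>x. b < x \<and> x \<in> A)"

lemma mnat_least:
  assumes "arith (\<lambda>e. P (e 0))" "P x"
  shows "\<exists>y. P y \<and> (\<forall>z<y. \<not> P (z :: mnat))"
proof (rule ccontr)
  assume *: "\<nexists>y. P y \<and> (\<forall>z<y. \<not> P z)"
  have "\<not> P x"
    by (rule mnat_strong_induct[of "\<lambda>x. \<not> P x"]) (use arith_not[OF assms(1)] * in auto)
  with assms(2) show False by blast
qed

text \<open>\<open>s\<close> may be nonstandard, so the bounds for \<open>n \<le> s\<close> cannot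
  be combined by finiteness; induction in the model combines them one at a time.\<close>

lemma collection:
  assumes "arith (\<lambda>e. Q (e 0) (e 1))"
    and mono: "\<And>n b c. Q n b \<Longrightarrow> b \<le> c \<Longrightarrow> Q n c"
    and ex: "\<And>n. \<exists>b. Q n b"
  shows "\<exists>b. \<forall>n\<le>s. Q n (b :: mnat)"
proof (rule mnat_induct[of "\<lambda>s. \<exists>b. \<forall>n\<le>s. Q n b"])
  show "arith (\<lambda>e. \<exists>b. \<forall>n\<le>e 0. Q n b)"
    by (intro arith_intros arith_rel2[of Q, OF assms(1)])
  show "\<exists>b. \<forall>n\<le>0. Q n b" using ex[of 0] by auto
  fix s assume "\<exists>b. \<forall>n\<le>s. Q n b"
  then obtain b c where "\<forall>n\<le>s. Q n b" "Q (s + 1) c" using ex[of "s + 1"] by blast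
  then have "\<forall>n\<le>s + 1. Q n (max b c)"
    using mono by (auto simp: le_less[of _ "s + 1"] mnat_less_add_1_iff)
  then show "\<exists>b. \<forall>n\<le>s + 1. Q n b" by blast
qed

text \<open>The set \<open>G\<close> decides greedily, for \<open>s = 0, 1, \<dots>\<close>, whether to keep the \<open>y\<close> with \<open>s + y \<in> C\<close> or those
  with \<open>s + y \<notin> C\<close>, so that unboundedly many \<open>y\<close> agree with the first \<open>s\<close> decisions. The \<open>s\<close>-th element
  of \<open>Y\<close> is the least such \<open>y \<ge> s\<close>.\<close>

lemma cohesive:
  assumes C: "C \<in> SS" and X: "X \<in> SS" "unbounded X"
  shows "\<exists>Y G. Y \<in> SS \<and> G \<in> SS \<and> Y \<subseteq> X \<and> unbounded Y \<and>
    (\<forall>s. \<exists>b. \<forall>y. b < y \<longrightarrow> y \<in> Y \<longrightarrow> (s + y \<in> C \<longleftrightarrow> s \<in> G))"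
proof -
  define P where "P s S \<longleftrightarrow> (\<forall>b. \<exists>y. b < y \<and> y \<in> X \<and> s + y \<in> C \<and>
    (\<forall>i<s. i + y \<in> C \<longleftrightarrow> i \<in> S))" for s S
  have "arith (\<lambda>e. P (e 0) {i. beta (e 1) (e 2) i = 1})"
    unfolding P_def mem_Collect_eq by (intro arith_intros arith_fun_beta C X)
  moreover have "P s S \<longleftrightarrow> P s S'" if "\<And>i. i < s \<Longrightarrow> i \<in> S \<longleftrightarrow> i \<in> S'" for s S S'
    unfolding P_def by (simp add: that)
  ultimately obtain G where G: "G \<in> SS" "\<And>s. s \<in> G \<longleftrightarrow> P s G"
    using set_recursion by blast
  have agree: "\<forall>b. \<exists>y. b < y \<and> y \<in> X \<and> (\<forall>i<s. i + y \<in> C \<longleftrightarrow> i \<in> G)" for s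
  proof (rule mnat_induct[of "\<lambda>s. \<forall>b. \<exists>y. b < y \<and> y \<in> X \<and> (\<forall>i<s. i + y \<in> C \<longleftrightarrow> i \<in> G)"])
    show "arith (\<lambda>e. \<forall>b. \<exists>y. b < y \<and> y \<in> X \<and> (\<forall>i<e 0. i + y \<in> C \<longleftrightarrow> i \<in> G))"
      by (intro arith_intros C X G)
    show "\<forall>b. \<exists>y. b < y \<and> y \<in> X \<and> (\<forall>i<0. i + y \<in> C \<longleftrightarrow> i \<in> G)"
      using X(2) by (simp add: unbounded_def)
    fix s assume IH: "\<forall>b. \<exists>y. b < y \<and> y \<in> X \<and> (\<forall>i<s. i + y \<in> C \<longleftrightarrow> i \<in> G)"
    show "\<forall>b. \<exists>y. b < y \<and> y \<in> X \<and> (\<forall>i<s + 1. i + y \<in> C \<longleftrightarrow> i \<in> G)"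
    proof
      fix b
      show "\<exists>y. b < y \<and> y \<in> X \<and> (\<forall>i<s + 1. i + y \<in> C \<longleftrightarrow> i \<in> G)"
      proof (cases "s \<in> G")
        case True
        then obtain y where "b < y" "y \<in> X" "s + y \<in> C" "\<forall>i<s. i + y \<in> C \<longleftrightarrow> i \<in> G"
          using G(2)[of s] unfolding P_def by blast
        with True show ?thesis by (intro exI[of _ y]) (auto simp: mnat_less_add_1_iff le_less)
      next
        case False
        then obtain b0 where b0: "\<not> (\<exists>y. b0 < y \<and> y \<in> X \<and> s + y \<in> C \<and> (\<forall>i<s. i + y \<in> C \<longleftrightarrow> i \<in> G))"
          using G(2)[of s] unfolding P_def by blast
        \<comment> \<open>Beyond \<open>b0\<close> no \<open>y\<close> that agrees below
          \<open>s\<close> puts \<open>s + y\<close> into \<open>C\<close>, so every agreeing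
          \<open>y\<close> there confirms \<open>s \<notin> G\<close>.\<close>
        obtain y where y: "max b b0 < y" "y \<in> X" "\<forall>i<s. i + y \<in> C \<longleftrightarrow> i \<in> G" using IH by blast
        then have "s + y \<notin> C" using b0 by auto
        with False y show ?thesis by (intro exI[of _ y]) (auto simp: mnat_less_add_1_iff le_less)
      qed
    qed
  qed
  \<comment> \<open>The demand \<open>s \<le> y\<close> makes the selected elements unbounded, even
    if one \<open>y\<close> serves several \<open>s\<close>.\<close>
  define A where "A s y \<longleftrightarrow> s \<le> y \<and> y \<in> X \<and> (\<forall>i<s. i + y \<in> C \<longleftrightarrow> i \<in> G)" for s y
  define L where "L s y \<longleftrightarrow> A s y \<and> (\<forall>z<y. \<not> A s z)" for s y
  have A_arith: "arith (\<lambda>e. A (s e) (t e))" if "arith_fun s" "arith_fun t" for s t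
    unfolding A_def by (intro arith_intros that that[THEN arith_fun_rename] C X G)
  have L_arith: "arith (\<lambda>e. L (s e) (t e))" if "arith_fun s" "arith_fun t" for s t
    unfolding L_def by (intro arith_intros A_arith that that[THEN arith_fun_rename])
  have L_ex: "\<exists>y. L s y" for s
  proof -
    obtain y where "s < y" "y \<in> X" "\<forall>i<s. i + y \<in> C \<longleftrightarrow> i \<in> G" using agree by blast
    then have "A s y" by (simp add: A_def)
    moreover have "arith (\<lambda>e. A s (e 0))" by (intro A_arith arith_intros)
    ultimately show ?thesis unfolding L_def using mnat_least[of "A s"] by blast
  qed
  have L_unique: "y = z" if "L s y" "L s z" for s y z
    using that unfolding L_def by (metis linorder_neqE)
  define Y where "Y = {y. \<exists>s. L s y}"
  have "Y \<in> SS"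
    unfolding Y_def by (rule SS_comprehension) (intro arith_intros L_arith)
  moreover have "Y \<subseteq> X"
    unfolding Y_def L_def A_def by blast
  moreover have "unbounded Y"
    unfolding unbounded_def
  proof
    fix b
    obtain y where y: "L (b + 1) y" using L_ex by blast
    then have "b < y" unfolding L_def A_def by (simp add: mnat_add_1_le_iff)
    with y show "\<exists>y. b < y \<and> y \<in> Y" unfolding Y_def by blast
  qed
  moreover have "\<exists>b. \<forall>y. b < y \<longrightarrow> y \<in> Y \<longrightarrow> (s + y \<in> C \<longleftrightarrow> s \<in> G)" for s
  proof -
    \<comment> \<open>Only the elements chosen for \<open>n \<le> s\<close> may disagree about
      \<open>s\<close>; collection bounds them.\<close>
    have "\<exists>b. \<forall>n\<le>s. \<forall>y. L n y \<longrightarrow> y \<le> b"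
    proof (rule collection)
      show "arith (\<lambda>e. \<forall>y. L (e 0) y \<longrightarrow> y \<le> e 1)"
        by (intro arith_intros L_arith)
      show "\<forall>y. L n y \<longrightarrow> y \<le> c" if "\<forall>y. L n y \<longrightarrow> y \<le> b" "b \<le> c" for n b c
        using that by (meson order_trans)
      show "\<exists>b. \<forall>y. L n y \<longrightarrow> y \<le> b" for n
        using L_ex[of n] L_unique[of n] by (metis order_refl)
    qed
    then obtain b where b: "\<forall>n\<le>s. \<forall>y. L n y \<longrightarrow> y \<le> b" by blast
    have "s + y \<in> C \<longleftrightarrow> s \<in> G" if y: "b < y" "y \<in> Y" for y
    proof -
      obtain n where n: "L n y" using y(2) unfolding Y_def by blast
      then have "s < n" using b y(1) by (meson leD not_le)
      with n show ?thesis unfolding L_def A_def by blast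
    qed
    then show ?thesis by blast
  qed
  ultimately show ?thesis using G(1) by blast
qed

text \<open>The point from which the limit colour of \<open>s\<close> is attained depends on
  \<open>s\<close>. \<open>H\<close> is chosen recursively so that at each new element this point is
  already passed, as far as \<open>H\<close> can tell, by every \<open>s\<close> that is a sum of
  \<open>k\<close> earlier elements: if \<open>x\<close> is the largest of them, then
  \<open>s \<le> k * x\<close>.\<close>

lemma thinning:
  assumes C: "C \<in> SS" and G: "G \<in> SS" and X: "X \<in> SS" "unbounded X"
    and lim: "\<And>s. \<exists>b. \<forall>y. b < y \<longrightarrow> y \<in> X \<longrightarrow> (s + y \<in> C \<longleftrightarrow> s \<in> G)"
  shows "\<exists>H. H \<in> SS \<and> H \<subseteq> X \<and> unbounded H \<and>
    (\<forall>x\<in>H. \<forall>z\<in>H. x < z \<longrightarrow> (\<forall>s\<le>k * x. s + z \<in> C \<longleftrightarrow> s \<in> G))"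
proof -
  define P where "P z S \<longleftrightarrow> z \<in> X \<and> (\<forall>x. x < z \<longrightarrow> x \<in> S \<longrightarrow> (\<forall>s\<le>k * x. s + z \<in> C \<longleftrightarrow> s \<in> G))" for z S
  have "arith (\<lambda>e. P (e 0) {i. beta (e 1) (e 2) i = 1})"
    unfolding P_def mem_Collect_eq by (intro arith_intros arith_fun_beta C G X)
  moreover have "P s S \<longleftrightarrow> P s S'" if "\<And>i. i < s \<Longrightarrow> i \<in> S \<longleftrightarrow> i \<in> S'" for s S S'
    unfolding P_def using that by auto
  ultimately obtain H where H: "H \<in> SS" "\<And>z. z \<in> H \<longleftrightarrow> P z H"
    using set_recursion by blast
  have "\<exists>z. b < z \<and> z \<in> H" for b
  proof (rule ccontr)
    assume none: "\<nexists>z. b < z \<and> z \<in> H"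
    \<comment> \<open>If \<open>b\<close> bounded \<open>H\<close>, collection would give one
      settling point \<open>c\<close> for all \<open>s \<le> k * b\<close>, and any \<open>z\<close>
      of \<open>X\<close> beyond \<open>b\<close> and \<open>c\<close> would qualify.\<close>
    have "\<exists>c. \<forall>s\<le>k * b. \<forall>y. c < y \<longrightarrow> y \<in> X \<longrightarrow> (s + y \<in> C \<longleftrightarrow> s \<in> G)"
    proof (rule collection)
      show "arith (\<lambda>e. \<forall>y. e 1 < y \<longrightarrow> y \<in> X \<longrightarrow> (e 0 + y \<in> C \<longleftrightarrow> e 0 \<in> G))"
        by (intro arith_intros C G X)
    qed (use lim in \<open>auto dest: le_less_trans\<close>)
    then obtain c where c: "\<forall>s\<le>k * b. \<forall>y. c < y \<longrightarrow> y \<in> X \<longrightarrow> (s + y \<in> C \<longleftrightarrow> s \<in> G)" by blast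
    obtain z where z: "max b c < z" "z \<in> X" using X(2) unfolding unbounded_def by blast
    have "s + z \<in> C \<longleftrightarrow> s \<in> G" if "x \<in> H" "s \<le> k * x" for x s
    proof -
      have "x \<le> b" using none that(1) by (meson not_le)
      then have "s \<le> k * b" using that(2) mult_left_mono[of x b k] by (auto intro: order_trans)
      with c z show ?thesis by auto
    qed
    then have "P z H" unfolding P_def using z(2) by blast
    then have "z \<in> H" using H(2) by blast
    with none z(1) show False by auto
  qed
  moreover have "H \<subseteq> X" using H(2) unfolding P_def by blast
  moreover have "s + z \<in> C \<longleftrightarrow> s \<in> G" if "x \<in> H" "z \<in> H" "x < z" "s \<le> k * x" for x z s
    using that H(2)[of z] unfolding P_def by blast
  ultimately show ?thesis
    using H(1) unfolding unbounded_def by blast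
qed

text \<open>\<open>j\<close> and the finite sets \<open>A\<close> belong to the metatheory, so the
  induction runs outside the model. \<open>C\<close> varies in it because the induction hypothesis
  is applied to the limit colouring \<open>G\<close>: splitting off the maximum of \<open>A\<close>
  turns the colour of \<open>\<Sum>A\<close> into the limit colour of the sum of the rest.\<close>

lemma ramsey_sums:
  assumes "C \<in> SS" "X \<in> SS" "unbounded X"
  shows "\<exists>H v. H \<in> SS \<and> H \<subseteq> X \<and> unbounded H \<and>
    (\<forall>A\<subseteq>H. finite A \<longrightarrow> card A = j \<longrightarrow> (\<Sum>A \<in> C \<longleftrightarrow> v))"
  using assms
proof (induction j arbitrary: C X)
  case 0
  then show ?case by (intro exI[of _ X] exI[of _ "0 \<in> C"]) auto
next
  case (Suc j)
  show ?case
  \<comment> \<open>A singleton leaves nothing after its maximum is removed, so no element could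
    bound the rest; this case is the pigeonhole principle.\<close>
  proof (cases j)
    case 0
    have "\<exists>H v. H \<in> SS \<and> H \<subseteq> X \<and> unbounded H \<and> (\<forall>x\<in>H. x \<in> C \<longleftrightarrow> v)"
    proof (cases "\<forall>b. \<exists>x. b < x \<and> x \<in> X \<and> x \<in> C")
      case True
      have "{x. x \<in> X \<and> x \<in> C} \<in> SS"
        by (rule SS_comprehension) (intro arith_intros Suc.prems)
      with True show ?thesis
        by (intro exI[of _ "{x. x \<in> X \<and> x \<in> C}"] exI[of _ True]) (auto simp: unbounded_def)
    next
      case False
      then obtain b where b: "\<And>x. b < x \<Longrightarrow> x \<in> X \<Longrightarrow> x \<notin> C" by blast
      have "{x. x \<in> X \<and> b < x} \<in> SS"
        by (rule SS_comprehension) (intro arith_intros Suc.prems)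
      moreover have "\<exists>x. c < x \<and> x \<in> X \<and> b < x" for c
        using Suc.prems(3)[unfolded unbounded_def, rule_format, of "max b c"] by auto
      ultimately show ?thesis using b
        by (intro exI[of _ "{x. x \<in> X \<and> b < x}"] exI[of _ False]) (auto simp: unbounded_def)
    qed
    then obtain H v where "H \<in> SS" "H \<subseteq> X" "unbounded H" "\<forall>x\<in>H. x \<in> C \<longleftrightarrow> v" by blast
    then show ?thesis
      by (intro exI[of _ H] exI[of _ v]) (auto simp: 0 card_1_singleton_iff)
  next
    case (Suc i)
    obtain Y G where Y: "Y \<in> SS" "G \<in> SS" "Y \<subseteq> X" "unbounded Y"
      and lim: "\<And>s. \<exists>b. \<forall>y. b < y \<longrightarrow> y \<in> Y \<longrightarrow> (s + y \<in> C \<longleftrightarrow> s \<in> G)"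
      using cohesive[OF Suc.prems] by blast
    obtain H' v where H': "H' \<in> SS" "H' \<subseteq> Y" "unbounded H'"
      and v: "\<And>A. A \<subseteq> H' \<Longrightarrow> finite A \<Longrightarrow> card A = j \<Longrightarrow> \<Sum>A \<in> G \<longleftrightarrow> v"
      using Suc.IH[OF Y(2,1,4)] by blast
    have "\<exists>b. \<forall>y. b < y \<longrightarrow> y \<in> H' \<longrightarrow> (s + y \<in> C \<longleftrightarrow> s \<in> G)" for s
      using lim[of s] H'(2) by blast
    \<comment> \<open>A sum of \<open>j\<close> elements is at most \<open>j\<close> times the
      largest of them, whence the factor \<open>of_nat j\<close>.\<close>
    from thinning[OF Suc.prems(1) Y(2) H'(1,3) this, of "of_nat j"]
    obtain H where H: "H \<in> SS" "H \<subseteq> H'" "unbounded H"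
      and thin: "\<And>x z s. x \<in> H \<Longrightarrow> z \<in> H \<Longrightarrow> x < z \<Longrightarrow> s \<le> of_nat j * x \<Longrightarrow> s + z \<in> C \<longleftrightarrow> s \<in> G"
      by blast
    have "\<Sum>A \<in> C \<longleftrightarrow> v" if A: "A \<subseteq> H" "finite A" "card A = Suc j" for A
    proof -
      define z where "z = Max A"
      define B where "B = A - {z}"
      have "A \<noteq> {}" using A(3) by auto
      then have z: "z \<in> A" "\<And>x. x \<in> A \<Longrightarrow> x \<le> z" unfolding z_def using A(2) by simp_all
      have B: "finite B" "card B = j" "B \<subseteq> H" using A z(1) unfolding B_def by auto
      have sum: "\<Sum>A = \<Sum>B + z" unfolding B_def using A(2) z(1) by (simp add: sum.remove[of A z] add.commute)
      have "B \<noteq> {}" using B(2) Suc by auto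
      then have M: "Max B \<in> B" using B(1) by simp
      then have "Max B \<noteq> z" "Max B \<le> z" using z(2) unfolding B_def by blast+
      then have "Max B < z" by simp
      moreover have "\<Sum>B \<le> of_nat j * Max B"
        using sum_bounded_above[of B "\<lambda>x. x" "Max B"] B by simp
      ultimately have "\<Sum>B + z \<in> C \<longleftrightarrow> \<Sum>B \<in> G"
        using thin[of "Max B" z] M B(3) z(1) A(1) by blast
      with v[of B] B H(2) show ?thesis unfolding sum by auto
    qed
    moreover have "H \<subseteq> X" using H(2) H'(2) Y(3) by blast
    ultimately show ?thesis using H by blast
  qed
qed

text \<open>Homogeneity passes to subsets, so the exponents are treated one after another, each
  inside the set found for the previous ones.\<close>

lemma ramsey_sums_upto:
  assumes "C \<in> SS" "X \<in> SS" "unbounded X"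
  shows "\<exists>H v. H \<in> SS \<and> H \<subseteq> X \<and> unbounded H \<and>
    (\<forall>j<n. \<forall>A\<subseteq>H. finite A \<longrightarrow> card A = j \<longrightarrow> (\<Sum>A \<in> C \<longleftrightarrow> v j))"
proof (induction n)
  case 0
  show ?case using assms by blast
next
  case (Suc n)
  then obtain H v where H: "H \<in> SS" "H \<subseteq> X" "unbounded H"
    and v: "\<forall>j<n. \<forall>A\<subseteq>H. finite A \<longrightarrow> card A = j \<longrightarrow> (\<Sum>A \<in> C \<longleftrightarrow> v j)" by (elim exE conjE)
  obtain H' w where H': "H' \<in> SS" "H' \<subseteq> H" "unbounded H'"
    and w: "\<And>A. A \<subseteq> H' \<Longrightarrow> finite A \<Longrightarrow> card A = n \<Longrightarrow> \<Sum>A \<in> C \<longleftrightarrow> w"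
    using ramsey_sums[OF assms(1) H(1,3), of n] by blast
  have "\<Sum>A \<in> C \<longleftrightarrow> (v(n := w)) j" if "j < Suc n" "A \<subseteq> H'" "finite A" "card A = j" for j A
    using that v[rule_format, of j A] w[of A] H'(2) by (cases "j = n") auto
  moreover have "H' \<subseteq> X" using H(2) H'(2) by blast
  ultimately show ?case using H'(1,3) by blast
qed

subsection \<open>Van der Waerden's and Brauer's theorems\<close>

text \<open>\<open>N\<close> bounds \<open>a + k * d\<close>, the point after the last of the
  \<open>k\<close> terms, because focusing has to keep that point in range as well.\<close>

definition vdW :: "nat \<Rightarrow> nat \<Rightarrow> nat \<Rightarrow> bool" where
  "vdW k r N \<longleftrightarrow> (\<forall>c :: nat \<Rightarrow> nat. (\<forall>x. c x < r) \<longrightarrow>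
    (\<exists>a d. 0 < d \<and> a + k * d < N \<and> (\<forall>i<k. c (a + i * d) = c a)))"

text \<open>Applied below to colourings of positions by whole windows, where a colour is a
  list.\<close>

lemma vdW_finite_colours:
  fixes c :: "nat \<Rightarrow> 'b"
  assumes "vdW k (card B) N" "finite B" "\<And>x. c x \<in> B"
  shows "\<exists>a d. 0 < d \<and> a + k * d < N \<and> (\<forall>i<k. c (a + i * d) = c a)"
proof -
  obtain f where f: "bij_betw f B {..<card B}"
    using ex_bij_betw_finite_nat[OF assms(2)] by (auto simp: atLeast0LessThan)
  have "f (c x) < card B" for x using f assms(3)[of x] by (auto simp: bij_betw_def)
  with assms(1) obtain a d where "0 < d" "a + k * d < N" "\<forall>i<k. f (c (a + i * d)) = f (c a)"
    unfolding vdW_def by meson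
  moreover have "f (c x) = f (c y) \<longleftrightarrow> c x = c y" for x y
    using f assms(3) by (auto simp: bij_betw_def inj_on_eq_iff)
  ultimately show ?thesis by auto
qed

text \<open>Colour focusing: \<open>m\<close> progressions of length \<open>k\<close> in \<open>m\<close> different colours, all of which would be
  continued by the same point \<open>f\<close>. A progression of step \<open>D\<close> of windows of length \<open>N\<close> with equal colourings
  turns \<open>m\<close> focused progressions into \<open>m + 1\<close>.\<close>

definition focused :: "(nat \<Rightarrow> nat) \<Rightarrow> nat \<Rightarrow> nat \<Rightarrow> nat \<Rightarrow> nat \<Rightarrow> bool" where
  "focused c k N x m \<longleftrightarrow> (\<exists>f<N. \<exists>Col. card Col = m \<and> finite Col \<and> (\<forall>q\<in>Col. \<exists>a d. 0 < d \<and> a + k * d = f \<and>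
    (\<forall>i<k. c (x + a + i * d) = q)))"

definition ap :: "(nat \<Rightarrow> nat) \<Rightarrow> nat \<Rightarrow> nat \<Rightarrow> nat \<Rightarrow> bool" where
  "ap c l N x \<longleftrightarrow> (\<exists>a d. 0 < d \<and> a + (l - 1) * d < N \<and> (\<forall>i<l. c (x + a + i * d) = c (x + a)))"

lemma ap_mono: "ap c l N x \<Longrightarrow> N \<le> M \<Longrightarrow> ap c l M x"
  unfolding ap_def by (meson order_less_le_trans)

lemma ap_shift: "ap c l N (x + y) \<Longrightarrow> ap c l (y + N) x"
  unfolding ap_def by (elim exE conjE, rule_tac x = "y + a" in exI) (auto simp: add.assoc)

lemma colour_focusing:
  assumes k: "0 < k" and vdW: "\<And>r. \<exists>N. vdW k r N"
  shows "\<exists>N. \<forall>c. (\<forall>x. c x < r) \<longrightarrow> (\<forall>x. ap c (Suc k) N x \<or> focused c k N x m)"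
proof (induction m)
  case 0
  have "focused c k 1 x 0" for c x
    unfolding focused_def by (intro exI[of _ 0] conjI exI[of _ "{}"]) auto
  then show ?case by blast
next
  case (Suc m)
  then obtain N where N: "\<And>c x. (\<forall>x. c x < r) \<Longrightarrow> ap c (Suc k) N x \<or> focused c k N x m" by blast
  define B where "B = {xs. set xs \<subseteq> {..<r} \<and> length xs = N}"
  have fin: "finite B" unfolding B_def by (rule finite_lists_length_eq) simp
  obtain W where W: "vdW k (card B) W" using vdW by blast
  have "ap c (Suc k) (W + N) x \<or> focused c k (W + N) x (Suc m)" if c: "\<forall>x. c x < r" for c x
  proof -
    define w where "w y = map (\<lambda>i. c (x + y + i)) [0..<N]" for y
    have wB: "w y \<in> B" for y unfolding B_def w_def using c by auto
    from vdW_finite_colours[of k B W w, OF W fin wB] obtain y D where D: "0 < D" "y + k * D < W"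
      and eq: "\<forall>j<k. w (y + j * D) = w y" by auto
    have same: "c (x + (y + j * D) + i) = c (x + y + i)" if "j < k" "i < N" for i j
      using arg_cong[OF eq[rule_format, OF that(1)], of "\<lambda>xs. xs ! i"] that(2)
      by (simp add: w_def)
    show ?thesis
    proof (cases "ap c (Suc k) N (x + y)")
      case True
      from ap_mono[OF ap_shift[OF this], of "W + N"] D show ?thesis by simp
    next
      case no_ap: False
      with N[OF c] have "focused c k N (x + y) m" by blast
      then obtain f Col where f: "f < N" and Col: "card Col = m" "finite Col"
        and foc: "\<And>q. q \<in> Col \<Longrightarrow> \<exists>a d. 0 < d \<and> a + k * d = f \<and> (\<forall>i<k. c (x + y + a + i * d) = q)"
        unfolding focused_def by blast
      \<comment> \<open>Otherwise the focus would continue the progression of its colour to length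
        \<open>k + 1\<close>.\<close>
      have notin: "c (x + y + f) \<notin> Col"
      proof
        assume "c (x + y + f) \<in> Col"
        from foc[OF this] obtain a d where ad: "0 < d" "a + k * d = f"
          "\<And>i. i < k \<Longrightarrow> c (x + y + a + i * d) = c (x + y + f)" by blast
        have "c (x + y + a + i * d) = c (x + y + a)" if "i < Suc k" for i
          using that ad(3)[of i] ad(3)[of 0] ad(2) k by (cases "i = k") (auto simp: add.assoc)
        with ad f have "ap c (Suc k) N (x + y)"
          unfolding ap_def by (intro exI[of _ a] exI[of _ d]) simp
        with no_ap show False by blast
      qed
      \<comment> \<open>The new focus is the old one moved by \<open>k * D\<close>. The copies of
        the old focus form a progression of step \<open>D\<close> in a new colour; an old
        progression runs with step \<open>d + D\<close>, its \<open>i\<close>-th term being taken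
        from the \<open>i\<close>-th window.\<close>
      have "\<exists>a d'. 0 < d' \<and> a + k * d' = y + f + k * D \<and> (\<forall>i<k. c (x + a + i * d') = q)"
        if q: "q \<in> insert (c (x + y + f)) Col" for q
      proof (cases "q = c (x + y + f)")
        case True
        have "c (x + (y + f) + i * D) = q" if "i < k" for i
          using same[OF that f] True by (simp add: ac_simps)
        with D(1) show ?thesis by (intro exI[of _ "y + f"] exI[of _ D]) simp
      next
        case False
        with q foc obtain a d where ad: "0 < d" "a + k * d = f"
          "\<And>i. i < k \<Longrightarrow> c (x + y + a + i * d) = q" by blast
        have "c (x + (y + a) + i * (d + D)) = q" if "i < k" for i
        proof -
          have "i * d \<le> k * d" using that by (intro mult_le_mono1) simp
          then have "a + i * d < N" using ad(2) f by linarith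
          from same[OF that this] ad(3)[OF that] show ?thesis by (simp add: algebra_simps)
        qed
        with ad D(1) show ?thesis
          by (intro exI[of _ "y + a"] exI[of _ "d + D"]) (auto simp: algebra_simps)
      qed
      moreover have "y + f + k * D < W + N" using D(2) f by simp
      moreover have "card (insert (c (x + y + f)) Col) = Suc m" using Col notin by simp
      ultimately have "focused c k (W + N) x (Suc m)"
        unfolding focused_def using Col(2) by blast
      then show ?thesis ..
    qed
  qed
  then show ?case by blast
qed

theorem van_der_Waerden: "\<exists>N. vdW k r N"
proof (induction k arbitrary: r)
  case 0
  have "vdW 0 r 1" unfolding vdW_def by auto
  then show ?case ..
next
  case (Suc k)
  show ?case
  proof (cases "k = 0")
    case True
    have "vdW 1 r 2" unfolding vdW_def by (intro allI impI, rule exI[of _ 0], rule exI[of _ 1]) simp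
    with True show ?thesis by auto
  next
    case False
    \<comment> \<open>With \<open>r\<close> colours there cannot be \<open>r + 1\<close>
      progressions of different colours, so only the long progression remains.\<close>
    obtain N where N: "\<And>c x. (\<forall>x. c x < r) \<Longrightarrow> ap c (Suc k) N x \<or> focused c k N x (Suc r)"
      using colour_focusing[of k r "Suc r"] False Suc by blast
    have "\<exists>a d. 0 < d \<and> a + Suc k * d < 2 * N \<and> (\<forall>i<Suc k. c (a + i * d) = c a)"
      if c: "\<forall>x. c x < r" for c
    proof -
      have "\<not> focused c k N 0 (Suc r)"
      proof
        assume "focused c k N 0 (Suc r)"
        then obtain Col where Col: "card Col = Suc r" "finite Col"
          "\<And>q. q \<in> Col \<Longrightarrow> \<exists>a d. \<forall>i<k. c (0 + a + i * d) = q" unfolding focused_def by blast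
        then have "Col \<subseteq> {..<r}" using c False by (metis gr0I lessThan_iff subsetI)
        from card_mono[OF _ this] Col(1) show False by simp
      qed
      with N[OF c] obtain a d where ad: "0 < d" "a + k * d < N" "\<forall>i<Suc k. c (a + i * d) = c a"
        unfolding ap_def by (metis add_0 diff_Suc_1)
      \<comment> \<open>\<open>ap\<close> keeps the last term \<open>a + k * d\<close> below
        \<open>N\<close>; the further step demanded by \<open>vdW\<close> costs less than another
        \<open>N\<close>.\<close>
      have "d \<le> k * d" using False by simp
      then have "a + Suc k * d < 2 * N" using ad(2) unfolding mult_Suc by linarith
      with ad(1,3) show ?thesis by - (rule exI[of _ a], rule exI[of _ d], simp)
    qed
    then have "vdW (Suc k) r (2 * N)" unfolding vdW_def by blast
    then show ?thesis ..
  qed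
qed

text \<open>If a long progression \<open>a, a + d, \<dots>\<close> has colour \<open>v\<close>, then either some \<open>j d\<close> with \<open>1 \<le> j \<le> k\<close> has colour
  \<open>v\<close> as well and serves as the step, or \<open>d, 2 d, \<dots>, k d\<close> all have the other colour.\<close>

theorem Brauer:
  "\<exists>N. \<forall>v :: nat \<Rightarrow> bool. \<exists>a b. 0 < a \<and> 0 < b \<and> b < N \<and> (\<forall>i<k. a + i * b < N \<and> (v (a + i * b) \<longleftrightarrow> v b))"
proof -
  \<comment> \<open>The largest indices used below are products \<open>i * j\<close> with
    \<open>i < k\<close> and \<open>j \<le> k\<close>.\<close>
  define K where "K = Suc (k * k)"
  obtain N where N: "vdW K 2 N" using van_der_Waerden by blast
  have "\<exists>a b. 0 < a \<and> 0 < b \<and> b < N + N \<and> (\<forall>i<k. a + i * b < N + N \<and> (v (a + i * b) \<longleftrightarrow> v b))"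
    for v :: "nat \<Rightarrow> bool"
  proof -
    \<comment> \<open>Shifting by one makes the first term \<open>Suc a\<close> positive.\<close>
    define c where "c x = (if v (Suc x) then 1 else 0 :: nat)" for x
    have "c x < 2" for x unfolding c_def by simp
    then obtain a d where ad: "0 < d" "a + K * d < N" "\<And>i. i < K \<Longrightarrow> c (a + i * d) = c a"
      using N unfolding vdW_def by blast
    have v: "v (Suc a + i * d) \<longleftrightarrow> v (Suc a)" if "i < K" for i
      using ad(3)[OF that] unfolding c_def by (auto split: if_splits)
    have less: "Suc a + i * d < N + N" "i * d < N + N" if "i \<le> K" for i
    proof -
      have "i * d \<le> K * d" using that by (rule mult_le_mono1)
      then show "Suc a + i * d < N + N" "i * d < N + N" using ad(2) by linarith+
    qed
    show ?thesis
    proof (cases "\<exists>j. 1 \<le> j \<and> j \<le> k \<and> (v (j * d) \<longleftrightarrow> v (Suc a))")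
      case True
      then obtain j where j: "1 \<le> j" "j \<le> k" "v (j * d) \<longleftrightarrow> v (Suc a)" by blast
      have "Suc a + i * (j * d) < N + N \<and> (v (Suc a + i * (j * d)) \<longleftrightarrow> v (j * d))" if "i < k" for i
      proof -
        have "i * j < K" unfolding K_def using that j(2) by (simp add: mult_le_mono less_Suc_eq_le)
        from less(1)[of "i * j"] v[OF this] this j(3) show ?thesis by (simp add: mult.assoc)
      qed
      moreover have "j \<le> K" using j(2) unfolding K_def by (meson le_SucI le_square le_trans)
      ultimately show ?thesis using less(2)[of j] j(1) ad(1)
        by (intro exI[of _ "Suc a"] exI[of _ "j * d"]) simp
    next
      case False
      have "d + i * d < N + N \<and> (v (d + i * d) \<longleftrightarrow> v d)" if "i < k" for i
      proof -
        have "Suc i \<le> K" using that unfolding K_def by (meson Suc_leI le_SucI le_square le_trans)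
        moreover have "v (j * d) \<noteq> v (Suc a)" if "1 \<le> j" "j \<le> k" for j
          using False that by blast
        from this[of "Suc i"] this[of 1] have "v (Suc i * d) \<noteq> v (Suc a)" "v (1 * d) \<noteq> v (Suc a)"
          using that by simp_all
        ultimately show ?thesis using less(2)[of "Suc i"] by auto
      qed
      moreover have "d < N + N" using less(2)[of 1] unfolding K_def by simp
      ultimately show ?thesis using ad(1) by blast
    qed
  qed
  then show ?thesis by blast
qed

subsection \<open>Meaning of the formulas in the model\<close>

lemma tval_num [simp]: "tval e (num k) = of_nat k"
  by (induction k) (simp_all add: add.commute)

lemma tval_substT [simp]: "tval e (substT \<sigma> t) = tval (\<lambda>n. tval e (\<sigma> n)) t"
  by (rule eval_substT)

lemma holds_Beta [simp]:
  "holds e s (Beta c d i x) \<longleftrightarrow> beta (tval e c) (tval e d) (tval e i) = tval e x"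
  by (auto simp: Beta_def Let_def beta_eq_iff)

definition seqsum :: "mnat \<Rightarrow> mnat \<Rightarrow> mnat \<Rightarrow> mnat \<Rightarrow> bool" where
  "seqsum c d j n \<longleftrightarrow> (\<exists>a b. beta a b 0 = 0 \<and>
    (\<forall>i<j. beta a b (i + 1) = beta a b i + beta c d i) \<and> beta a b j = n)"

lemma holds_SeqSum [simp]:
  "holds e s (SeqSum c d j n) \<longleftrightarrow> seqsum (tval e c) (tval e d) (tval e j) (tval e n)"
  by (simp add: SeqSum_def seqsum_def numeral_eq_Suc)

definition pow2 :: "mnat \<Rightarrow> mnat \<Rightarrow> bool" where
  "pow2 t p \<longleftrightarrow> (\<exists>a b. beta a b 0 = 1 \<and>
    (\<forall>i<t. beta a b (i + 1) = 2 * beta a b i) \<and> beta a b t = p)"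

lemma holds_Pow2 [simp]: "holds e s (Pow2 t p) \<longleftrightarrow> pow2 (tval e t) (tval e p)"
  by (simp add: Pow2_def pow2_def numeral_eq_Suc)

lemma holds_BinExp [simp]:
  "holds e s (BinExp n m c d) \<longleftrightarrow>
    (\<forall>i j. j < i \<and> i < tval e m \<longrightarrow> beta (tval e c) (tval e d) j < beta (tval e c) (tval e d) i) \<and>
    (\<exists>a b. (\<forall>i<tval e m. pow2 (beta (tval e c) (tval e d) i) (beta a b i)) \<and>
      seqsum a b (tval e m) (tval e n))"
  by (simp add: BinExp_def numeral_eq_Suc)

text \<open>The binary expansion of a power of \<open>2\<close> has one exponent, which is therefore
  both the least and the greatest.\<close>

lemma pow2_Lambda_Mu:
  assumes "pow2 t x" "tval e n = x" "tval e l = t"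
  shows "holds e s (Lambda n l)" "holds e s (Mu n l)"
proof -
  have code: "\<exists>c d. beta c d 0 = z" for z
    using beta_code[OF arith_fun_const, of 1 z] by (metis zero_less_one)
  obtain c d where cd: "beta c d 0 = t" using code by blast
  obtain c' d' where cd': "beta c' d' 0 = x" using code by blast
  \<comment> \<open>\<open>0, x\<close> are the partial sums of the one-term sequence
    \<open>x\<close>.\<close>
  have "arith_fun (\<lambda>e. if e 0 = 0 then 0 else x)"
    by (intro arith_fun_if arith_intros)
  from beta_code[of "\<lambda>i. if i = 0 then 0 else x" 2, OF this]
  obtain a b where "\<forall>i<2. beta a b i = (if i = 0 then 0 else x)" by blast
  then have ab: "beta a b 0 = 0" "beta a b 1 = x" by simp_all
  have less1: "i < 1 \<longleftrightarrow> i = 0" for i :: mnat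
    using mnat_less_add_1_iff[of i 0] by simp
  have "seqsum c' d' 1 x"
    unfolding seqsum_def by (rule exI[of _ a], rule exI[of _ b]) (simp add: less1 ab cd')
  moreover have "\<forall>i<1. pow2 (beta c d i) (beta c' d' i)"
    using assms(1) by (simp add: less1 cd cd')
  moreover have "\<forall>i j. j < i \<and> i < 1 \<longrightarrow> beta c d j < beta c d i"
    by (auto simp: less1)
  ultimately have "holds (case_nat d (case_nat c (case_nat 0 e))) s (BinExp (upT 3 n) (V 2 \<^bold>+ One) (V 1) (V 0))"
    using assms(2) by (auto simp: numeral_eq_Suc)
  then have
    "holds (case_nat d (case_nat c (case_nat 0 e))) s
      (BinExp (upT 3 n) (V 2 \<^bold>+ One) (V 1) (V 0) \<^bold>\<and> Beta (V 1) (V 0) Zero (upT 3 l))"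
    "holds (case_nat d (case_nat c (case_nat 0 e))) s
      (BinExp (upT 3 n) (V 2 \<^bold>+ One) (V 1) (V 0) \<^bold>\<and> Beta (V 1) (V 0) (V 2) (upT 3 l))"
    using assms(3) cd by (simp_all del: holds_BinExp add: numeral_eq_Suc)
  then show "holds e s (Lambda n l)" "holds e s (Mu n l)"
    unfolding Lambda_def Mu_def holds_simps by blast+
qed

section \<open>Powers of two as an unbounded set of the model\<close>

lemma pow2_chain:
  assumes "beta a b 0 = 1" "\<forall>i<t. beta a b (i + 1) = 2 * beta a b i" "i \<le> t"
  shows "i < beta a b i"
    and "j \<le> i \<Longrightarrow> beta a b j \<le> beta a b i"
proof -
  have "i \<le> t \<longrightarrow> i < beta a b i \<and> (\<forall>j\<le>i. beta a b j \<le> beta a b i)"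
  proof (rule mnat_induct[of "\<lambda>i. i \<le> t \<longrightarrow> i < beta a b i \<and> (\<forall>j\<le>i. beta a b j \<le> beta a b i)"])
    show "arith (\<lambda>e. e 0 \<le> t \<longrightarrow> e 0 < beta a b (e 0) \<and> (\<forall>j\<le>e 0. beta a b j \<le> beta a b (e 0)))"
      by (intro arith_intros arith_fun_beta)
    show "0 \<le> t \<longrightarrow> 0 < beta a b 0 \<and> (\<forall>j\<le>0. beta a b j \<le> beta a b 0)"
      using assms(1) by simp
    fix i assume IH: "i \<le> t \<longrightarrow> i < beta a b i \<and> (\<forall>j\<le>i. beta a b j \<le> beta a b i)"
    show "i + 1 \<le> t \<longrightarrow> i + 1 < beta a b (i + 1) \<and> (\<forall>j\<le>i + 1. beta a b j \<le> beta a b (i + 1))"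
    proof
      assume "i + 1 \<le> t"
      then have "i < t" by (simp add: mnat_add_1_le_iff)
      with IH assms(2) have *: "i < beta a b i" "\<forall>j\<le>i. beta a b j \<le> beta a b i"
        "beta a b (i + 1) = beta a b i + beta a b i" by (auto simp: mult_2)
      then have "i + 1 \<le> beta a b i" by (simp add: mnat_add_1_le_iff)
      also have "beta a b i < beta a b i + beta a b i"
        using *(1) by (metis add_less_cancel_left add_0_right le_less_trans zero_le)
      finally have "i + 1 < beta a b i + beta a b i" .
      moreover have "beta a b j \<le> beta a b i + beta a b i" if "j \<le> i" for j
        using *(2) that by (meson add_increasing2 order_trans zero_le)
      ultimately show "i + 1 < beta a b (i + 1) \<and> (\<forall>j\<le>i + 1. beta a b j \<le> beta a b (i + 1))"
        unfolding *(3) by (auto simp: le_less[of _ "i + 1"] mnat_less_add_1_iff *(3))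
    qed
  qed
  with assms(3) show "i < beta a b i" "j \<le> i \<Longrightarrow> beta a b j \<le> beta a b i" by blast+
qed

lemma pow2_gt: "pow2 t p \<Longrightarrow> t < p"
  unfolding pow2_def using pow2_chain(1) by blast

text \<open>Doubling sequences agree on their common range, so both powers can be compared within
  the longer one.\<close>

lemma pow2_mono:
  assumes "pow2 t p" "pow2 u q" "t \<le> u"
  shows "p \<le> q"
proof -
  obtain a b where ab: "beta a b 0 = 1" "\<forall>i<t. beta a b (i + 1) = 2 * beta a b i" "beta a b t = p"
    using assms(1) unfolding pow2_def by blast
  obtain a' b' where ab': "beta a' b' 0 = 1" "\<forall>i<u. beta a' b' (i + 1) = 2 * beta a' b' i" "beta a' b' u = q"
    using assms(2) unfolding pow2_def by blast
  have "t \<le> t \<longrightarrow> beta a b t = beta a' b' t"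
  proof (rule mnat_induct[of "\<lambda>i. i \<le> t \<longrightarrow> beta a b i = beta a' b' i"])
    show "arith (\<lambda>e. e 0 \<le> t \<longrightarrow> beta a b (e 0) = beta a' b' (e 0))"
      by (intro arith_intros arith_fun_beta)
    show "0 \<le> t \<longrightarrow> beta a b 0 = beta a' b' 0" by (simp add: ab ab')
    fix i assume "i \<le> t \<longrightarrow> beta a b i = beta a' b' i"
    then show "i + 1 \<le> t \<longrightarrow> beta a b (i + 1) = beta a' b' (i + 1)"
      using ab(2) ab'(2) assms(3) by (auto simp: mnat_add_1_le_iff)
  qed
  with pow2_chain(2)[OF ab'(1,2) order_refl assms(3)] show ?thesis by (simp add: ab(3) ab'(3))
qed

lemma pow2_ex: "\<exists>p. pow2 t p"
proof -
  have "\<exists>a b. beta a b 0 = 1 \<and> (\<forall>i<t. beta a b (i + 1) = 2 * beta a b i)"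
  proof (rule mnat_induct[of "\<lambda>t. \<exists>a b. beta a b 0 = 1 \<and> (\<forall>i<t. beta a b (i + 1) = 2 * beta a b i)"])
    show "arith (\<lambda>e. \<exists>a b. beta a b 0 = 1 \<and> (\<forall>i<e 0. beta a b (i + 1) = 2 * beta a b i))"
      by (intro arith_intros arith_fun_beta)
    have "\<exists>a b. beta a b 0 = 1"
      using beta_code[OF arith_fun_const, of 1 1] by (metis zero_less_one)
    then show "\<exists>a b. beta a b 0 = 1 \<and> (\<forall>i<0. beta a b (i + 1) = 2 * beta a b i)" by simp
    fix t assume "\<exists>a b. beta a b 0 = 1 \<and> (\<forall>i<t. beta a b (i + 1) = 2 * beta a b i)"
    then obtain a b where ab: "beta a b 0 = 1" "\<forall>i<t. beta a b (i + 1) = 2 * beta a b i" by blast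
    \<comment> \<open>The chain for \<open>t\<close> has the entries \<open>0\<close> to
      \<open>t\<close>; the new one ends at index \<open>t + 1\<close>, hence the length
      \<open>t + 1 + 1\<close> below.\<close>
    define F where "F i = (if i \<le> t then beta a b i else 2 * beta a b t)" for i
    have "arith_fun (\<lambda>e. F (e 0))"
      unfolding F_def by (intro arith_fun_if arith_intros arith_fun_beta)
    from beta_code[OF this, of "t + 1 + 1"]
    obtain c d where "\<forall>i<t + 1 + 1. beta c d i = F i" by blast
    then have F: "beta c d i = F i" if "i \<le> t + 1" for i
      using that by (simp add: mnat_less_add_1_iff)
    have "beta c d (i + 1) = 2 * beta c d i" if "i \<le> t" for i
    proof -
      have "i \<le> t + 1" using that by (simp add: add_increasing2)
      moreover have "i + 1 \<le> t \<longleftrightarrow> i < t" by (rule mnat_add_1_le_iff)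
      ultimately show ?thesis
        using that ab(2) F[of "i + 1"] F[of i] by (auto simp: F_def)
    qed
    moreover have "beta c d 0 = 1" using F[of 0] ab(1) by (simp add: F_def)
    ultimately show "\<exists>a b. beta a b 0 = 1 \<and> (\<forall>i<t + 1. beta a b (i + 1) = 2 * beta a b i)"
      by (auto simp: mnat_less_add_1_iff)
  qed
  then show ?thesis unfolding pow2_def by blast
qed

definition Powers :: "mnat set" where "Powers = {p. \<exists>t. pow2 t p}"

lemma Powers: "Powers \<in> SS" "unbounded Powers"
proof -
  show "Powers \<in> SS"
    unfolding Powers_def pow2_def by (rule SS_comprehension) (intro arith_intros arith_fun_beta)
  show "unbounded Powers"
    unfolding unbounded_def Powers_def using pow2_ex pow2_gt by blast
qed

lemma holds_Apart:
  assumes "s X \<subseteq> Powers"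
  shows "holds e s (Apart X)"
proof -
  have "\<exists>u l. holds (case_nat l (case_nat u (case_nat y (case_nat x e)))) s (Mu (V 3) (V 1)) \<and>
      holds (case_nat l (case_nat u (case_nat y (case_nat x e)))) s (Lambda (V 2) (V 0)) \<and> u < l"
    if xy: "x \<in> s X" "y \<in> s X" "x < y" for x y
  proof -
    obtain u l where ul: "pow2 u x" "pow2 l y" using xy assms unfolding Powers_def by blast
    have "u < l" using pow2_mono[OF ul(2,1)] xy(3) by (meson not_le)
    with ul show ?thesis
      by (intro exI[of _ u] exI[of _ l] conjI pow2_Lambda_Mu) (auto simp: numeral_eq_Suc)
  qed
  then show ?thesis unfolding Apart_def by simp
qed

text \<open>The standard numbers form an initial segment of the model, so quantifiers bounded by
  \<open>num k\<close> range over actual numbers.\<close>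

lemma less_of_nat: "x < of_nat k \<Longrightarrow> \<exists>i<k. x = (of_nat i :: mnat)"
proof (induction k)
  case (Suc k)
  then have "x \<le> of_nat k"
    using mnat_less_add_1_iff[of x "of_nat k"] by (simp add: add.commute)
  with Suc.IH show ?case by (auto simp: le_less intro: less_SucI)
qed simp

text \<open>For standard \<open>J\<close> the coded partial sums can be followed by an induction
  outside the model, which yields a genuine finite sum. This direction suffices because
  \<open>FS\<close> is the hypothesis in \<open>Monochromatic\<close>.\<close>

lemma holds_SumOf_sum:
  assumes "holds e s (SumOf j X n)" "tval e j = of_nat J"
  shows "\<exists>A\<subseteq>s X. finite A \<and> card A = J \<and> \<Sum>A = tval e n"
proof -
  from assms obtain c d where mem: "\<forall>i<of_nat J. beta c d i \<in> s X"
    and dist: "\<forall>i j. j < i \<and> i < of_nat J \<longrightarrow> beta c d j \<noteq> beta c d i"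
    and sum: "seqsum c d (of_nat J) (tval e n)"
    by (auto simp: SumOf_def numeral_eq_Suc)
  define f where "f i = beta c d (of_nat i)" for i :: nat
  obtain a b where ab: "beta a b 0 = 0" "\<forall>i<of_nat J. beta a b (i + 1) = beta a b i + beta c d i"
    "beta a b (of_nat J) = tval e n"
    using sum unfolding seqsum_def by blast
  have "j \<le> J \<Longrightarrow> beta a b (of_nat j) = (\<Sum>i<j. f i)" for j
  proof (induction j)
    case (Suc j)
    then have "of_nat j < (of_nat J :: mnat)" by simp
    with ab(2) have "beta a b (of_nat j + 1) = beta a b (of_nat j) + beta c d (of_nat j)" by blast
    with Suc show ?case by (simp add: f_def add.commute)
  qed (simp add: ab)
  with ab(3) have "(\<Sum>i<J. f i) = tval e n" by simp
  moreover have inj: "inj_on f {..<J}"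
  proof (rule linorder_inj_onI)
    fix i j assume "i < j" "i \<in> {..<J}" "j \<in> {..<J}"
    then have "(of_nat i :: mnat) < of_nat j" "(of_nat j :: mnat) < of_nat J" by simp_all
    with dist show "f i \<noteq> f j" unfolding f_def by blast
  qed auto
  moreover have "f ` {..<J} \<subseteq> s X" using mem unfolding f_def by auto
  ultimately show ?thesis
    by (intro exI[of _ "f ` {..<J}"]) (simp add: card_image sum.reindex)
qed

section \<open>Pairs and colourings\<close>

definition pr :: "mnat \<Rightarrow> mnat \<Rightarrow> mnat" where
  "pr x y = (x + y) * (x + y) + x"

text \<open>With \<open>u = x + y\<close> the value lies between \<open>u * u\<close> and
  \<open>u * u + u\<close>, below the next square. So it determines \<open>u\<close>, then
  \<open>x\<close> and \<open>y\<close>.\<close>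

lemma pr_inject: "pr x y = pr x' y' \<longleftrightarrow> x = x' \<and> y = y'"
proof -
  have square: "u * u + u < (u + 1) * (u + 1)" for u :: mnat
  proof -
    have "u * u + u + 0 < u * u + u + (u + 1)"
      by (rule add_strict_left_mono) (simp add: mnat_less_add_1_iff)
    also have "u * u + u + (u + 1) = (u + 1) * (u + 1)" by (simp add: algebra_simps)
    finally show ?thesis by simp
  qed
  have less: "pr x y < pr x' y'" if "x + y < x' + y'" for x y x' y'
  proof -
    have "pr x y \<le> (x + y) * (x + y) + (x + y)" unfolding pr_def by simp
    also have "\<dots> < (x + y + 1) * (x + y + 1)" by (rule square)
    also have "\<dots> \<le> (x' + y') * (x' + y')"
      using that by (intro mult_mono) (simp_all add: mnat_add_1_le_iff)
    also have "\<dots> \<le> pr x' y'" unfolding pr_def by simp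
    finally show ?thesis .
  qed
  have "x + y = x' + y'" if "pr x y = pr x' y'"
    using less[of x y x' y'] less[of x' y' x y] that by (metis less_irrefl linorder_neqE)
  then show ?thesis unfolding pr_def by auto
qed

lemma tval_pair [simp]: "tval e (pair t u) = pr (tval e t) (tval e u)"
  by (simp add: pair_def pr_def)

text \<open>Lets a colouring given as a graph be traded for the set of numbers of colour
  \<open>1\<close>.\<close>

lemma Coloring_dichotomy:
  assumes "holds e s (Coloring c)"
  shows "pr x 0 \<in> s c \<longleftrightarrow> pr x 1 \<notin> s c"
proof -
  have "holds e s (Coloring c) \<longleftrightarrow> (\<forall>n. n \<in> s c \<longrightarrow> (\<exists>x y. y < of_nat 2 \<and> n = pr x y)) \<and>
      (\<forall>x. \<exists>y. pr x y \<in> s c \<and> (\<forall>z. pr x z \<in> s c \<longrightarrow> z = y))"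
    unfolding Coloring_def
    by (simp only: holds_simps eval.simps tval_num tval_pair numeral_2_eq_2 One_nat_def nat.case
        simp_thms not_imp not_all) blast
  with assms have 1: "\<forall>n. n \<in> s c \<longrightarrow> (\<exists>x y. y < of_nat 2 \<and> n = pr x y)"
    and 2: "\<exists>y. pr x y \<in> s c \<and> (\<forall>z. pr x z \<in> s c \<longrightarrow> z = y)" for x
    by blast+
  obtain y where y: "pr x y \<in> s c" "\<And>z. pr x z \<in> s c \<Longrightarrow> z = y" using 2[of x] by blast
  obtain x' y' where "y' < of_nat 2" "pr x y = pr x' y'" using 1 y(1) by blast
  then have "y < of_nat 2" unfolding pr_inject by simp
  then obtain i where "i < 2" "y = of_nat i" using less_of_nat by blast
  then have "y = 0 \<or> y = 1" by (auto simp: less_2_cases_iff)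
  then show ?thesis using y by (metis zero_neq_one)
qed

section \<open>The combinatorial statement in the model\<close>

lemma valid_FS_AP_statement: "valid MM (FS_AP_statement k)"
  unfolding valid_def
proof (intro allI impI)
  fix e :: "nat \<Rightarrow> mnat" and s :: "nat \<Rightarrow> mnat set"
  have main: "\<exists>H. H \<in> SS \<and> unbounded H \<and> H \<subseteq> Powers \<and> (\<exists>a b. 0 < a \<and> 0 < b \<and>
      holds (case_nat b (case_nat a e)) (case_nat H (case_nat K s))
        (Monochromatic 1 (FS (AP k (V 4) (V 3) (V 0)) 0 (V 0))))"
    if K: "K \<in> SS" "holds e (case_nat K s) (Coloring 0)" for K
  proof -
    define C where "C = {x. pr x 1 \<in> K}"
    have "C \<in> SS"
      unfolding C_def pr_def by (rule SS_comprehension) (intro arith_intros K)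
    have K_iff: "pr x (of_bool v) \<in> K \<longleftrightarrow> (x \<in> C \<longleftrightarrow> v)" for x v
      using Coloring_dichotomy[OF K(2), of x] by (cases v) (simp_all add: C_def)
    from Brauer[of k] obtain N where N: "\<forall>v :: nat \<Rightarrow> bool. \<exists>a b. 0 < a \<and> 0 < b \<and> b < N \<and>
        (\<forall>i<k. a + i * b < N \<and> (v (a + i * b) \<longleftrightarrow> v b))"
      by (rule exE)
    from ramsey_sums_upto[OF \<open>C \<in> SS\<close> Powers, of N]
    obtain H v where H: "H \<in> SS" "H \<subseteq> Powers" "unbounded H"
      and v: "\<forall>j<N. \<forall>A\<subseteq>H. finite A \<longrightarrow> card A = j \<longrightarrow> (\<Sum>A \<in> C \<longleftrightarrow> v j)"
      by (elim exE conjE)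
    from N[rule_format, of v]
    obtain a b where ab: "0 < a" "0 < b" "b < N" "\<forall>i<k. a + i * b < N \<and> (v (a + i * b) \<longleftrightarrow> v b)"
      by (elim exE conjE)
    \<comment> \<open>The common colour is that of sums of \<open>b\<close> elements.\<close>
    have "pr x (of_bool (v b)) \<in> K"
      if "holds (case_nat x (case_nat m (case_nat (of_nat b) (case_nat (of_nat a) e)))) (case_nat H (case_nat K s))
        (FS (AP k (V 4) (V 3) (V 0)) 0 (V 0))" for x m
    proof -
      let ?e = "\<lambda>j. case_nat j (case_nat x (case_nat m (case_nat (of_nat b) (case_nat (of_nat a) e))))"
      from that obtain j where
        j: "(\<exists>i<of_nat k. j = of_nat a + i * of_nat b) \<or> j = of_nat b"
        and sum: "holds (?e j) (case_nat H (case_nat K s)) (SumOf (V 0) 0 (V 1))"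
        by (auto simp: FS_def AP_def numeral_eq_Suc)
      \<comment> \<open>Every exponent allowed by \<open>AP\<close> is a standard number below
        \<open>N\<close>, so \<open>v\<close> gives its colour.\<close>
      obtain J where J: "j = of_nat J" "J < N" "v J \<longleftrightarrow> v b"
      proof (cases "j = of_nat b")
        case True
        with ab(3) show ?thesis by (intro that) auto
      next
        case False
        with j obtain i where "i < of_nat k" "j = of_nat a + i * of_nat b" by blast
        moreover from this(1) obtain i' where "i' < k" "i = of_nat i'" using less_of_nat by blast
        ultimately show ?thesis using ab(4) by (intro that[of "a + i' * b"]) simp_all
      qed
      with holds_SumOf_sum[OF sum, of J] obtain A where A: "A \<subseteq> H" "finite A" "card A = J" "\<Sum>A = x"
        by auto
      with v J(2,3) show ?thesis unfolding K_iff by blast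
    qed
    then have "holds (case_nat (of_nat b) (case_nat (of_nat a) e)) (case_nat H (case_nat K s))
        (Monochromatic 1 (FS (AP k (V 4) (V 3) (V 0)) 0 (V 0)))"
      unfolding Monochromatic_def by (auto intro!: exI[of _ "of_bool (v b) :: mnat"])
    with H ab(1,2) show ?thesis
      by (intro exI[of _ H] conjI exI[of _ "of_nat a :: mnat"] exI[of _ "of_nat b :: mnat"]) simp_all
  qed
  have inf: "holds e' s' (Infinite 0)" if "unbounded (s' 0)" for e' s'
    using that by (auto simp: Infinite_def unbounded_def)
  have pos: "holds e' s' (Positive 0)" if "s' 0 \<subseteq> Powers" for e' s'
  proof -
    have "0 < x" if "x \<in> s' 0" for x
      using that \<open>s' 0 \<subseteq> Powers\<close> le_less_trans[OF zero_le pow2_gt] unfolding Powers_def by blast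
    then show ?thesis by (simp add: Positive_def)
  qed
  have "\<exists>H\<in>SS. holds e (case_nat H (case_nat K s)) (Infinite 0) \<and>
      holds e (case_nat H (case_nat K s)) (Positive 0) \<and>
      holds e (case_nat H (case_nat K s)) (Apart 0) \<and>
      (\<exists>a b. 0 < a \<and> 0 < b \<and> holds (case_nat b (case_nat a e)) (case_nat H (case_nat K s))
        (Monochromatic 1 (FS (AP k (V 4) (V 3) (V 0)) 0 (V 0))))"
    if K: "K \<in> SS" "holds e (case_nat K s) (Coloring 0)" for K
  proof -
    from main[OF K] obtain H where H: "H \<in> SS" "unbounded H" "H \<subseteq> Powers"
      and mono: "\<exists>a b. 0 < a \<and> 0 < b \<and> holds (case_nat b (case_nat a e)) (case_nat H (case_nat K s))
        (Monochromatic 1 (FS (AP k (V 4) (V 3) (V 0)) 0 (V 0)))"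
      by (rule exE) (elim conjE, rule that)
    show ?thesis
      by (intro bexI[OF _ H(1)] conjI inf pos holds_Apart mono) (simp_all add: H)
  qed
  then show "holds e s (FS_AP_statement k)"
    unfolding FS_AP_statement_def by (simp add: zero_less_iff_neq_zero conj_ac)
qed

theorem proposition2:
  fixes k :: nat
  assumes "k > 0"
  shows "ACA0 \<turnstile> FS_AP_statement k"
  using valid_FS_AP_statement assms by (rule proves_if_valid_MM)

end
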